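(* Let $\sigma,\nu>0$ and let $\theta\in S^1e_++S^1e_-$ with $\theta\ne\pm1,\pm ij$. The bicomplex fractional Fourier transform $$\mathcal{F}^\sigma_\theta\psi(y)=\frac{(\sigma/\pi)^{1/2}}{\sqrt{1-\theta^2}}\int_{\mathbb{R}}\psi(x)\,e^{-\frac{\sigma}{1-\theta^2}(x-\theta y)^2}\,dx$$ is well-defined on the bicomplex Hilbert space $L^{2,\sigma}_{\mathbb{T}}(\mathbb{R})$. Moreover, for every $\psi\in L^{2,\sigma}_{\mathbb{T}}(\mathbb{R})$ and every $x\in\mathbb{R}$, we have $$\mathcal{F}^\sigma_\theta\psi(x)=[\mathcal{B}^{\sigma,\nu}_{\mathbb{T}}]^{-1}\left(\Gamma_\theta\,\mathcal{B}^{\sigma,\nu}_{\mathbb{T}}\psi\right)(x),$$ where $\Gamma_\theta f(Z):=f(\theta Z)$.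
   Context: Bicomplex numbers: $\mathbb{T}=\{Z=z_1+jz_2:\ z_1,z_2\in\mathbb{C}\}$ is the commutative algebra in which $i^2=j^2=-1$, $ij=ji$ and $\mathbb{C}=\mathbb{R}+i\mathbb{R}$. Put $e_\pm=\frac{1\pm ij}{2}$; then $e_\pm^2=e_\pm$, $e_+e_-=0$, $e_++e_-=1$, $e_+-e_-=ij$. Every $Z=z_1+jz_2$ is uniquely $Z=\alpha e_++\beta e_-$ with $\alpha=z_1-iz_2$, $\beta=z_1+iz_2\in\mathbb{C}$; algebraic operations are componentwise in $(\alpha,\beta)$, $e^Z=e^\alpha e_++e^\beta e_-$, and $\sqrt{\alpha e_++\beta e_-}=\sqrt{\alpha}\,e_++\sqrt{\beta}\,e_-$ with principal square roots. Set $Z^*=\overline{\alpha}e_++\overline{\beta}e_-$ and $|Z|^2=|z_1|^2+|z_2|^2=\frac{|\alpha|^2+|\beta|^2}{2}$. $S^1=\{\xi\in\mathbb{C}:|\xi|=1\}$, and $S^1e_++S^1e_-=\{\alpha e_++\beta e_-:\alpha,\beta\in S^1\}$. $\lambda$ is Lebesgue measure on $\mathbb{T}\equiv\mathbb{R}^4$ (real coordinates of $z_1,z_2$). For a $\mathbb{T}$-valued inner product, writing $\langle f,f\rangle=a\,e_++b\,e_-$ with $a,b\ge0$, the induced norm is $\|f\|^2=\frac{a+b}{2}$. $L^{2,\sigma}_{\mathbb{T}}(\mathbb{R})$ is the space of (classes of) functions $\varphi=\varphi^+e_++\varphi^-e_-:\mathbb{R}\to\mathbb{T}$ with $\varphi^\pm:\mathbb{R}\to\mathbb{C}$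 square integrable for $e^{-\sigma x^2}dx$, with inner product $\langle\varphi,\psi\rangle=\left(\frac{\sigma}{\pi}\right)^{1/2}\int_{\mathbb{R}}\varphi(x)\psi(x)^*e^{-\sigma x^2}dx$ and its induced norm. $\mathcal{H}^{2,\nu}(\mathbb{T})$ is the space of Borel measurable $f:\mathbb{T}\to\mathbb{T}$ (modulo a.e. equality) of finite induced norm for $\langle f,g\rangle=\left(\frac{\nu}{\pi}\right)^2\int_{\mathbb{T}} f(Z)g(Z)^*e^{-\nu|Z|^2}d\lambda(Z)$. A function $f:\mathbb{T}\to\mathbb{T}$ is bicomplex holomorphic if for every $Z_0\in\mathbb{T}$ the limit of $\frac{f(Z_0+H)-f(Z_0)}{H}$ as $H\to0$, $H\notin\mathcal{NC}$, exists and is finite, where $\mathcal{NC}=\{\alpha e_++\beta e_-:\alpha\beta=0\}$. $\mathcal{F}^{2,\nu}(\mathbb{T})$ is the set of bicomplex holomorphic functions on $\mathbb{T}$ belonging to $\mathcal{H}^{2,\nu}(\mathbb{T})$. The bicomplex Segal--Bargmann transform is $\mathcal{B}^{\sigma,\nu}_{\mathbb{T}}(\varphi)(Z)=\left(\frac{\sigma}{\pi}\right)^{1/2}\int_{\mathbb{R}}e^{-\sigma\left(x-\sqrt{\frac{\nu}{4\sigma}}Z\right)^2}\varphi(x)\,dx$; it is a unitary map of $L^{2,\sigma}_{\mathbb{T}}(\mathbb{R})$ onto $\mathcal{F}^{2,\nu}(\mathbb{T})$, with inverse $[\mathcal{B}^{\sigma,\nu}_{\mathbb{T}}]^{-1}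$.
   Formalization: 1−θ² is assumed invertible (for θ=e₊+i e₋ the formula divides by a zero divisor); as the integral need not converge absolutely on L^{2,σ}, it is the norm limit over [−R,R], equal to the literal integral a.e. where that converges; the identity holds for almost every x. *)

theory Defs
  imports "HOL-Analysis.Analysis"
begin

section \<open>Bicomplex numbers\<close>

text \<open>
  The pair \<open>(z1, z2)\<close> stands for \<open>z1 + j z2\<close>. The instances for products then supply the addition,
  the scaling by reals, the topology, the norm \<open>|Z|^2 = |z1|^2 + |z2|^2\<close> and, as
  \<^term>\<open>lborel :: (complex \<times> complex) measure\<close>, the Lebesgue measure of \<open>\<real>^4\<close> on the Borel sets.
\<close>

type_synonym bicomplex = "complex \<times> complex"

definition bc_of_real :: "real \<Rightarrow> bicomplex" where
  "bc_of_real r = (of_real r, 0)"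

definition bc_one :: bicomplex where
  "bc_one = (1, 0)"

definition bc_ij :: bicomplex where
  "bc_ij = (0, \<i>)"

definition bc_mult :: "bicomplex \<Rightarrow> bicomplex \<Rightarrow> bicomplex" (infixl "*\<^sub>T" 70) where
  "Z *\<^sub>T W = (fst Z * fst W - snd Z * snd W, fst Z * snd W + snd Z * fst W)"

definition bc_sq :: "bicomplex \<Rightarrow> bicomplex" where
  "bc_sq Z = Z *\<^sub>T Z"

text \<open>The idempotent components \<open>\<alpha>\<close>, \<open>\<beta>\<close> of \<open>Z = \<alpha> e\<^sub>+ + \<beta> e\<^sub>-\<close>.\<close>

definition bc_plus :: "bicomplex \<Rightarrow> complex" where
  "bc_plus Z = fst Z - \<i> * snd Z"

definition bc_minus :: "bicomplex \<Rightarrow> complex" where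
  "bc_minus Z = fst Z + \<i> * snd Z"

definition e_plus :: bicomplex where
  "e_plus = (1/2) *\<^sub>R (bc_one + bc_ij)"

definition e_minus :: bicomplex where
  "e_minus = (1/2) *\<^sub>R (bc_one - bc_ij)"

definition bc_idem :: "complex \<Rightarrow> complex \<Rightarrow> bicomplex" where
  "bc_idem \<alpha> \<beta> = (\<alpha>, 0) *\<^sub>T e_plus + (\<beta>, 0) *\<^sub>T e_minus"

definition bc_exp :: "bicomplex \<Rightarrow> bicomplex" where
  "bc_exp Z = bc_idem (exp (bc_plus Z)) (exp (bc_minus Z))"

definition bc_sqrt :: "bicomplex \<Rightarrow> bicomplex" where
  "bc_sqrt Z = bc_idem (csqrt (bc_plus Z)) (csqrt (bc_minus Z))"

definition bc_conj :: "bicomplex \<Rightarrow> bicomplex" where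
  "bc_conj Z = bc_idem (cnj (bc_plus Z)) (cnj (bc_minus Z))"

definition null_cone :: "bicomplex set" where
  "null_cone = {Z. bc_plus Z * bc_minus Z = 0}"

text \<open>Meaningful only if \<open>W\<close> is outside the null cone, i.e. invertible.\<close>

definition bc_div :: "bicomplex \<Rightarrow> bicomplex \<Rightarrow> bicomplex" (infixl "'/\<^sub>T" 70) where
  "Z /\<^sub>T W = bc_idem (bc_plus Z / bc_plus W) (bc_minus Z / bc_minus W)"

definition bc_torus :: "bicomplex set" where
  "bc_torus = {bc_idem \<alpha> \<beta> | \<alpha> \<beta>. cmod \<alpha> = 1 \<and> cmod \<beta> = 1}"

lemma bc_idem_eq: "bc_idem \<alpha> \<beta> = ((\<alpha> + \<beta>) / 2, \<i> * (\<alpha> - \<beta>) / 2)"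
  by (simp add: bc_idem_def bc_mult_def e_plus_def e_minus_def bc_one_def bc_ij_def
      scaleR_conv_of_real field_simps)

lemma bc_plus_idem [simp]: "bc_plus (bc_idem \<alpha> \<beta>) = \<alpha>"
  and bc_minus_idem [simp]: "bc_minus (bc_idem \<alpha> \<beta>) = \<beta>"
  by (simp_all add: bc_idem_eq bc_plus_def bc_minus_def field_simps)

lemma bc_idem_plus_minus [simp]: "bc_idem (bc_plus Z) (bc_minus Z) = Z"
  by (cases Z) (simp add: bc_idem_eq bc_plus_def bc_minus_def field_simps)

lemma bc_plus_mult [simp]: "bc_plus (Z *\<^sub>T W) = bc_plus Z * bc_plus W"
  and bc_minus_mult [simp]: "bc_minus (Z *\<^sub>T W) = bc_minus Z * bc_minus W"
  by (simp_all add: bc_mult_def bc_plus_def bc_minus_def algebra_simps)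

lemma bc_mult_div_cancel: "W \<notin> null_cone \<Longrightarrow> W *\<^sub>T (Z /\<^sub>T W) = Z"
  by (subst (1 2) bc_idem_plus_minus [symmetric]) (simp add: bc_div_def null_cone_def)


section \<open>The Hilbert spaces\<close>

definition bc_inner_norm :: "bicomplex \<Rightarrow> real" where
  \<comment> \<open>the induced norm, as a function of \<open>\<langle>f, f\<rangle>\<close>\<close>
  "bc_inner_norm w = sqrt ((Re (bc_plus w) + Re (bc_minus w)) / 2)"

text \<open>
  Elements of the spaces are functions, not classes; equality in the space is equality almost
  everywhere. Every class has a Borel representative.
\<close>

definition L2T :: "real \<Rightarrow> (real \<Rightarrow> bicomplex) set" where
  "L2T \<sigma> = {\<phi>. \<phi> \<in> borel_measurable lborel \<and>
     integrable lborel (\<lambda>x. (cmod (bc_plus (\<phi> x)))\<^sup>2 * exp (- \<sigma> * x\<^sup>2)) \<and>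
     integrable lborel (\<lambda>x. (cmod (bc_minus (\<phi> x)))\<^sup>2 * exp (- \<sigma> * x\<^sup>2))}"

definition L2T_inner :: "real \<Rightarrow> (real \<Rightarrow> bicomplex) \<Rightarrow> (real \<Rightarrow> bicomplex) \<Rightarrow> bicomplex" where
  "L2T_inner \<sigma> \<phi> \<psi> = sqrt (\<sigma> / pi) *\<^sub>R
     (LINT x|lborel. exp (- \<sigma> * x\<^sup>2) *\<^sub>R (\<phi> x *\<^sub>T bc_conj (\<psi> x)))"

definition L2T_norm :: "real \<Rightarrow> (real \<Rightarrow> bicomplex) \<Rightarrow> real" where
  "L2T_norm \<sigma> \<phi> = bc_inner_norm (L2T_inner \<sigma> \<phi> \<phi>)"

text \<open>
  Both components of \<open>f Z *\<^sub>T bc_conj (f Z)\<close> are non-negative reals, so integrability of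
  the integrand of \<open>\<langle>f, f\<rangle>\<close> says that the induced norm is finite.
\<close>

definition H2T :: "real \<Rightarrow> (bicomplex \<Rightarrow> bicomplex) set" where
  "H2T \<nu> = {f. f \<in> borel_measurable lborel \<and>
     integrable lborel (\<lambda>Z. exp (- \<nu> * (norm Z)\<^sup>2) *\<^sub>R (f Z *\<^sub>T bc_conj (f Z)))}"

definition bc_holomorphic :: "(bicomplex \<Rightarrow> bicomplex) \<Rightarrow> bool" where
  "bc_holomorphic f \<longleftrightarrow>
     (\<forall>Z0. \<exists>L. ((\<lambda>H. (f (Z0 + H) - f Z0) /\<^sub>T H) \<longlongrightarrow> L) (at 0 within - null_cone))"

definition F2T :: "real \<Rightarrow> (bicomplex \<Rightarrow> bicomplex) set" where
  "F2T \<nu> = {f \<in> H2T \<nu>. bc_holomorphic f}"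


section \<open>The bicomplex Segal--Bargmann transform\<close>

definition segal_bargmann :: "real \<Rightarrow> real \<Rightarrow> (real \<Rightarrow> bicomplex) \<Rightarrow> bicomplex \<Rightarrow> bicomplex" where
  "segal_bargmann \<sigma> \<nu> \<phi> Z = sqrt (\<sigma> / pi) *\<^sub>R
     (LINT x|lborel.
        bc_exp (- (\<sigma> *\<^sub>R bc_sq (bc_of_real x - sqrt (\<nu> / (4 * \<sigma>)) *\<^sub>R Z))) *\<^sub>T \<phi> x)"

text \<open>
  On the image of the transform this chooses one representative of the class of preimages.
\<close>

definition segal_bargmann_inv ::
    "real \<Rightarrow> real \<Rightarrow> (bicomplex \<Rightarrow> bicomplex) \<Rightarrow> real \<Rightarrow> bicomplex" where
  "segal_bargmann_inv \<sigma> \<nu> = inv_into (L2T \<sigma>) (segal_bargmann \<sigma> \<nu>)"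

definition Gamma_op :: "bicomplex \<Rightarrow> (bicomplex \<Rightarrow> bicomplex) \<Rightarrow> bicomplex \<Rightarrow> bicomplex" where
  "Gamma_op \<theta> f Z = f (\<theta> *\<^sub>T Z)"


section \<open>The bicomplex fractional Fourier transform\<close>

definition frft_kernel :: "real \<Rightarrow> bicomplex \<Rightarrow> real \<Rightarrow> real \<Rightarrow> bicomplex" where
  "frft_kernel \<sigma> \<theta> x y =
     bc_exp (- ((bc_of_real \<sigma> /\<^sub>T (bc_one - bc_sq \<theta>)) *\<^sub>T bc_sq (bc_of_real x - y *\<^sub>R \<theta>)))"

text \<open>The defining formula, with the integral taken over \<open>A\<close>.\<close>

definition frft_integral ::
    "real set \<Rightarrow> real \<Rightarrow> bicomplex \<Rightarrow> (real \<Rightarrow> bicomplex) \<Rightarrow> real \<Rightarrow> bicomplex" where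
  "frft_integral A \<sigma> \<theta> \<psi> y =
     (bc_of_real (sqrt (\<sigma> / pi)) /\<^sub>T bc_sqrt (bc_one - bc_sq \<theta>)) *\<^sub>T
     (LINT x:A|lborel. \<psi> x *\<^sub>T frft_kernel \<sigma> \<theta> x y)"

text \<open>
  If both components of \<open>\<theta>\<close> are unimodular, those of the kernel have modulus
  \<open>exp (- \<sigma> x^2 / 2) exp (\<sigma> y^2 / 2)\<close>, and \<open>\<psi> \<in> L2T \<sigma>\<close> only makes \<open>\<psi> x exp (- \<sigma> x^2 / 2)\<close> square
  integrable. So the integral over \<open>\<real>\<close> need not converge absolutely, and, as for the classical
  Fourier transform on \<open>L^2\<close>, it is the limit in norm of the integrals over \<open>[-R, R]\<close>, each of
  which is absolutely convergent.
\<close>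

definition is_frft ::
    "real \<Rightarrow> bicomplex \<Rightarrow> (real \<Rightarrow> bicomplex) \<Rightarrow> (real \<Rightarrow> bicomplex) \<Rightarrow> bool" where
  "is_frft \<sigma> \<theta> \<psi> g \<longleftrightarrow> g \<in> L2T \<sigma> \<and>
     (\<forall>R>0. frft_integral {-R..R} \<sigma> \<theta> \<psi> \<in> L2T \<sigma>) \<and>
     ((\<lambda>R. L2T_norm \<sigma> (\<lambda>y. frft_integral {-R..R} \<sigma> \<theta> \<psi> y - g y)) \<longlongrightarrow> 0) at_top"

definition frft :: "real \<Rightarrow> bicomplex \<Rightarrow> (real \<Rightarrow> bicomplex) \<Rightarrow> real \<Rightarrow> bicomplex" where
  "frft \<sigma> \<theta> \<psi> = (SOME g. is_frft \<sigma> \<theta> \<psi> g)"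

end

theory Submission
  imports Defs "HOL-Probability.Levy" "HOL-Complex_Analysis.Conformal_Mappings"
begin

text \<open>
  All operations are componentwise in the idempotent coordinates, so everything reduces to one complex
  component, with a parameter \<open>a\<close> of modulus \<open>1\<close> such that \<open>a\<^sup>2 \<noteq> 1\<close>.

  Expanding the square in the kernel shows that the fractional Fourier transform of \<open>f\<close> is, up to
  multiplication by Gaussian chirps before and after, the ordinary Fourier transform evaluated at
  \<open>\<sigma> * y / Im a\<close>, and the moduli of the chirps turn the weighted \<open>L\<^sup>2\<close> space into the unweighted
  one. Plancherel's inequality (\<open>Plancherel_inequality\<close>) therefore makes the truncated transforms
  contractive (\<open>sq_norm_frt_le\<close>), so they form a Cauchy family and converge in norm by completeness
  (\<open>sq_norm_complete\<close>, \<open>is_frt_exists\<close>). The limit is unique almost everywhere and agrees with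
  the integral where this converges absolutely (\<open>is_frt_AE_eq_integral\<close>).

  The relation with the Segal--Bargmann transform \<open>B\<close> is a Gaussian integral: integrating the
  fractional Fourier kernel against the kernel of \<open>B\<close> at \<open>w\<close> gives the kernel at \<open>a * w\<close>
  (\<open>gaussian_frt_kernel\<close>). By Fubini's theorem the transform of \<open>f\<close> over \<open>[-R, R]\<close> is mapped by \<open>B\<close>
  to \<open>B (f restricted to [-R, R])\<close> rotated by \<open>a\<close>. Evaluation of \<open>B\<close> at a point is continuous on the
  weighted space, so the limit \<open>h\<close> satisfies \<open>B h z = B f (a * z)\<close> (\<open>bargmann_is_frt\<close>).

  It remains to know that \<open>B\<close> is injective up to null sets and that its values are in the Fock space.
  Restricted to a vertical line, \<open>B f\<close> is a Fourier transform (\<open>bargmann_fourier\<close>). Hence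
  injectivity follows from uniqueness for the Fourier transform (\<open>fourier_eq_zero_imp_AE_zero\<close>),
  and Plancherel's inequality on every vertical line bounds the Fock norm (\<open>bargmann_fock_finite\<close>).
\<close>

section \<open>Holomorphic parameter integrals and the complex Gaussian\<close>

text \<open>
  Cauchy's inequality turns the bound \<open>G x\<close> for \<open>f\<close> on a disc into a bound for its derivative on
  the disc of half the radius, hence for the difference quotients. These are what
  dominated convergence is applied to.
\<close>

lemma holomorphic_on_lebesgue_integral:
  fixes f :: "complex \<Rightarrow> 'a \<Rightarrow> complex"
  assumes "open S"
    and meas: "\<And>z. z \<in> S \<Longrightarrow> f z \<in> borel_measurable M"
    and holo: "\<And>x. x \<in> space M \<Longrightarrow> (\<lambda>z. f z x) holomorphic_on S"
    and dom: "\<And>z0. z0 \<in> S \<Longrightarrow> \<exists>r>0. \<exists>G. cball z0 r \<subseteq> S \<and> integrable M G \<and>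
                (\<forall>z\<in>cball z0 r. \<forall>x\<in>space M. cmod (f z x) \<le> G x)"
  shows "(\<lambda>z. LINT x|M. f z x) holomorphic_on S"
  unfolding holomorphic_on_open[OF \<open>open S\<close>]
proof (intro ballI)
  fix z0 assume "z0 \<in> S"
  then obtain r G where "r > 0" and sub: "cball z0 r \<subseteq> S" and G: "integrable M G"
    and le: "\<And>z x. z \<in> cball z0 r \<Longrightarrow> x \<in> space M \<Longrightarrow> cmod (f z x) \<le> G x"
    using dom by metis
  define q where "q h x = (f (z0 + h) x - f z0 x) / h" for h x
  define d where "d x = deriv (\<lambda>z. f z x) z0" for x
  have int: "integrable M (f z)" if "z \<in> cball z0 r" for z
    by (rule Bochner_Integration.integrable_bound[OF G])
       (use that sub le meas in \<open>auto intro!: AE_I2 order_trans[OF _ abs_ge_self]\<close>)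
  have q_le: "cmod (q h x) \<le> 2 * G x / r" if "cmod h < r / 2" "x \<in> space M" for h x
  proof -
    let ?B = "cball z0 (r/2)"
    have hol: "(\<lambda>z. f z x) holomorphic_on cball z0 r"
      using holo[OF that(2)] sub by (rule holomorphic_on_subset)
    have "cmod (f (z0 + h) x - f z0 x) \<le> (2 * G x / r) * cmod ((z0 + h) - z0)"
    proof (rule field_differentiable_bound)
      show "convex (ball z0 (r/2))" by simp
      fix w assume w: "w \<in> ball z0 (r/2)"
      have sub_w: "cball w (r/2) \<subseteq> cball z0 r"
      proof
        fix y assume y: "y \<in> cball w (r/2)"
        have "dist z0 y \<le> dist z0 w + dist w y" by (rule dist_triangle)
        then show "y \<in> cball z0 r" using w y by simp
      qed
      have "w \<in> ball z0 r" using w \<open>r > 0\<close> by simp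
      then have "(\<lambda>z. f z x) field_differentiable at w"
        using hol by (meson ball_subset_cball holomorphic_on_imp_differentiable_at holomorphic_on_subset open_ball)
      then show "((\<lambda>z. f z x) has_field_derivative deriv (\<lambda>z. f z x) w) (at w within ball z0 (r/2))"
        by (metis DERIV_deriv_iff_field_differentiable has_field_derivative_at_within)
      have "cmod ((deriv ^^ 1) (\<lambda>z. f z x) w) \<le> fact 1 * G x / (r/2)^1"
      proof (rule Cauchy_inequality)
        show "(\<lambda>z. f z x) holomorphic_on ball w (r/2)" "continuous_on (cball w (r/2)) (\<lambda>z. f z x)"
          using hol sub_w ball_subset_cball holomorphic_on_imp_continuous_on
          by (meson holomorphic_on_subset order_trans)+
        show "cmod (f y x) \<le> G x" if "cmod (w - y) = r/2" for y
          using sub_w that \<open>x \<in> space M\<close> by (intro le) (auto simp: dist_norm)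
      qed (use \<open>r > 0\<close> in auto)
      then show "cmod (deriv (\<lambda>z. f z x) w) \<le> 2 * G x / r" by (simp add: field_simps)
    qed (use that \<open>r > 0\<close> in \<open>auto simp: dist_norm\<close>)
    moreover have "0 \<le> G x" using order_trans[OF norm_ge_zero le[of z0 x]] that \<open>r > 0\<close> by simp
    ultimately show ?thesis
      using \<open>r > 0\<close> by (cases "h = 0") (simp_all add: q_def norm_divide divide_le_eq)
  qed
  have q_lim: "((\<lambda>h. q h x) \<longlongrightarrow> d x) (at 0)" if "x \<in> space M" for x
  proof -
    have "(\<lambda>z. f z x) field_differentiable at z0"
      using holo[OF that] \<open>open S\<close> \<open>z0 \<in> S\<close> by (simp add: holomorphic_on_imp_differentiable_at)
    then have "((\<lambda>z. f z x) has_field_derivative d x) (at z0)"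
      by (simp add: DERIV_deriv_iff_field_differentiable d_def)
    then show ?thesis by (simp add: DERIV_def q_def)
  qed
  have q_meas: "q h \<in> borel_measurable M" if "cmod h < r / 2" for h
    unfolding q_def using that sub \<open>r > 0\<close>
    by (intro borel_measurable_divide borel_measurable_diff meas borel_measurable_const) (auto simp: dist_norm)
  have lim: "(\<lambda>n. LINT x|M. q (X n) x) \<longlonglongrightarrow> (LINT x|M. d x)"
    if X: "\<And>n. X n \<noteq> 0" "\<And>n. cmod (X n) < r / 2" "X \<longlonglongrightarrow> 0" for X
  proof (rule integral_dominated_convergence[where w = "\<lambda>x. 2 * G x / r"])
    have at: "filterlim X (at 0) sequentially" using X by (simp add: filterlim_at)
    show "AE x in M. (\<lambda>n. q (X n) x) \<longlonglongrightarrow> d x"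
      by (intro AE_I2 filterlim_compose[OF q_lim at])
    show "q (X n) \<in> borel_measurable M" for n by (rule q_meas) fact
    show "d \<in> borel_measurable M"
      by (rule borel_measurable_LIMSEQ_metric[where f = "\<lambda>n. q (X n)"])
         (use q_meas X filterlim_compose[OF q_lim at] in auto)
    show "AE x in M. cmod (q (X n) x) \<le> 2 * G x / r" for n
      by (intro AE_I2 q_le X)
  qed (use G in auto)
  have "((\<lambda>h. ((LINT x|M. f (z0 + h) x) - (LINT x|M. f z0 x)) / h) \<longlongrightarrow> (LINT x|M. d x)) (at 0)"
    unfolding tendsto_at_iff_sequentially comp_def
  proof (intro allI impI)
    fix X :: "nat \<Rightarrow> complex" assume X: "\<forall>n. X n \<in> UNIV - {0}" "X \<longlonglongrightarrow> 0"
    have "\<forall>\<^sub>F n in sequentially. cmod (X n) < r / 2"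
      using X(2) \<open>r > 0\<close> tendstoD[of X 0 sequentially "r/2"] by (simp add: dist_norm)
    then obtain N where N: "\<And>n. cmod (X (n + N)) < r / 2"
      unfolding eventually_sequentially by (meson le_add2)
    have "(\<lambda>n. LINT x|M. q (X (n + N)) x) \<longlonglongrightarrow> (LINT x|M. d x)"
      using X N by (intro lim) (auto intro: LIMSEQ_ignore_initial_segment)
    moreover have "(LINT x|M. q (X (n + N)) x) =
        ((LINT x|M. f (z0 + X (n + N)) x) - (LINT x|M. f z0 x)) / X (n + N)" for n
    proof -
      have "cmod (X (n + N)) \<le> r" using N[of n] \<open>r > 0\<close> by linarith
      then have "integrable M (f (z0 + X (n + N)))" "integrable M (f z0)"
        using \<open>r > 0\<close> by (auto intro!: int simp: dist_norm)
      then show ?thesis by (simp add: q_def)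
    qed
    ultimately show "(\<lambda>n. ((LINT x|M. f (z0 + X n) x) - (LINT x|M. f z0 x)) / X n) \<longlonglongrightarrow> (LINT x|M. d x)"
      by - (rule LIMSEQ_offset[where k = N], simp)
  qed
  then show "\<exists>f'. ((\<lambda>z. LINT x|M. f z x) has_field_derivative f') (at z0)"
    unfolding DERIV_def by blast
qed

lemma has_bochner_integral_gaussian_real:
  fixes b c :: real
  assumes "c > 0"
  shows "has_bochner_integral lborel (\<lambda>y. exp (- c * y\<^sup>2 + b * y)) (sqrt (pi / c) * exp (b\<^sup>2 / (4 * c)))"
proof -
  define K where "K = sqrt (pi / c) * exp (b\<^sup>2 / (4 * c))"
  have eq: "K * normal_density (b / (2 * c)) (1 / sqrt (2 * c)) y = exp (- c * y\<^sup>2 + b * y)" for y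
  proof -
    have nd: "normal_density (b / (2 * c)) (1 / sqrt (2 * c)) y = exp (- (y - b / (2 * c))\<^sup>2 * c) / sqrt (pi / c)"
      using assms by (simp add: normal_density_def power_divide mult.commute)
    have "b\<^sup>2 / (4 * c) + - (y - b / (2 * c))\<^sup>2 * c = - c * y\<^sup>2 + b * y"
      using assms by (simp add: power2_eq_square field_simps)
    then show ?thesis
      unfolding nd K_def using assms by (simp add: exp_add [symmetric])
  qed
  have "has_bochner_integral lborel (\<lambda>y. K * normal_density (b / (2 * c)) (1 / sqrt (2 * c)) y) (K * 1)"
    using assms by (intro has_bochner_integral_mult_right) (simp add: has_bochner_integral_iff)
  then show ?thesis unfolding eq unfolding K_def by simp
qed

lemma integrable_gaussian:
  fixes \<gamma> \<beta> :: complex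
  assumes "Re \<gamma> > 0"
  shows "integrable lborel (\<lambda>y. exp (- \<gamma> * (of_real y)\<^sup>2 + \<beta> * of_real y))"
proof (rule Bochner_Integration.integrable_bound)
  show "integrable lborel (\<lambda>y. exp (- Re \<gamma> * y\<^sup>2 + Re \<beta> * y))"
    using has_bochner_integral_gaussian_real[OF assms] by (auto simp: has_bochner_integral_iff)
qed (simp_all add: norm_exp_eq_Re flip: of_real_power)

text \<open>
  The two applications of the identity theorem below start from what is known on the positive reals.
\<close>

lemma of_real_islimpt:
  assumes "x > 0"
  shows "complex_of_real x islimpt (of_real ` {0<..})"
  unfolding islimpt_approachable
proof (intro allI impI)
  fix e :: real assume "e > 0"
  then show "\<exists>x'\<in>of_real ` {0<..}. x' \<noteq> complex_of_real x \<and> dist x' (of_real x) < e"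
    using assms by (intro bexI[of _ "of_real (x + e/2)"])
      (auto simp: dist_norm simp flip: of_real_add of_real_diff)
qed

text \<open>
  Both sides are holomorphic in each of the two parameters and agree for \<open>\<gamma> > 0\<close> and real \<open>\<beta>\<close>.
  The identity theorem first moves \<open>\<gamma>\<close> into the right half-plane and then moves \<open>\<beta>\<close> off the real axis.
  There the principal root is the continuation of the positive one.
\<close>

lemma integral_gaussian:
  fixes \<gamma> \<beta> :: complex
  assumes "Re \<gamma> > 0"
  shows "(LINT y|lborel. exp (- \<gamma> * (of_real y)\<^sup>2 + \<beta> * of_real y)) =
         of_real (sqrt pi) / csqrt \<gamma> * exp (\<beta>\<^sup>2 / (4 * \<gamma>))"
proof -
  define J where "J \<gamma> \<beta> = (LINT y|lborel. exp (- \<gamma> * (of_real y)\<^sup>2 + \<beta> * of_real y))" for \<gamma> \<beta> :: complex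
  define H where "H \<gamma> \<beta> = of_real (sqrt pi) / csqrt \<gamma> * exp (\<beta>\<^sup>2 / (4 * \<gamma>))" for \<gamma> \<beta> :: complex
  have real: "J (of_real c) (of_real b) = H (of_real c) (of_real b)" if "c > 0" for b c :: real
  proof -
    have "J (of_real c) (of_real b) = of_real (LINT y|lborel. exp (- c * y\<^sup>2 + b * y))"
      unfolding J_def by (subst integral_complex_of_real [symmetric]) (simp add: exp_of_real [symmetric])
    also have "\<dots> = H (of_real c) (of_real b)"
      using has_bochner_integral_gaussian_real[OF that, of b] that
      by (simp add: has_bochner_integral_iff H_def real_sqrt_divide exp_of_real [symmetric])
    finally show ?thesis .
  qed
  have hol\<gamma>: "(\<lambda>\<gamma>. J \<gamma> \<beta>) holomorphic_on {\<gamma>. 0 < Re \<gamma>}" for \<beta>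
    unfolding J_def
  proof (rule holomorphic_on_lebesgue_integral)
    fix \<gamma>0 :: complex assume "\<gamma>0 \<in> {\<gamma>. 0 < Re \<gamma>}"
    then have pos: "Re \<gamma>0 > 0" by simp
    have near: "Re \<gamma> \<ge> Re \<gamma>0 / 2" if "\<gamma> \<in> cball \<gamma>0 (Re \<gamma>0 / 2)" for \<gamma>
      using that abs_Re_le_cmod[of "\<gamma>0 - \<gamma>"] by (simp add: dist_norm)
    have "cball \<gamma>0 (Re \<gamma>0 / 2) \<subseteq> {\<gamma>. 0 < Re \<gamma>}"
      using near pos by force
    moreover have "cmod (exp (- \<gamma> * (of_real y)\<^sup>2 + \<beta> * of_real y)) \<le> exp (- (Re \<gamma>0 / 2) * y\<^sup>2 + Re \<beta> * y)"
      if "\<gamma> \<in> cball \<gamma>0 (Re \<gamma>0 / 2)" for \<gamma> y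
      using mult_right_mono[OF near[OF that], of "y\<^sup>2"]
      by (simp add: norm_exp_eq_Re flip: of_real_power)
    ultimately show "\<exists>r>0. \<exists>G. cball \<gamma>0 r \<subseteq> {\<gamma>. 0 < Re \<gamma>} \<and> integrable lborel G \<and>
        (\<forall>\<gamma>\<in>cball \<gamma>0 r. \<forall>y\<in>space lborel. cmod (exp (- \<gamma> * (of_real y)\<^sup>2 + \<beta> * of_real y)) \<le> G y)"
      using pos has_bochner_integral_gaussian_real[of "Re \<gamma>0 / 2" "Re \<beta>"]
      by (intro exI[of _ "Re \<gamma>0 / 2"] conjI exI[of _ "\<lambda>y. exp (- (Re \<gamma>0 / 2) * y\<^sup>2 + Re \<beta> * y)"])
         (auto simp: has_bochner_integral_iff)
  qed (auto intro!: holomorphic_intros open_halfspace_Re_gt)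
  have hol\<beta>: "(\<lambda>\<beta>. J \<gamma> \<beta>) holomorphic_on UNIV" if "Re \<gamma> > 0" for \<gamma>
    unfolding J_def
  proof (rule holomorphic_on_lebesgue_integral)
    fix \<beta>0 :: complex
    let ?G = "\<lambda>y. exp (- Re \<gamma> * y\<^sup>2 + (Re \<beta>0 + 1) * y) + exp (- Re \<gamma> * y\<^sup>2 + (Re \<beta>0 - 1) * y)"
    have "cmod (exp (- \<gamma> * (of_real y)\<^sup>2 + \<beta> * of_real y)) \<le> ?G y" if "\<beta> \<in> cball \<beta>0 1" for \<beta> y
    proof -
      have le: "Re \<beta> \<le> Re \<beta>0 + 1" "Re \<beta>0 - 1 \<le> Re \<beta>"
        using that abs_Re_le_cmod[of "\<beta>0 - \<beta>"] by (simp_all add: dist_norm)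
      have "Re \<beta> * y \<le> (Re \<beta>0 + 1) * y \<or> Re \<beta> * y \<le> (Re \<beta>0 - 1) * y"
        using mult_right_mono[OF le(1), of y] mult_right_mono_neg[OF le(2), of y] by linarith
      then have "exp (- Re \<gamma> * y\<^sup>2 + Re \<beta> * y) \<le> ?G y"
        by (elim disjE) (simp_all add: add_increasing add_increasing2)
      then show ?thesis by (simp add: norm_exp_eq_Re flip: of_real_power)
    qed
    then show "\<exists>r>0. \<exists>G. cball \<beta>0 r \<subseteq> UNIV \<and> integrable lborel G \<and>
        (\<forall>\<beta>\<in>cball \<beta>0 r. \<forall>y\<in>space lborel. cmod (exp (- \<gamma> * (of_real y)\<^sup>2 + \<beta> * of_real y)) \<le> G y)"
      using has_bochner_integral_gaussian_real[OF that]
      by (intro exI[of _ 1] conjI exI[of _ ?G] Bochner_Integration.integrable_add)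
         (auto simp: has_bochner_integral_iff)
  qed (auto intro!: holomorphic_intros)
  have holH: "(\<lambda>\<gamma>. H \<gamma> \<beta>) holomorphic_on {\<gamma>. 0 < Re \<gamma>}" for \<beta>
    unfolding H_def by (intro holomorphic_intros) (auto simp: complex_nonpos_Reals_iff)
  have step1: "J \<gamma> (of_real b) = H \<gamma> (of_real b)" if "Re \<gamma> > 0" for \<gamma> b
  proof -
    have "J \<gamma> (of_real b) - H \<gamma> (of_real b) = 0"
    proof (rule analytic_continuation[where S = "{\<gamma>. 0 < Re \<gamma>}" and U = "of_real ` {0<..}" and \<xi> = 1
          and f = "\<lambda>\<gamma>. J \<gamma> (of_real b) - H \<gamma> (of_real b)"])
      show "connected {\<gamma>. 0 < Re \<gamma>}" by (intro convex_connected convex_halfspace_Re_gt)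
      show "(1::complex) islimpt of_real ` {0<..}" using of_real_islimpt[of 1] by simp
    qed (use that real in \<open>auto intro!: holomorphic_intros hol\<gamma> holH open_halfspace_Re_gt\<close>)
    then show ?thesis by simp
  qed
  have "J \<gamma> \<beta> - H \<gamma> \<beta> = 0"
  proof (rule analytic_continuation[where S = UNIV and U = "of_real ` {0<..}" and \<xi> = 1
        and f = "\<lambda>\<beta>. J \<gamma> \<beta> - H \<gamma> \<beta>"])
    show "(\<lambda>\<beta>. J \<gamma> \<beta> - H \<gamma> \<beta>) holomorphic_on UNIV"
      using assms unfolding H_def by (intro holomorphic_intros hol\<beta>) auto
    show "(1::complex) islimpt of_real ` {0<..}" using of_real_islimpt[of 1] by simp
  qed (use assms step1 in auto)
  then show ?thesis by (simp add: J_def H_def)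
qed

section \<open>The Fourier transform on the line\<close>

definition fourier :: "(real \<Rightarrow> complex) \<Rightarrow> real \<Rightarrow> complex" where
  "fourier u \<xi> = (LINT x|lborel. u x * cis (\<xi> * x))"

lemma borel_measurable_cis [measurable]: "cis \<in> borel_measurable borel"
  by (intro borel_measurable_continuous_onI continuous_intros)

lemma borel_measurable_cnj [measurable]: "cnj \<in> borel_measurable borel"
  by (intro borel_measurable_continuous_onI continuous_intros)

lemma borel_measurable_fourier [measurable]:
  assumes [measurable]: "u \<in> borel_measurable borel"
  shows "fourier u \<in> borel_measurable borel"
proof -
  have "(\<lambda>\<xi>. LINT x|lborel. u x * cis (\<xi> * x)) \<in> borel_measurable borel"
    by (intro lborel.borel_measurable_lebesgue_integral) measurable
  then show ?thesis by (simp add: fourier_def [abs_def])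
qed

lemma integrable_mult_cis:
  assumes "integrable M u" and [measurable]: "g \<in> borel_measurable M"
  shows "integrable M (\<lambda>x. u x * cis (g x))"
  by (rule Bochner_Integration.integrable_bound[OF assms(1)])
     (use assms(1)[THEN borel_measurable_integrable] in \<open>auto simp: norm_mult\<close>)

lemma fourier_diff:
  assumes "integrable lborel u" "integrable lborel v"
  shows "fourier (\<lambda>x. u x - v x) \<xi> = fourier u \<xi> - fourier v \<xi>"
  unfolding fourier_def using assms
  by (subst Bochner_Integration.integral_diff [symmetric])
     (auto intro!: integrable_mult_cis simp: algebra_simps)

lemma norm_fourier_le: "cmod (fourier u \<xi>) \<le> (LINT x|lborel. cmod (u x))"
  using integral_norm_bound[of lborel "\<lambda>x. u x * cis (\<xi> * x)"] by (simp add: fourier_def norm_mult)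

text \<open>
  The multiplication formula, which is Fubini's theorem for \<open>u x * h \<xi> * cis (s * x * \<xi>)\<close>.
  It gives Plancherel's inequality and the intertwining relation without any triple integral.
\<close>

lemma integral_fourier_mult:
  assumes u: "integrable lborel u" and h: "integrable lborel h"
  shows "(LINT \<xi>|lborel. fourier u (s * \<xi>) * h \<xi>) = (LINT x|lborel. u x * fourier h (s * x))"
proof -
  have [measurable]: "u \<in> borel_measurable borel" "h \<in> borel_measurable borel"
    using assms by (auto dest: borel_measurable_integrable)
  have int: "integrable (lborel \<Otimes>\<^sub>M lborel) (\<lambda>(x, \<xi>). u x * h \<xi> * cis (s * x * \<xi>))"
  proof (rule lborel_pair.Fubini_integrable)
    show "AE x in lborel. integrable lborel (\<lambda>\<xi>. case (x, \<xi>) of (x, \<xi>) \<Rightarrow> u x * h \<xi> * cis (s * x * \<xi>))"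
      using h by (intro AE_I2) (auto intro!: integrable_mult_cis)
    show "integrable lborel (\<lambda>x. LINT \<xi>|lborel. cmod (case (x, \<xi>) of (x, \<xi>) \<Rightarrow> u x * h \<xi> * cis (s * x * \<xi>)))"
      using u by (simp add: norm_mult)
  qed measurable
  have "(LINT \<xi>|lborel. fourier u (s * \<xi>) * h \<xi>) = (LINT \<xi>|lborel. LINT x|lborel. u x * h \<xi> * cis (s * x * \<xi>))"
    by (simp add: fourier_def mult_ac integrable_mult_cis u flip: integral_mult_left_zero)
  also have "\<dots> = (LINT x|lborel. LINT \<xi>|lborel. u x * h \<xi> * cis (s * x * \<xi>))"
    by (rule lborel_pair.Fubini_integral[OF int])
  also have "\<dots> = (LINT x|lborel. u x * fourier h (s * x))"
    by (simp add: fourier_def mult.assoc)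
  finally show ?thesis .
qed

lemma ennreal_norm_integral_le:
  fixes f :: "'a \<Rightarrow> 'b :: {banach, second_countable_topology}"
  shows "ennreal (norm (integral\<^sup>L M f)) \<le> (\<integral>\<^sup>+x. ennreal (norm (f x)) \<partial>M)"
  by (cases "integrable M f") (simp_all add: integral_norm_bound_ennreal not_integrable_integral_eq)

text \<open>
  Schur's test for a convolution kernel: \<open>f x * f y\<close> is at most the mean of the two squares, and
  the integral of the kernel over either variable is the same number.
\<close>

lemma nn_integral_convolution_form_le:
  fixes f :: "real \<Rightarrow> real" and g :: "real \<Rightarrow> real"
  assumes [measurable]: "f \<in> borel_measurable borel" "g \<in> borel_measurable borel"
    and g: "\<And>t. g t \<ge> 0"
  shows "(\<integral>\<^sup>+x. \<integral>\<^sup>+y. ennreal (f x * f y * g (y - x)) \<partial>lborel \<partial>lborel) \<le>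
         (\<integral>\<^sup>+t. g t \<partial>lborel) * (\<integral>\<^sup>+x. ennreal ((f x)\<^sup>2) \<partial>lborel)"
proof -
  define G F where "G = (\<integral>\<^sup>+t. g t \<partial>lborel)" and "F = (\<integral>\<^sup>+x. ennreal ((f x)\<^sup>2) \<partial>lborel)"
  have shift: "(\<integral>\<^sup>+y. g (y - x) \<partial>lborel) = G" for x
    using nn_integral_real_affine[of g 1 "- x"] by (simp add: G_def)
  have shift': "(\<integral>\<^sup>+x. g (y - x) \<partial>lborel) = G" for y
    using nn_integral_real_affine[of g "-1" y] by (simp add: G_def)
  have "f x * f y * g (y - x) \<le> (f x)\<^sup>2 / 2 * g (y - x) + (f y)\<^sup>2 / 2 * g (y - x)" for x y
  proof -
    have "f x * f y \<le> (f x)\<^sup>2 / 2 + (f y)\<^sup>2 / 2"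
      using sum_squares_bound[of "f x" "f y"] by simp
    from mult_right_mono[OF this g] show ?thesis by (simp add: algebra_simps)
  qed
  then have "(\<integral>\<^sup>+x. \<integral>\<^sup>+y. ennreal (f x * f y * g (y - x)) \<partial>lborel \<partial>lborel) \<le>
      (\<integral>\<^sup>+x. \<integral>\<^sup>+y. ennreal ((f x)\<^sup>2 / 2) * ennreal (g (y - x)) + ennreal ((f y)\<^sup>2 / 2) * ennreal (g (y - x)) \<partial>lborel \<partial>lborel)"
    using g by (intro nn_integral_mono) (simp flip: ennreal_mult ennreal_plus)
  also have "\<dots> = (\<integral>\<^sup>+x. \<integral>\<^sup>+y. ennreal ((f x)\<^sup>2 / 2) * ennreal (g (y - x)) \<partial>lborel \<partial>lborel) +
      (\<integral>\<^sup>+x. \<integral>\<^sup>+y. ennreal ((f y)\<^sup>2 / 2) * ennreal (g (y - x)) \<partial>lborel \<partial>lborel)"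
    by (simp add: nn_integral_add)
  also have "(\<integral>\<^sup>+x. \<integral>\<^sup>+y. ennreal ((f y)\<^sup>2 / 2) * ennreal (g (y - x)) \<partial>lborel \<partial>lborel) =
      (\<integral>\<^sup>+y. \<integral>\<^sup>+x. ennreal ((f y)\<^sup>2 / 2) * ennreal (g (y - x)) \<partial>lborel \<partial>lborel)"
    by (rule lborel_pair.Fubini') simp
  also have "(\<integral>\<^sup>+x. \<integral>\<^sup>+y. ennreal ((f x)\<^sup>2 / 2) * ennreal (g (y - x)) \<partial>lborel \<partial>lborel) = (\<integral>\<^sup>+x. ennreal ((f x)\<^sup>2 / 2) \<partial>lborel) * G"
    by (simp add: nn_integral_cmult shift nn_integral_multc)
  also have "(\<integral>\<^sup>+y. \<integral>\<^sup>+x. ennreal ((f y)\<^sup>2 / 2) * ennreal (g (y - x)) \<partial>lborel \<partial>lborel) = (\<integral>\<^sup>+x. ennreal ((f x)\<^sup>2 / 2) \<partial>lborel) * G"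
    by (simp add: nn_integral_cmult shift' nn_integral_multc)
  also have "(\<integral>\<^sup>+x. ennreal ((f x)\<^sup>2 / 2) \<partial>lborel) * G + (\<integral>\<^sup>+x. ennreal ((f x)\<^sup>2 / 2) \<partial>lborel) * G
      = (\<integral>\<^sup>+x. ennreal ((f x)\<^sup>2 / 2) + ennreal ((f x)\<^sup>2 / 2) \<partial>lborel) * G"
    by (simp add: nn_integral_add distrib_right)
  also have "\<dots> = G * F"
    by (simp add: F_def mult.commute flip: ennreal_plus)
  finally show ?thesis by (simp add: G_def F_def)
qed

text \<open>
  With a Gaussian weight everything converges absolutely. Two uses of the multiplication formula move
  the transform from \<open>u\<close> to the weight, whose transform is again a Gaussian \<open>g\<close>. This leaves the
  quadratic form of \<open>u\<close> with convolution kernel \<open>g\<close>, and \<open>g\<close> has total mass \<open>2 * pi\<close> for every \<open>\<epsilon>\<close>.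
\<close>

lemma integral_norm_fourier_gaussian_le:
  fixes u :: "real \<Rightarrow> complex"
  assumes u: "integrable lborel u" and "\<epsilon> > 0"
  shows "(\<integral>\<^sup>+\<xi>. ennreal ((cmod (fourier u \<xi>))\<^sup>2 * exp (- \<epsilon> * \<xi>\<^sup>2)) \<partial>lborel) \<le>
         ennreal (2 * pi) * (\<integral>\<^sup>+x. ennreal ((cmod (u x))\<^sup>2) \<partial>lborel)"
proof -
  have [measurable]: "u \<in> borel_measurable borel"
    using u by (auto dest: borel_measurable_integrable)
  define w where "w \<xi> = complex_of_real (exp (- \<epsilon> * \<xi>\<^sup>2))" for \<xi>
  define g where "g t = sqrt (pi / \<epsilon>) * exp (- (1 / (4 * \<epsilon>)) * t\<^sup>2)" for t
  have [measurable]: "g \<in> borel_measurable borel" unfolding g_def by measurable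
  have [measurable]: "w \<in> borel_measurable borel" unfolding w_def by measurable
  have int_w: "integrable lborel w"
    unfolding w_def using has_bochner_integral_gaussian_real[OF \<open>\<epsilon> > 0\<close>, of 0]
    by (simp add: has_bochner_integral_iff)
  have int_fw: "integrable lborel (\<lambda>\<xi>. c \<xi> * w \<xi>)"
    if [measurable]: "c \<in> borel_measurable borel" and "\<And>\<xi>. cmod (c \<xi>) \<le> B" for c B
  proof (rule Bochner_Integration.integrable_bound)
    show "integrable lborel (\<lambda>\<xi>. B * cmod (w \<xi>))" using int_w by simp
    show "AE \<xi> in lborel. cmod (c \<xi> * w \<xi>) \<le> norm (B * cmod (w \<xi>))"
      using that(2) by (auto simp: norm_mult abs_mult intro!: mult_right_mono order_trans[OF _ abs_ge_self])
  qed measurable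
  note B = norm_fourier_le[of u]
  have fourier_w: "fourier (\<lambda>\<xi>. w \<xi> * cis (- x * \<xi>)) y = of_real (g (y - x))" for x y
  proof -
    have "fourier (\<lambda>\<xi>. w \<xi> * cis (- x * \<xi>)) y =
        (LINT \<xi>|lborel. exp (- of_real \<epsilon> * (of_real \<xi>)\<^sup>2 + (\<i> * of_real (y - x)) * of_real \<xi>))"
      unfolding fourier_def w_def
      by (intro Bochner_Integration.integral_cong refl)
         (simp add: cis_conv_exp exp_of_real [symmetric] mult_exp_exp algebra_simps)
    also have "\<dots> = of_real (sqrt pi) / csqrt (of_real \<epsilon>) * exp ((\<i> * of_real (y - x))\<^sup>2 / (4 * of_real \<epsilon>))"
      using \<open>\<epsilon> > 0\<close> by (intro integral_gaussian) simp
    also have "\<dots> = of_real (g (y - x))"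
      using \<open>\<epsilon> > 0\<close>
      by (simp add: g_def real_sqrt_divide power_mult_distrib exp_of_real [symmetric])
    finally show ?thesis .
  qed
  have inner: "fourier (\<lambda>\<xi>. cnj (fourier u \<xi>) * w \<xi>) x = cnj (LINT y|lborel. u y * of_real (g (y - x)))" for x
  proof -
    have "fourier (\<lambda>\<xi>. cnj (fourier u \<xi>) * w \<xi>) x =
        (LINT \<xi>|lborel. cnj (fourier u \<xi> * (w \<xi> * cis (- x * \<xi>))))"
      unfolding fourier_def[of "\<lambda>\<xi>. cnj (fourier u \<xi>) * w \<xi>"]
      by (intro Bochner_Integration.integral_cong refl) (simp add: w_def cis_cnj mult.assoc)
    also have "\<dots> = cnj (LINT \<xi>|lborel. fourier u \<xi> * (w \<xi> * cis (- x * \<xi>)))"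
      by (rule Bochner_Integration.integral_cnj)
    also have "\<dots> = cnj (LINT y|lborel. u y * fourier (\<lambda>\<xi>. w \<xi> * cis (- x * \<xi>)) y)"
      by (subst integral_fourier_mult[OF u, where s = 1, simplified]) (auto intro!: integrable_mult_cis int_w)
    finally show ?thesis unfolding fourier_w .
  qed
  have int1: "integrable lborel (\<lambda>\<xi>. cnj (fourier u \<xi>) * w \<xi>)"
    by (rule int_fw[OF _ order_trans[OF eq_refl B]]) simp_all
  have int2: "integrable lborel (\<lambda>\<xi>. fourier u \<xi> * (cnj (fourier u \<xi>) * w \<xi>))"
  proof -
    have "integrable lborel (\<lambda>\<xi>. (fourier u \<xi> * cnj (fourier u \<xi>)) * w \<xi>)"
      by (rule int_fw[where B = "(LINT x|lborel. cmod (u x)) * (LINT x|lborel. cmod (u x))"])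
         (auto simp: norm_mult intro!: mult_mono B)
    then show ?thesis by (simp add: mult.assoc)
  qed
  have eq: "(LINT \<xi>|lborel. fourier u \<xi> * (cnj (fourier u \<xi>) * w \<xi>)) =
      (LINT x|lborel. u x * cnj (LINT y|lborel. u y * of_real (g (y - x))))"
    using integral_fourier_mult[OF u int1, of 1] by (simp add: inner)
  have pos: "fourier u \<xi> * (cnj (fourier u \<xi>) * w \<xi>) = of_real ((cmod (fourier u \<xi>))\<^sup>2 * exp (- \<epsilon> * \<xi>\<^sup>2))" for \<xi>
    by (simp add: w_def complex_norm_square flip: mult.assoc of_real_power)
  have "(\<integral>\<^sup>+\<xi>. ennreal ((cmod (fourier u \<xi>))\<^sup>2 * exp (- \<epsilon> * \<xi>\<^sup>2)) \<partial>lborel) =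
      ennreal (LINT \<xi>|lborel. (cmod (fourier u \<xi>))\<^sup>2 * exp (- \<epsilon> * \<xi>\<^sup>2))"
    using int2 unfolding pos complex_of_real_integrable_eq by (intro nn_integral_eq_integral) auto
  also have "\<dots> \<le> ennreal (cmod (LINT \<xi>|lborel. fourier u \<xi> * (cnj (fourier u \<xi>) * w \<xi>)))"
    unfolding pos integral_complex_of_real by (intro ennreal_leI) simp
  also have "\<dots> = ennreal (cmod (LINT x|lborel. u x * cnj (LINT y|lborel. u y * of_real (g (y - x)))))"
    by (simp only: eq)
  also have "\<dots> \<le> (\<integral>\<^sup>+x. ennreal (cmod (u x * cnj (LINT y|lborel. u y * of_real (g (y - x))))) \<partial>lborel)"
    by (rule ennreal_norm_integral_le)
  also have "\<dots> \<le> (\<integral>\<^sup>+x. \<integral>\<^sup>+y. ennreal (cmod (u x) * cmod (u y) * g (y - x)) \<partial>lborel \<partial>lborel)"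
  proof (intro nn_integral_mono)
    fix x
    have "ennreal (cmod (u x * cnj (LINT y|lborel. u y * of_real (g (y - x))))) =
        ennreal (cmod (u x)) * ennreal (cmod (LINT y|lborel. u y * of_real (g (y - x))))"
      by (simp add: norm_mult ennreal_mult)
    also have "\<dots> \<le> ennreal (cmod (u x)) * (\<integral>\<^sup>+y. ennreal (cmod (u y * of_real (g (y - x)))) \<partial>lborel)"
      by (intro mult_left_mono ennreal_norm_integral_le) simp
    also have "\<dots> = (\<integral>\<^sup>+y. ennreal (cmod (u x) * cmod (u y) * g (y - x)) \<partial>lborel)"
      using \<open>\<epsilon> > 0\<close>
      by (subst nn_integral_cmult [symmetric])
         (auto intro!: nn_integral_cong simp: norm_mult g_def mult.assoc simp flip: ennreal_mult)
    finally show "ennreal (cmod (u x * cnj (LINT y|lborel. u y * of_real (g (y - x))))) \<le>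
        (\<integral>\<^sup>+y. ennreal (cmod (u x) * cmod (u y) * g (y - x)) \<partial>lborel)" .
  qed
  also have "\<dots> \<le> (\<integral>\<^sup>+t. g t \<partial>lborel) * (\<integral>\<^sup>+x. ennreal ((cmod (u x))\<^sup>2) \<partial>lborel)"
    using \<open>\<epsilon> > 0\<close> by (intro nn_integral_convolution_form_le) (auto simp: g_def)
  also have "(\<integral>\<^sup>+t. g t \<partial>lborel) = ennreal (2 * pi)"
  proof -
    have "has_bochner_integral lborel g (sqrt (pi / \<epsilon>) * (sqrt (pi / (1 / (4 * \<epsilon>))) * exp (0\<^sup>2 / (4 * (1 / (4 * \<epsilon>))))))"
      unfolding g_def
      using has_bochner_integral_gaussian_real[of "1 / (4 * \<epsilon>)" 0] \<open>\<epsilon> > 0\<close>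
      by (intro has_bochner_integral_mult_right) simp
    moreover have "sqrt (pi / \<epsilon>) * (sqrt (pi / (1 / (4 * \<epsilon>))) * exp (0\<^sup>2 / (4 * (1 / (4 * \<epsilon>))))) = 2 * pi"
      using \<open>\<epsilon> > 0\<close> by (simp add: real_sqrt_mult [symmetric] real_sqrt_mult real_sqrt_divide)
    ultimately have "integrable lborel g" "(LINT t|lborel. g t) = 2 * pi"
      by (simp_all only: has_bochner_integral_iff)
    moreover have "AE t in lborel. 0 \<le> g t" using \<open>\<epsilon> > 0\<close> by (simp add: g_def)
    ultimately show ?thesis by (simp only: nn_integral_eq_integral)
  qed
  finally show ?thesis .
qed

text \<open>
  The bound with Gaussian weight is uniform in \<open>\<epsilon>\<close>, so Fatou's lemma removes the weight.
\<close>

theorem Plancherel_inequality: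
  fixes u :: "real \<Rightarrow> complex"
  assumes u: "integrable lborel u"
  shows "(\<integral>\<^sup>+\<xi>. ennreal ((cmod (fourier u \<xi>))\<^sup>2) \<partial>lborel) \<le>
         ennreal (2 * pi) * (\<integral>\<^sup>+x. ennreal ((cmod (u x))\<^sup>2) \<partial>lborel)"
proof -
  have [measurable]: "u \<in> borel_measurable borel"
    using u by (auto dest: borel_measurable_integrable)
  define q where "q n \<xi> = (cmod (fourier u \<xi>))\<^sup>2 * exp (- (1 / real (Suc n)) * \<xi>\<^sup>2)" for n \<xi>
  have [measurable]: "q n \<in> borel_measurable borel" for n unfolding q_def by measurable
  have lim: "(\<lambda>n. ennreal (q n \<xi>)) \<longlonglongrightarrow> ennreal ((cmod (fourier u \<xi>))\<^sup>2)" for \<xi>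
  proof -
    have "(\<lambda>n. 1 / real (Suc n)) \<longlonglongrightarrow> 0" by (rule LIMSEQ_Suc[OF lim_1_over_n])
    then have "(\<lambda>n. q n \<xi>) \<longlonglongrightarrow> (cmod (fourier u \<xi>))\<^sup>2 * exp (- 0 * \<xi>\<^sup>2)"
      unfolding q_def by (intro tendsto_intros)
    then show ?thesis by (intro tendsto_ennrealI) simp
  qed
  have "(\<integral>\<^sup>+\<xi>. ennreal ((cmod (fourier u \<xi>))\<^sup>2) \<partial>lborel) = (\<integral>\<^sup>+\<xi>. liminf (\<lambda>n. ennreal (q n \<xi>)) \<partial>lborel)"
    by (intro nn_integral_cong) (simp add: lim_imp_Liminf[OF _ lim])
  also have "\<dots> \<le> liminf (\<lambda>n. \<integral>\<^sup>+\<xi>. ennreal (q n \<xi>) \<partial>lborel)"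
    by (rule nn_integral_liminf) simp
  also have "\<dots> \<le> ennreal (2 * pi) * (\<integral>\<^sup>+x. ennreal ((cmod (u x))\<^sup>2) \<partial>lborel)"
    unfolding q_def by (intro Liminf_le always_eventually allI integral_norm_fourier_gaussian_le u) simp_all
  finally show ?thesis .
qed

section \<open>Uniqueness for the Fourier transform\<close>

text \<open>
  The positive and the negative part of \<open>v\<close> have the same mass, namely the value of their transforms
  at \<open>0\<close>. After normalisation they are densities of two probability measures with the same
  characteristic function, hence equal by Levy's theorem, and two functions with disjoint supports can
  only be equal by vanishing.
\<close>

lemma fourier_real_eq_zero_imp_AE_zero:
  fixes v :: "real \<Rightarrow> real"
  assumes v: "integrable lborel v" and zero: "\<And>\<xi>. fourier (\<lambda>x. of_real (v x)) \<xi> = 0"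
  shows "AE x in lborel. v x = 0"
proof -
  have [measurable]: "v \<in> borel_measurable borel"
    using v by (auto dest: borel_measurable_integrable)
  define p n where "p x = max 0 (v x)" and "n x = max 0 (- v x)" for x
  have pn: "v x = p x - n x" "p x \<ge> 0" "n x \<ge> 0" for x by (auto simp: p_def n_def)
  have [measurable]: "p \<in> borel_measurable borel" "n \<in> borel_measurable borel"
    by (simp_all add: p_def [abs_def] n_def [abs_def])
  have int: "integrable lborel p" "integrable lborel n"
    by (rule Bochner_Integration.integrable_bound[OF v], simp, simp add: p_def n_def)+
  define m where "m = (LINT x|lborel. p x)"
  have eq: "fourier (\<lambda>x. of_real (p x)) \<xi> = fourier (\<lambda>x. of_real (n x)) \<xi>" for \<xi>
    using zero[of \<xi>] fourier_diff[of "\<lambda>x. of_real (p x)" "\<lambda>x. of_real (n x)" \<xi>] int by (simp add: pn(1))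
  have m: "(LINT x|lborel. n x) = m"
    using eq[of 0] by (simp add: fourier_def m_def)
  have "m \<ge> 0" unfolding m_def using pn by (intro integral_nonneg_AE) auto
  show ?thesis
  proof (cases "m = 0")
    case True
    then have "AE x in lborel. p x = 0" "AE x in lborel. n x = 0"
      using integral_nonneg_eq_0_iff_AE[OF int(1)] integral_nonneg_eq_0_iff_AE[OF int(2)] pn m
      by (auto simp: m_def)
    then show ?thesis by eventually_elim (simp add: pn(1))
  next
    case False
    then have "m > 0" using \<open>m \<ge> 0\<close> by simp
    define D where "D g = density lborel (\<lambda>x. ennreal (g x / m))" for g :: "real \<Rightarrow> real"
    have D: "real_distribution (D g)" "char (D g) \<xi> = fourier (\<lambda>x. of_real (g x)) \<xi> / m"
      if [measurable]: "g \<in> borel_measurable borel" and "integrable lborel g" "\<And>x. g x \<ge> 0"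
        and "(LINT x|lborel. g x) = m" for g \<xi>
    proof -
      have "emeasure (D g) (space (D g)) = 1"
        using that \<open>m > 0\<close> by (simp add: D_def emeasure_density nn_integral_eq_integral)
      then show "real_distribution (D g)"
        by (intro real_distribution.intro prob_spaceI real_distribution_axioms.intro) (auto simp: D_def)
      have "char (D g) \<xi> = (LINT x|lborel. (g x / m) *\<^sub>R cis (\<xi> * x))"
        unfolding char_def D_def using that \<open>m > 0\<close>
        by (subst integral_density) (auto simp: cis_conv_exp)
      also have "\<dots> = (LINT x|lborel. (of_real (g x) * cis (\<xi> * x)) / m)"
        by (intro Bochner_Integration.integral_cong refl) (simp add: scaleR_conv_of_real)
      finally show "char (D g) \<xi> = fourier (\<lambda>x. of_real (g x)) \<xi> / m"
        by (simp add: fourier_def)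
    qed
    have "D p = D n"
      using D[of p] D[of n] int pn m by (intro Levy_uniqueness) (auto simp: m_def eq intro!: ext)
    then have "AE x in lborel. ennreal (p x / m) = ennreal (n x / m)"
      unfolding D_def by (intro sigma_finite_measure.density_unique[OF sigma_finite_lborel]) auto
    then show ?thesis
      by eventually_elim (use \<open>m > 0\<close> pn in \<open>simp add: divide_right_mono\<close>)
  qed
qed

text \<open>
  The transform of \<open>cnj (u x)\<close> at \<open>\<xi>\<close> is the conjugate of that of \<open>u\<close> at \<open>- \<xi>\<close>, so it vanishes as
  well, and the real and the imaginary part of \<open>u\<close> can be treated separately.
\<close>

lemma fourier_eq_zero_imp_AE_zero:
  assumes u: "integrable lborel u" and zero: "\<And>\<xi>. fourier u \<xi> = 0"
  shows "AE x in lborel. u x = 0"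
proof -
  have cnj: "fourier (\<lambda>x. cnj (u x)) \<xi> = 0" for \<xi>
  proof -
    have "fourier (\<lambda>x. cnj (u x)) \<xi> = (LINT x|lborel. cnj (u x * cis (- \<xi> * x)))"
      unfolding fourier_def by (intro Bochner_Integration.integral_cong refl) (simp add: cis_cnj)
    also have "\<dots> = cnj (fourier u (- \<xi>))"
      unfolding fourier_def by (rule Bochner_Integration.integral_cnj)
    finally show ?thesis by (simp add: zero)
  qed
  have lin: "fourier (\<lambda>x. c * u x + d * cnj (u x)) \<xi> = 0" for c d \<xi>
  proof -
    have "fourier (\<lambda>x. c * u x + d * cnj (u x)) \<xi> =
        (LINT x|lborel. c * (u x * cis (\<xi> * x)) + d * (cnj (u x) * cis (\<xi> * x)))"
      unfolding fourier_def by (intro Bochner_Integration.integral_cong refl) (simp add: algebra_simps)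
    also have "\<dots> = c * fourier u \<xi> + d * fourier (\<lambda>x. cnj (u x)) \<xi>"
      unfolding fourier_def using u
      by (subst Bochner_Integration.integral_add) (auto intro!: integrable_mult_cis integrable_mult_right)
    finally show ?thesis by (simp add: zero cnj)
  qed
  have "AE x in lborel. Re (u x) = 0"
  proof (rule fourier_real_eq_zero_imp_AE_zero)
    have "complex_of_real (Re z) = 1/2 * z + 1/2 * cnj z" for z by (simp add: complex_eq_iff)
    then show "fourier (\<lambda>x. of_real (Re (u x))) \<xi> = 0" for \<xi> by (simp only: lin)
  qed (use u in simp)
  moreover have "AE x in lborel. Im (u x) = 0"
  proof (rule fourier_real_eq_zero_imp_AE_zero)
    have "complex_of_real (Im z) = (- \<i>/2) * z + (\<i>/2) * cnj z" for z by (simp add: complex_eq_iff)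
    then show "fourier (\<lambda>x. of_real (Im (u x))) \<xi> = 0" for \<xi> by (simp only: lin)
  qed (use u in simp)
  ultimately show ?thesis by eventually_elim (simp add: complex_eq_iff)
qed

section \<open>Square-integrable functions\<close>

text \<open>
  The squared norm takes values in the extended nonnegative reals, so that estimates can be stated
  before finiteness is known.
\<close>

definition sq_norm :: "'a measure \<Rightarrow> ('a \<Rightarrow> complex) \<Rightarrow> ennreal" where
  "sq_norm M f = (\<integral>\<^sup>+x. ennreal ((cmod (f x))\<^sup>2) \<partial>M)"

lemma sq_norm_diff_commute: "sq_norm M (\<lambda>x. f x - g x) = sq_norm M (\<lambda>x. g x - f x)"
  by (simp add: sq_norm_def norm_minus_commute)

lemma sq_norm_add_le:
  assumes [measurable]: "f \<in> borel_measurable M" "g \<in> borel_measurable M"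
  shows "sq_norm M (\<lambda>x. f x + g x) \<le> 2 * sq_norm M f + 2 * sq_norm M g"
proof -
  have "(cmod (f x + g x))\<^sup>2 \<le> 2 * (cmod (f x))\<^sup>2 + 2 * (cmod (g x))\<^sup>2" for x
  proof -
    have "(cmod (f x + g x))\<^sup>2 \<le> (cmod (f x) + cmod (g x))\<^sup>2"
      by (intro power_mono norm_triangle_ineq) simp
    also have "\<dots> \<le> 2 * (cmod (f x))\<^sup>2 + 2 * (cmod (g x))\<^sup>2"
      using sum_squares_bound[of "cmod (f x)" "cmod (g x)"] by (simp add: power2_sum)
    finally show ?thesis .
  qed
  then have "sq_norm M (\<lambda>x. f x + g x) \<le> (\<integral>\<^sup>+x. 2 * ennreal ((cmod (f x))\<^sup>2) + 2 * ennreal ((cmod (g x))\<^sup>2) \<partial>M)"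
    unfolding sq_norm_def
    by (intro nn_integral_mono) (simp add: ennreal_leI flip: ennreal_plus ennreal_mult ennreal_numeral)
  also have "\<dots> = 2 * sq_norm M f + 2 * sq_norm M g"
    unfolding sq_norm_def by (simp add: nn_integral_add nn_integral_cmult)
  finally show ?thesis .
qed

lemma sq_norm_triangle:
  assumes [measurable]: "f \<in> borel_measurable M" "g \<in> borel_measurable M" "h \<in> borel_measurable M"
  shows "sq_norm M (\<lambda>x. f x - h x) \<le> 2 * sq_norm M (\<lambda>x. f x - g x) + 2 * sq_norm M (\<lambda>x. g x - h x)"
  using sq_norm_add_le[of "\<lambda>x. f x - g x" M "\<lambda>x. g x - h x"] by simp

lemma sq_norm_minus_le:
  assumes [measurable]: "f \<in> borel_measurable M" "g \<in> borel_measurable M"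
  shows "sq_norm M (\<lambda>x. f x - g x) \<le> 2 * sq_norm M f + 2 * sq_norm M g"
  using sq_norm_add_le[of f M "\<lambda>x. - g x"] by (simp add: sq_norm_def)

lemma sq_norm_limit_AE_subseq:
  assumes [measurable]: "\<And>n. F n \<in> borel_measurable M" "h \<in> borel_measurable M"
    and fin: "\<And>n::nat. sq_norm M (\<lambda>x. F n x - h x) < \<infinity>"
    and lim: "(\<lambda>n. sq_norm M (\<lambda>x. F n x - h x)) \<longlonglongrightarrow> 0"
  shows "\<exists>r. strict_mono r \<and> (AE x in M. (\<lambda>n. F (r n) x) \<longlonglongrightarrow> h x)"
proof -
  have int: "integrable M (\<lambda>x. (cmod (F n x - h x))\<^sup>2)" for n
    using fin[of n] by (intro integrableI_bounded) (auto simp: sq_norm_def)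
  have "(\<lambda>n. LINT x|M. norm ((cmod (F n x - h x))\<^sup>2)) \<longlonglongrightarrow> 0"
  proof -
    have "sq_norm M (\<lambda>x. F n x - h x) = ennreal (LINT x|M. (cmod (F n x - h x))\<^sup>2)" for n
      unfolding sq_norm_def by (intro nn_integral_eq_integral int) simp
    then show ?thesis
      using lim by (simp add: ennreal_tendsto_0_iff)
  qed
  from tendsto_L1_AE_subseq[OF int this] obtain r where "strict_mono r"
    and "AE x in M. (\<lambda>n. (cmod (F (r n) x - h x))\<^sup>2) \<longlonglongrightarrow> 0" by blast
  moreover have "(\<lambda>n. F (r n) x) \<longlonglongrightarrow> h x" if "(\<lambda>n. (cmod (F (r n) x - h x))\<^sup>2) \<longlonglongrightarrow> 0" for x
    using tendsto_real_sqrt[OF that] by (simp add: tendsto_norm_zero_iff LIM_zero_iff)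
  ultimately show ?thesis by (metis (mono_tags, lifting) eventually_mono)
qed

lemma sq_norm_limit_unique:
  assumes [measurable]: "\<And>R. F R \<in> borel_measurable M" "g \<in> borel_measurable M" "h \<in> borel_measurable M"
    and g: "((\<lambda>R. sq_norm M (\<lambda>x. F R x - g x)) \<longlongrightarrow> 0) A" and "A \<noteq> bot"
    and h: "((\<lambda>R. sq_norm M (\<lambda>x. F R x - h x)) \<longlongrightarrow> 0) A"
  shows "AE x in M. g x = h x"
proof -
  have "((\<lambda>R. 2 * sq_norm M (\<lambda>x. F R x - g x) + 2 * sq_norm M (\<lambda>x. F R x - h x)) \<longlongrightarrow> 2 * 0 + 2 * 0) A"
    by (intro tendsto_add ennreal_tendsto_cmult g h) simp_all
  moreover have "sq_norm M (\<lambda>x. g x - h x) \<le> 2 * sq_norm M (\<lambda>x. F R x - g x) + 2 * sq_norm M (\<lambda>x. F R x - h x)" for R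
    using sq_norm_triangle[of g M "F R" h] by (simp add: sq_norm_diff_commute[of M g])
  ultimately have "sq_norm M (\<lambda>x. g x - h x) \<le> 0"
    by (intro tendsto_lowerbound[where F = A and a = "sq_norm M (\<lambda>x. g x - h x)", OF _ always_eventually \<open>A \<noteq> bot\<close>]) auto
  then have "AE x in M. ennreal ((cmod (g x - h x))\<^sup>2) = 0"
    by (subst nn_integral_0_iff_AE [symmetric]) (auto simp: sq_norm_def)
  then show ?thesis by eventually_elim (simp add: ennreal_eq_0_iff)
qed

text \<open>
  The Riesz--Fischer theorem for a family indexed by the reals, with the rate of convergence \<open>\<tau>\<close>
  kept. Along indices \<open>r n\<close> that grow fast enough the increments \<open>a n\<close> satisfy
  \<open>\<integral> (a n)\<^sup>2 \<le> (1/4)^n\<close>, so the sum of the \<open>2^n * (a n)\<^sup>2\<close> has a finite integral and is finite almost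
  everywhere. Since \<open>a n \<le> (1/2)^n + 2^n * (a n)\<^sup>2\<close>, the increments are then summable, and Fatou's
  lemma carries the estimate over to the pointwise limit.
\<close>

lemma sq_norm_complete:
  fixes F :: "real \<Rightarrow> 'a \<Rightarrow> complex" and \<tau> :: "real \<Rightarrow> ennreal"
  assumes [measurable]: "\<And>R. F R \<in> borel_measurable M"
    and Cauchy: "\<And>R R'. R \<le> R' \<Longrightarrow> sq_norm M (\<lambda>x. F R' x - F R x) \<le> \<tau> R"
    and \<tau>: "(\<tau> \<longlongrightarrow> 0) at_top"
  shows "\<exists>g\<in>borel_measurable M. \<forall>R. sq_norm M (\<lambda>x. F R x - g x) \<le> \<tau> R"
proof -
  have "\<exists>N. \<forall>R\<ge>N. \<tau> R \<le> ennreal ((1/4)^n)" for n :: nat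
    using order_tendstoD(2)[OF \<tau>, of "ennreal ((1/4)^n)"]
    by (auto simp: eventually_at_top_linorder intro: less_imp_le)
  then obtain N where N: "\<And>n R. R \<ge> N n \<Longrightarrow> \<tau> R \<le> ennreal ((1/4)^n)" by metis
  \<comment> \<open>The summand \<open>real n\<close> lets \<open>r\<close> pass every \<open>R\<close>, and the sum makes \<open>r\<close> increasing and \<open>r n \<ge> N n\<close>.\<close>
  define r where "r n = real n + (\<Sum>i\<le>n. \<bar>N i\<bar>)" for n
  have r_N: "r n \<ge> N n" for n
  proof -
    have "\<bar>N n\<bar> \<le> (\<Sum>i\<le>n. \<bar>N i\<bar>)" by (intro member_le_sum) auto
    then show ?thesis by (simp add: r_def)
  qed
  have r_Suc: "r n \<le> r (Suc n)" for n by (simp add: r_def)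
  define a where "a n x = cmod (F (r (Suc n)) x - F (r n) x)" for n x
  have [measurable]: "a n \<in> borel_measurable M" for n unfolding a_def by measurable
  have a_le: "(\<integral>\<^sup>+x. ennreal ((a n x)\<^sup>2) \<partial>M) \<le> ennreal ((1/4)^n)" for n
    using order_trans[OF Cauchy[OF r_Suc] N[OF r_N]] by (simp add: a_def sq_norm_def)
  have "(\<integral>\<^sup>+x. (\<Sum>n. ennreal (2^n * (a n x)\<^sup>2)) \<partial>M) = (\<Sum>n. \<integral>\<^sup>+x. ennreal (2^n * (a n x)\<^sup>2) \<partial>M)"
    by (intro nn_integral_suminf) simp
  also have "\<dots> \<le> (\<Sum>n. ennreal ((1/2)^n))"
  proof (intro suminf_le summableI)
    fix n
    have "(\<integral>\<^sup>+x. ennreal (2^n * (a n x)\<^sup>2) \<partial>M) = ennreal (2^n) * (\<integral>\<^sup>+x. ennreal ((a n x)\<^sup>2) \<partial>M)"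
      by (simp add: ennreal_mult nn_integral_cmult)
    also have "\<dots> \<le> ennreal (2^n) * ennreal ((1/4)^n)"
      by (intro mult_left_mono a_le) simp
    also have "\<dots> = ennreal ((1/2)^n)"
      by (simp add: power_mult_distrib [symmetric] flip: ennreal_mult)
    finally show "(\<integral>\<^sup>+x. ennreal (2^n * (a n x)\<^sup>2) \<partial>M) \<le> ennreal ((1/2)^n)" .
  qed
  also have "\<dots> = ennreal (\<Sum>n. (1/2)^n)"
    by (intro suminf_ennreal2) (auto intro: summable_geometric)
  finally have "(\<integral>\<^sup>+x. (\<Sum>n. ennreal (2^n * (a n x)\<^sup>2)) \<partial>M) \<noteq> \<infinity>"
    by (auto simp: top_unique)
  then have "AE x in M. (\<Sum>n. ennreal (2^n * (a n x)\<^sup>2)) \<noteq> \<infinity>"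
    by (intro nn_integral_PInf_AE) simp_all
  then have conv: "AE x in M. convergent (\<lambda>n. F (r n) x)"
  proof eventually_elim
    case (elim x)
    then have "summable (\<lambda>n. 2^n * (a n x)\<^sup>2)"
      by (intro summable_suminf_not_top) auto
    then have "summable (\<lambda>n. (1/2)^n + 2^n * (a n x)\<^sup>2)"
      by (intro summable_add summable_geometric) auto
    moreover have "norm (F (r (Suc n)) x - F (r n) x) \<le> (1/2)^n + 2^n * (a n x)\<^sup>2" for n
    proof -
      have "a n x \<le> (1/2)^n + 2^n * (a n x)\<^sup>2"
      proof (cases "a n x \<le> (1/2)^n")
        case True
        then show ?thesis by (simp add: add_increasing2)
      next
        case False
        then have "1 \<le> 2^n * a n x" by (simp add: power_divide field_simps)
        then have "1 * a n x \<le> (2^n * a n x) * a n x" by (intro mult_right_mono) (auto simp: a_def)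
        then show ?thesis by (simp add: power2_eq_square mult.assoc add_increasing)
      qed
      then show ?thesis by (simp add: a_def)
    qed
    ultimately have "summable (\<lambda>n. F (r (Suc n)) x - F (r n) x)"
      by (rule summable_comparison_test'[where N = 0])
    then have "convergent (\<lambda>n. \<Sum>i<n. F (r (Suc i)) x - F (r i) x)"
      by (simp add: summable_iff_convergent)
    then have "convergent (\<lambda>n. F (r n) x - F (r 0) x)"
      by (simp add: sum_lessThan_telescope[of "\<lambda>n. F (r n) x"])
    then have "convergent (\<lambda>n. (F (r n) x - F (r 0) x) + F (r 0) x)"
      by (intro convergent_add convergent_const)
    then show ?case by simp
  qed
  define g where "g x = lim (\<lambda>n. F (r n) x)" for x
  have [measurable]: "g \<in> borel_measurable M"
    unfolding g_def by (intro borel_measurable_lim_metric) simp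
  have "sq_norm M (\<lambda>x. F R x - g x) \<le> \<tau> R" for R
  proof -
    have "sq_norm M (\<lambda>x. F R x - g x) = (\<integral>\<^sup>+x. liminf (\<lambda>n. ennreal ((cmod (F (r n) x - F R x))\<^sup>2)) \<partial>M)"
      unfolding sq_norm_def
    proof (intro nn_integral_cong_AE, use conv in eventually_elim)
      case (elim x)
      then have "(\<lambda>n. F (r n) x) \<longlonglongrightarrow> g x" by (simp add: g_def convergent_LIMSEQ_iff)
      then have "(\<lambda>n. ennreal ((cmod (F (r n) x - F R x))\<^sup>2)) \<longlonglongrightarrow> ennreal ((cmod (g x - F R x))\<^sup>2)"
        by (intro tendsto_ennrealI tendsto_intros)
      then have "liminf (\<lambda>n. ennreal ((cmod (F (r n) x - F R x))\<^sup>2)) = ennreal ((cmod (g x - F R x))\<^sup>2)"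
        by (intro lim_imp_Liminf) simp_all
      then show ?case by (simp only: norm_minus_commute[of "F R x" "g x"])
    qed
    also have "\<dots> \<le> liminf (\<lambda>n. sq_norm M (\<lambda>x. F (r n) x - F R x))"
      unfolding sq_norm_def by (intro nn_integral_liminf) simp
    also have "\<dots> \<le> \<tau> R"
    proof (rule Liminf_le)
    have "\<forall>\<^sub>F n in sequentially. R \<le> real n"
        by (intro filterlim_at_top[THEN iffD1, rule_format] filterlim_real_sequentially)
      then show "\<forall>\<^sub>F n in sequentially. sq_norm M (\<lambda>x. F (r n) x - F R x) \<le> \<tau> R"
      proof eventually_elim
        case (elim n)
        then have "R \<le> r n" by (simp add: r_def add_increasing2 sum_nonneg)
        then show ?case by (rule Cauchy)
      qed
    qed simp
    finally show ?thesis .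
  qed
  then show ?thesis by (intro bexI[of _ g]) auto
qed

section \<open>The Gaussian weighted space of one idempotent component\<close>

definition gauss :: "real \<Rightarrow> real measure" where
  "gauss \<sigma> = density lborel (\<lambda>x. ennreal (exp (- \<sigma> * x\<^sup>2)))"

definition L2G :: "real \<Rightarrow> (real \<Rightarrow> complex) set" where
  "L2G \<sigma> = {f \<in> borel_measurable borel. sq_norm (gauss \<sigma>) f < \<infinity>}"

lemma sets_gauss [simp, measurable_cong]: "sets (gauss \<sigma>) = sets borel"
  by (simp add: gauss_def)

lemma AE_gauss: "(AE x in gauss \<sigma>. P x) \<longleftrightarrow> (AE x in lborel. P x)"
  unfolding gauss_def by (subst AE_density) auto

lemma sq_norm_gauss:
  assumes [measurable]: "f \<in> borel_measurable borel"
  shows "sq_norm (gauss \<sigma>) f = (\<integral>\<^sup>+x. ennreal ((cmod (f x))\<^sup>2 * exp (- \<sigma> * x\<^sup>2)) \<partial>lborel)"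
  unfolding sq_norm_def gauss_def
  by (subst nn_integral_density) (auto simp: ennreal_mult mult.commute intro!: nn_integral_cong)

lemma sq_norm_mono:
  assumes "\<And>x. cmod (f x) \<le> cmod (g x)"
  shows "sq_norm M f \<le> sq_norm M g"
  unfolding sq_norm_def by (intro nn_integral_mono ennreal_leI power_mono assms) simp

lemma L2G_iff:
  "f \<in> L2G \<sigma> \<longleftrightarrow> f \<in> borel_measurable borel \<and> integrable lborel (\<lambda>x. (cmod (f x))\<^sup>2 * exp (- \<sigma> * x\<^sup>2))"
proof -
  have "sq_norm (gauss \<sigma>) f < \<infinity> \<longleftrightarrow> integrable lborel (\<lambda>x. (cmod (f x))\<^sup>2 * exp (- \<sigma> * x\<^sup>2))"
    if [measurable]: "f \<in> borel_measurable borel"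
    by (simp add: sq_norm_gauss integrable_iff_bounded abs_mult)
  then show ?thesis by (auto simp: L2G_def)
qed

lemma L2G_diff:
  assumes "f \<in> L2G \<sigma>" "g \<in> L2G \<sigma>"
  shows "(\<lambda>x. f x - g x) \<in> L2G \<sigma>"
proof -
  have [measurable]: "f \<in> borel_measurable borel" "g \<in> borel_measurable borel"
    using assms by (simp_all add: L2G_def)
  have "sq_norm (gauss \<sigma>) (\<lambda>x. f x - g x) \<le> 2 * sq_norm (gauss \<sigma>) f + 2 * sq_norm (gauss \<sigma>) g"
    by (rule sq_norm_minus_le) simp_all
  also have "\<dots> < \<infinity>" using assms by (auto simp: L2G_def ennreal_mult_less_top)
  finally show ?thesis by (simp add: L2G_def)
qed

text \<open>
  Pointwise, \<open>exp (b * x) * cmod (f x) \<le> exp (2 * b * x) + (cmod (f x))\<^sup>2\<close>.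
\<close>

lemma L2G_mult_gaussian_integrable:
  assumes f: "f \<in> L2G \<sigma>" and "\<sigma> > 0"
  shows "integrable lborel (\<lambda>x. exp (- \<sigma> * x\<^sup>2 + b * x) * cmod (f x))"
proof (rule Bochner_Integration.integrable_bound)
  have [measurable]: "f \<in> borel_measurable borel" using f by (simp add: L2G_def)
  show "integrable lborel (\<lambda>x. exp (- \<sigma> * x\<^sup>2 + 2 * b * x) + (cmod (f x))\<^sup>2 * exp (- \<sigma> * x\<^sup>2))"
    using has_bochner_integral_gaussian_real[OF \<open>\<sigma> > 0\<close>, of "2 * b"] f
    by (auto simp: L2G_iff has_bochner_integral_iff)
  show "(\<lambda>x. exp (- \<sigma> * x\<^sup>2 + b * x) * cmod (f x)) \<in> borel_measurable lborel" by measurable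
  have "exp (- \<sigma> * x\<^sup>2 + b * x) * cmod (f x) \<le> exp (- \<sigma> * x\<^sup>2 + 2 * b * x) + (cmod (f x))\<^sup>2 * exp (- \<sigma> * x\<^sup>2)" for x
  proof -
    have "exp (b * x) * cmod (f x) \<le> (exp (b * x))\<^sup>2 + (cmod (f x))\<^sup>2"
      using sum_squares_bound[of "exp (b * x)" "cmod (f x)"]
        mult_nonneg_nonneg[OF less_imp_le[OF exp_gt_zero] norm_ge_zero, of "b * x" "f x"] by linarith
    then have "exp (- \<sigma> * x\<^sup>2) * (exp (b * x) * cmod (f x)) \<le> exp (- \<sigma> * x\<^sup>2) * ((exp (b * x))\<^sup>2 + (cmod (f x))\<^sup>2)"
      by (rule mult_left_mono) simp
    moreover have "exp (- \<sigma> * x\<^sup>2 + b * x) = exp (- \<sigma> * x\<^sup>2) * exp (b * x)"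
      and "exp (- \<sigma> * x\<^sup>2 + 2 * b * x) = exp (- \<sigma> * x\<^sup>2) * (exp (b * x))\<^sup>2"
      by (simp_all only: exp_add exp_double [symmetric] mult.assoc)
    ultimately show ?thesis by (simp add: distrib_left mult_ac)
  qed
  then show "AE x in lborel. norm (exp (- \<sigma> * x\<^sup>2 + b * x) * cmod (f x)) \<le>
      norm (exp (- \<sigma> * x\<^sup>2 + 2 * b * x) + (cmod (f x))\<^sup>2 * exp (- \<sigma> * x\<^sup>2))"
    by (intro AE_I2) (simp add: abs_mult)
qed

section \<open>The fractional Fourier transform of one component\<close>

definition frt_kernel :: "real \<Rightarrow> complex \<Rightarrow> real \<Rightarrow> real \<Rightarrow> complex" where
  "frt_kernel \<sigma> a x y = exp (- (of_real \<sigma> / (1 - a\<^sup>2)) * (of_real x - of_real y * a)\<^sup>2)"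

definition frt :: "real set \<Rightarrow> real \<Rightarrow> complex \<Rightarrow> (real \<Rightarrow> complex) \<Rightarrow> real \<Rightarrow> complex" where
  "frt A \<sigma> a f y = of_real (sqrt (\<sigma> / pi)) / csqrt (1 - a\<^sup>2) *
     (LINT x|lborel. indicator A x * (f x * frt_kernel \<sigma> a x y))"

text \<open>
  For unimodular \<open>a\<close> one has \<open>1 - a\<^sup>2 = a * (cnj a - a)\<close>. This is what makes the kernel an imaginary
  exponential in \<open>x * y\<close>.
\<close>

lemma unimodular_one_minus_square:
  assumes "cmod a = 1" "a\<^sup>2 \<noteq> 1"
  shows "Im a \<noteq> 0" "Re (1 / (1 - a\<^sup>2)) = 1 / 2"
    "a / (1 - a\<^sup>2) = \<i> / (2 * Im a)" "cmod (1 - a\<^sup>2) = 2 * \<bar>Im a\<bar>"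
proof -
  have n: "a * cnj a = 1" using assms(1) by (simp add: complex_norm_square [symmetric])
  have "1 - a\<^sup>2 = - (a - cnj a) * a" using n by (simp add: algebra_simps power2_eq_square)
  also have "a - cnj a = 2 * \<i> * Im a" by (simp add: complex_eq_iff)
  finally have eq: "1 - a\<^sup>2 = - 2 * \<i> * Im a * a" by simp
  then show im: "Im a \<noteq> 0" using assms(2) by auto
  have "a \<noteq> 0" using assms by auto
  have "1 / (1 - a\<^sup>2) = \<i> * cnj a / (2 * Im a)"
    unfolding eq using n im \<open>a \<noteq> 0\<close> by (simp add: field_simps)
  then show "Re (1 / (1 - a\<^sup>2)) = 1 / 2" using im by (simp add: Re_divide power2_eq_square)
  show "a / (1 - a\<^sup>2) = \<i> / (2 * Im a)" unfolding eq using im \<open>a \<noteq> 0\<close> by (simp add: field_simps)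
  show "cmod (1 - a\<^sup>2) = 2 * \<bar>Im a\<bar>" unfolding eq using assms by (simp add: norm_mult)
qed

locale frt_parameter =
  fixes \<sigma> :: real and a :: complex
  assumes \<sigma>: "\<sigma> > 0" and a: "cmod a = 1" "a\<^sup>2 \<noteq> 1"
begin

text \<open>
  Expanding the square in the kernel, \<open>\<gamma>\<close> is the coefficient of \<open>- x\<^sup>2\<close> and \<open>\<i> * s\<close> that of \<open>x * y\<close>.
\<close>

definition \<gamma> :: complex where "\<gamma> = of_real \<sigma> / (1 - a\<^sup>2)"
definition s :: real where "s = \<sigma> / Im a"

lemma \<gamma>_props: "\<gamma> * a\<^sup>2 = \<gamma> - \<sigma>" "2 * \<gamma> * a = \<i> * s" "Re \<gamma> = \<sigma> / 2" "Re (\<gamma> * a\<^sup>2) = - \<sigma> / 2"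
  "s \<noteq> 0" "\<gamma> \<noteq> 0"
proof -
  note u = unimodular_one_minus_square[OF a]
  have "1 - a\<^sup>2 \<noteq> 0" using a by simp
  then show 1: "\<gamma> * a\<^sup>2 = \<gamma> - \<sigma>" by (simp add: \<gamma>_def field_simps)
  have "2 * \<gamma> * a = 2 * \<sigma> * (a / (1 - a\<^sup>2))" by (simp add: \<gamma>_def)
  also have "\<dots> = \<i> * s" unfolding u(3) by (simp add: s_def)
  finally show "2 * \<gamma> * a = \<i> * s" .
  have "\<gamma> = of_real \<sigma> * (1 / (1 - a\<^sup>2))" by (simp add: \<gamma>_def)
  then show 2: "Re \<gamma> = \<sigma> / 2" using u(2)
    by (metis Re_complex_of_real Im_complex_of_real diff_zero mult_zero_left times_complex.simps(1)
        times_divide_eq_right mult.right_neutral)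
  show "Re (\<gamma> * a\<^sup>2) = - \<sigma> / 2" unfolding 1 using 2 by simp
  show "s \<noteq> 0" using \<sigma> u(1) by (simp add: s_def)
  show "\<gamma> \<noteq> 0" using 2 \<sigma> by auto
qed

text \<open>
  Up to the factors that depend on \<open>x\<close> or on \<open>y\<close> alone, the fractional Fourier transform is the
  Fourier transform taken at \<open>s * y\<close>.
\<close>

lemma frt_kernel_factor:
  "frt_kernel \<sigma> a x y = exp (- \<gamma> * (of_real x)\<^sup>2) * exp (- (\<gamma> * a\<^sup>2) * (of_real y)\<^sup>2) * cis (s * y * x)"
proof -
  have "- \<gamma> * (of_real x - of_real y * a)\<^sup>2 =
      - \<gamma> * (of_real x)\<^sup>2 + - (\<gamma> * a\<^sup>2) * (of_real y)\<^sup>2 + (2 * \<gamma> * a) * of_real (y * x)"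
    by (simp add: power2_eq_square algebra_simps)
  then have "frt_kernel \<sigma> a x y =
      exp (- \<gamma> * (of_real x)\<^sup>2 + - (\<gamma> * a\<^sup>2) * (of_real y)\<^sup>2 + \<i> * s * of_real (y * x))"
    by (simp only: frt_kernel_def \<gamma>_def [symmetric] \<gamma>_props(2))
  also have "\<i> * s * of_real (y * x) = \<i> * of_real (s * y * x)" by simp
  finally show ?thesis by (simp only: exp_add cis_conv_exp)
qed

text \<open>
  These moduli are the square roots of the Gaussian weight and of its inverse: both weighted spaces
  become the unweighted one on the two sides of the Fourier transform.
\<close>

lemma norm_exp_\<gamma>: "cmod (exp (- \<gamma> * (of_real x)\<^sup>2)) = exp (- \<sigma> * x\<^sup>2 / 2)"
  "cmod (exp (- (\<gamma> * a\<^sup>2) * (of_real y)\<^sup>2)) = exp (\<sigma> * y\<^sup>2 / 2)"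
  using \<gamma>_props(3,4) by (simp_all add: norm_exp_eq_Re flip: of_real_power)

definition chirped :: "real set \<Rightarrow> (real \<Rightarrow> complex) \<Rightarrow> real \<Rightarrow> complex" where
  "chirped A f x = indicator A x * (f x * exp (- \<gamma> * (of_real x)\<^sup>2))"

lemma frt_eq_fourier:
  "frt A \<sigma> a f y = of_real (sqrt (\<sigma> / pi)) / csqrt (1 - a\<^sup>2) *
     (exp (- (\<gamma> * a\<^sup>2) * (of_real y)\<^sup>2) * fourier (chirped A f) (s * y))"
  unfolding frt_def fourier_def chirped_def frt_kernel_factor
  by (subst integral_mult_right_zero [symmetric]) (simp add: mult_ac)

lemma borel_measurable_chirped [measurable]:
  assumes [measurable]: "f \<in> borel_measurable borel" "A \<in> sets borel"
  shows "chirped A f \<in> borel_measurable borel"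
  unfolding chirped_def by measurable

lemma borel_measurable_frt [measurable]:
  assumes [measurable]: "f \<in> borel_measurable borel" "A \<in> sets borel"
  shows "frt A \<sigma> a f \<in> borel_measurable borel"
  unfolding frt_eq_fourier [abs_def] by measurable

lemma integrable_chirped:
  assumes f: "f \<in> L2G \<sigma>" and [measurable]: "A \<in> sets borel" and "emeasure lborel A < \<infinity>"
  shows "integrable lborel (chirped A f)"
proof (rule Bochner_Integration.integrable_bound)
  have [measurable]: "f \<in> borel_measurable borel" using f by (simp add: L2G_def)
  show "chirped A f \<in> borel_measurable lborel" by simp
  show "integrable lborel (\<lambda>x. indicator A x + (cmod (f x))\<^sup>2 * exp (- \<sigma> * x\<^sup>2))"
    using f assms by (auto simp: L2G_iff)
  have "cmod (chirped A f x) \<le> indicator A x + (cmod (f x))\<^sup>2 * exp (- \<sigma> * x\<^sup>2)" for x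
  proof -
    define t where "t = cmod (f x) * exp (- \<sigma> * x\<^sup>2 / 2)"
    have "t\<^sup>2 = (cmod (f x))\<^sup>2 * exp (- \<sigma> * x\<^sup>2)"
      by (simp add: t_def power_mult_distrib flip: exp_double)
    moreover have "0 \<le> t" by (simp add: t_def)
    then have "t \<le> 1 + t\<^sup>2" using sum_squares_bound[of 1 t] by simp
    moreover have "cmod (chirped A f x) = indicator A x * t"
      unfolding chirped_def norm_mult norm_exp_\<gamma> t_def by (simp add: indicator_def)
    ultimately show ?thesis by (auto simp: indicator_def)
  qed
  then show "AE x in lborel. cmod (chirped A f x) \<le> norm (indicator A x + (cmod (f x))\<^sup>2 * exp (- \<sigma> * x\<^sup>2))"
    by (intro AE_I2 order_trans[OF _ abs_ge_self[THEN order_trans[OF _ eq_refl[OF real_norm_def[symmetric]]]]])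
qed

text \<open>
  The normalisation is such that no constant appears: the squared modulus of the factor in front of the
  integral is \<open>\<bar>s\<bar> / (2 * pi)\<close>, while Plancherel's inequality contributes \<open>2 * pi\<close> and the
  substitution \<open>\<xi> = s * y\<close> contributes \<open>1 / \<bar>s\<bar>\<close>.
\<close>

lemma sq_norm_frt_le:
  assumes f: "f \<in> L2G \<sigma>" and [measurable]: "A \<in> sets borel" and "emeasure lborel A < \<infinity>"
  shows "sq_norm (gauss \<sigma>) (frt A \<sigma> a f) \<le> sq_norm (gauss \<sigma>) (\<lambda>x. indicator A x * f x)"
proof -
  have [measurable]: "f \<in> borel_measurable borel" using f by (simp add: L2G_def)
  define K where "K = (\<sigma> / pi) / (2 * \<bar>Im a\<bar>)"
  have im: "Im a \<noteq> 0" by (rule unimodular_one_minus_square[OF a])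
  have "K \<ge> 0" using \<sigma> by (simp add: K_def)
  have norm: "(cmod (frt A \<sigma> a f y))\<^sup>2 * exp (- \<sigma> * y\<^sup>2) = K * (cmod (fourier (chirped A f) (s * y)))\<^sup>2" for y
  proof -
    have "(cmod (of_real (sqrt (\<sigma> / pi)) / csqrt (1 - a\<^sup>2)))\<^sup>2 = K"
      using \<sigma> unimodular_one_minus_square(4)[OF a] by (simp add: norm_divide power_divide K_def)
    moreover have "(exp (\<sigma> * y\<^sup>2 / 2))\<^sup>2 * exp (- \<sigma> * y\<^sup>2) = 1"
      by (simp add: flip: exp_double exp_add)
    ultimately show ?thesis
      unfolding frt_eq_fourier norm_mult norm_exp_\<gamma> power_mult_distrib by (simp add: mult_ac)
  qed
  have "sq_norm (gauss \<sigma>) (frt A \<sigma> a f) = (\<integral>\<^sup>+y. ennreal K * ennreal ((cmod (fourier (chirped A f) (s * y)))\<^sup>2) \<partial>lborel)"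
    by (subst sq_norm_gauss, simp, simp only: norm, simp add: ennreal_mult \<open>K \<ge> 0\<close>)
  also have "\<dots> = ennreal K * (\<integral>\<^sup>+y. ennreal ((cmod (fourier (chirped A f) (s * y)))\<^sup>2) \<partial>lborel)"
    by (rule nn_integral_cmult) simp
  also have "ennreal K = ennreal (1 / (2 * pi)) * ennreal \<bar>s\<bar>"
    using im \<sigma> by (simp add: K_def s_def flip: ennreal_mult)
  also have "\<dots> * (\<integral>\<^sup>+y. ennreal ((cmod (fourier (chirped A f) (s * y)))\<^sup>2) \<partial>lborel) =
      ennreal (1 / (2 * pi)) * (\<integral>\<^sup>+\<xi>. ennreal ((cmod (fourier (chirped A f) \<xi>))\<^sup>2) \<partial>lborel)"
    using nn_integral_real_affine[of "\<lambda>\<xi>. ennreal ((cmod (fourier (chirped A f) \<xi>))\<^sup>2)" s 0] \<gamma>_props(5)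
    by (simp add: mult.assoc)
  also have "\<dots> \<le> ennreal (1 / (2 * pi)) * (ennreal (2 * pi) * (\<integral>\<^sup>+x. ennreal ((cmod (chirped A f x))\<^sup>2) \<partial>lborel))"
    by (intro mult_left_mono Plancherel_inequality integrable_chirped assms) simp
  also have "\<dots> = (\<integral>\<^sup>+x. ennreal ((cmod (chirped A f x))\<^sup>2) \<partial>lborel)"
    by (simp flip: mult.assoc ennreal_mult)
  also have "\<dots> = sq_norm (gauss \<sigma>) (\<lambda>x. indicator A x * f x)"
    unfolding chirped_def norm_mult norm_exp_\<gamma>
    by (subst sq_norm_gauss) (auto intro!: nn_integral_cong simp: norm_mult power_mult_distrib mult_ac simp flip: exp_double)
  finally show ?thesis .
qed

end

lemma L2G_tail:
  assumes f: "f \<in> L2G \<sigma>"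
  shows "((\<lambda>R. sq_norm (gauss \<sigma>) (\<lambda>x. indicator (- {-R..R}) x * f x)) \<longlongrightarrow> 0) at_top"
proof -
  have [measurable]: "f \<in> borel_measurable borel" using f by (simp add: L2G_def)
  define F where "F x = (cmod (f x))\<^sup>2 * exp (- \<sigma> * x\<^sup>2)" for x
  have F: "integrable lborel F" using f by (simp add: L2G_iff F_def [abs_def])
  have [measurable]: "F \<in> borel_measurable borel" unfolding F_def by measurable
  have eq: "sq_norm (gauss \<sigma>) (\<lambda>x. indicator (- {-R..R}) x * f x) =
      ennreal (LINT x|lborel. indicator (- {-R..R}) x * F x)" for R
  proof -
    have "sq_norm (gauss \<sigma>) (\<lambda>x. indicator (- {-R..R}) x * f x) =
        (\<integral>\<^sup>+x. ennreal (indicator (- {-R..R}) x * F x) \<partial>lborel)"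
      by (subst sq_norm_gauss)
         (auto intro!: nn_integral_cong simp: norm_mult F_def indicator_def)
    also have "\<dots> = ennreal (LINT x|lborel. indicator (- {-R..R}) x * F x)"
      using integrable_mult_indicator[of "- {-R..R}" lborel F] F
      by (intro nn_integral_eq_integral) (auto simp: F_def)
    finally show ?thesis .
  qed
  have "((\<lambda>R. LINT x|lborel. indicator (- {-R..R}) x * F x) \<longlongrightarrow> integral\<^sup>L (lborel :: real measure) (\<lambda>_. 0 :: real)) at_top"
  proof (rule integral_dominated_convergence_at_top[where w = F])
    show "AE x in lborel. ((\<lambda>R. indicator (- {-R..R}) x * F x) \<longlongrightarrow> 0) at_top"
    proof (intro AE_I2 tendsto_eventually)
      fix x :: real
      show "\<forall>\<^sub>F R in at_top. indicator (- {-R..R}) x * F x = 0"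
        using eventually_ge_at_top[of "\<bar>x\<bar>"] by eventually_elim (auto simp: indicator_def)
    qed
    show "\<forall>\<^sub>F R in at_top. AE x in lborel. norm (indicator (- {-R..R}) x * F x) \<le> F x"
      by (intro always_eventually allI AE_I2) (auto simp: indicator_def F_def abs_mult)
  qed (use F in auto)
  from tendsto_ennrealI[OF this] show ?thesis unfolding eq by simp
qed

definition is_frt :: "real \<Rightarrow> complex \<Rightarrow> (real \<Rightarrow> complex) \<Rightarrow> (real \<Rightarrow> complex) \<Rightarrow> bool" where
  "is_frt \<sigma> a f h \<longleftrightarrow> h \<in> L2G \<sigma> \<and> (\<forall>R>0. frt {-R..R} \<sigma> a f \<in> L2G \<sigma>) \<and>
     ((\<lambda>R. sq_norm (gauss \<sigma>) (\<lambda>y. frt {-R..R} \<sigma> a f y - h y)) \<longlongrightarrow> 0) at_top"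

context frt_parameter
begin

lemma frt_in_L2G:
  assumes f: "f \<in> L2G \<sigma>" and [measurable]: "A \<in> sets borel" and "emeasure lborel A < \<infinity>"
  shows "frt A \<sigma> a f \<in> L2G \<sigma>"
proof -
  have [measurable]: "f \<in> borel_measurable borel" using f by (simp add: L2G_def)
  have "sq_norm (gauss \<sigma>) (frt A \<sigma> a f) \<le> sq_norm (gauss \<sigma>) (\<lambda>x. indicator A x * f x)"
    by (rule sq_norm_frt_le) fact+
  also have "\<dots> \<le> sq_norm (gauss \<sigma>) f"
    by (rule sq_norm_mono) (simp add: indicator_def norm_mult)
  also have "\<dots> < \<infinity>" using f by (simp add: L2G_def)
  finally show ?thesis by (simp add: L2G_def)
qed

lemma frt_diff:
  assumes f: "f \<in> L2G \<sigma>" and "R \<le> R'"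
  shows "frt {-R'..R'} \<sigma> a f y - frt {-R..R} \<sigma> a f y = frt ({-R'..R'} - {-R..R}) \<sigma> a f y"
proof -
  have "chirped ({-R'..R'} - {-R..R}) f = (\<lambda>x. chirped {-R'..R'} f x - chirped {-R..R} f x)"
    using \<open>R \<le> R'\<close> by (auto simp: chirped_def indicator_def)
  then have "fourier (chirped ({-R'..R'} - {-R..R}) f) \<xi> =
      fourier (chirped {-R'..R'} f) \<xi> - fourier (chirped {-R..R} f) \<xi>" for \<xi>
    using f by (simp add: fourier_diff integrable_chirped emeasure_lborel_Icc_eq)
  then show ?thesis by (simp only: frt_eq_fourier right_diff_distrib)
qed

text \<open>
  The transforms over \<open>[-R', R']\<close> and \<open>[-R, R]\<close> differ by the transform over the set
  difference, whose norm is at most that of \<open>f\<close> outside \<open>[-R, R]\<close>. So the truncated transforms form a Cauchy family.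
\<close>

lemma is_frt_exists:
  assumes f: "f \<in> L2G \<sigma>"
  shows "\<exists>h. is_frt \<sigma> a f h"
proof -
  have [measurable]: "f \<in> borel_measurable borel" using f by (simp add: L2G_def)
  let ?F = "\<lambda>R. frt {-R..R} \<sigma> a f"
  let ?\<tau> = "\<lambda>R. sq_norm (gauss \<sigma>) (\<lambda>x. indicator (- {-R..R}) x * f x)"
  have "sq_norm (gauss \<sigma>) (\<lambda>y. ?F R' y - ?F R y) \<le> ?\<tau> R" if "R \<le> R'" for R R'
  proof -
    have "emeasure lborel ({-R'..R'} - {-R..R}) < \<infinity>"
      by (rule order.strict_trans1[OF emeasure_mono[of _ "{-R'..R'}"]]) (auto simp: emeasure_lborel_Icc_eq)
    then have "sq_norm (gauss \<sigma>) (\<lambda>y. ?F R' y - ?F R y) \<le>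
        sq_norm (gauss \<sigma>) (\<lambda>x. indicator ({-R'..R'} - {-R..R}) x * f x)"
      unfolding frt_diff[OF f that] by (intro sq_norm_frt_le f) simp_all
    also have "\<dots> \<le> ?\<tau> R"
      by (rule sq_norm_mono) (auto simp: indicator_def norm_mult)
    finally show ?thesis .
  qed
  then obtain h where h[measurable]: "h \<in> borel_measurable (gauss \<sigma>)"
    and le: "\<And>R. sq_norm (gauss \<sigma>) (\<lambda>y. ?F R y - h y) \<le> ?\<tau> R"
    using sq_norm_complete[of ?F "gauss \<sigma>" ?\<tau>] L2G_tail[OF f] by auto
  have lim: "((\<lambda>R. sq_norm (gauss \<sigma>) (\<lambda>y. ?F R y - h y)) \<longlongrightarrow> 0) at_top"
    by (rule tendsto_sandwich[OF _ _ tendsto_const L2G_tail[OF f]]) (use le in auto)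
  have F: "?F R \<in> L2G \<sigma>" for R
    using f by (intro frt_in_L2G) (auto simp: emeasure_lborel_Icc_eq)
  have "\<forall>\<^sub>F R in at_top. sq_norm (gauss \<sigma>) (\<lambda>y. ?F R y - h y) < 1"
    by (rule order_tendstoD(2)[OF lim]) simp
  then obtain R where R: "sq_norm (gauss \<sigma>) (\<lambda>y. ?F R y - h y) < 1"
    using eventually_happens by force
  \<comment> \<open>The limit lies in the space because it differs from one truncated transform by a function of finite norm.\<close>
  have "(\<lambda>y. ?F R y - (?F R y - h y)) \<in> L2G \<sigma>"
    by (rule L2G_diff[OF F]) (use R in \<open>auto simp: L2G_def intro: order.strict_trans\<close>)
  then have "h \<in> L2G \<sigma>" by simp
  then show ?thesis using F lim by (auto simp: is_frt_def)
qed

lemma is_frt_unique: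
  assumes "f \<in> L2G \<sigma>" "is_frt \<sigma> a f g" "is_frt \<sigma> a f h"
  shows "AE y in lborel. g y = h y"
  unfolding AE_gauss [where \<sigma> = \<sigma>, symmetric]
  by (rule sq_norm_limit_unique[where F = "\<lambda>R. frt {-R..R} \<sigma> a f" and A = at_top])
     (use assms in \<open>auto simp: is_frt_def L2G_def\<close>)

text \<open>
  A subsequence of the truncated transforms converges almost everywhere to \<open>h\<close>; where the full
  integral converges absolutely, dominated convergence gives the limit of the whole sequence.
\<close>

lemma is_frt_AE_eq_integral:
  assumes f: "f \<in> L2G \<sigma>" and h: "is_frt \<sigma> a f h"
  shows "AE y in lborel. integrable lborel (\<lambda>x. f x * frt_kernel \<sigma> a x y) \<longrightarrow> h y = frt UNIV \<sigma> a f y"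
proof -
  have [measurable]: "f \<in> borel_measurable borel" "h \<in> borel_measurable borel"
    using f h by (simp_all add: L2G_def is_frt_def)
  let ?F = "\<lambda>n::nat. frt {- real (Suc n)..real (Suc n)} \<sigma> a f"
  have top: "filterlim (\<lambda>n. real (Suc n)) at_top sequentially"
    using filterlim_compose[OF filterlim_real_sequentially filterlim_Suc] .
  have diff: "(\<lambda>y. ?F n y - h y) \<in> L2G \<sigma>" for n
    using h by (intro L2G_diff) (auto simp: is_frt_def simp del: of_nat_Suc)
  have "\<exists>r. strict_mono r \<and> (AE y in gauss \<sigma>. (\<lambda>n. ?F (r n) y) \<longlonglongrightarrow> h y)"
  proof (rule sq_norm_limit_AE_subseq)
    show "sq_norm (gauss \<sigma>) (\<lambda>y. ?F n y - h y) < \<infinity>" for n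
      using diff[of n] by (simp add: L2G_def)
    show "(\<lambda>n. sq_norm (gauss \<sigma>) (\<lambda>y. ?F n y - h y)) \<longlonglongrightarrow> 0"
      using h filterlim_compose[OF _ top, of "\<lambda>R. sq_norm (gauss \<sigma>) (\<lambda>y. frt {-R..R} \<sigma> a f y - h y)" "nhds 0"]
      by (simp add: is_frt_def del: of_nat_Suc)
  qed simp_all
  then obtain r where r: "strict_mono r" and ae: "AE y in lborel. (\<lambda>n. ?F (r n) y) \<longlonglongrightarrow> h y"
    by (auto simp: AE_gauss)
  from ae show ?thesis
  proof eventually_elim
    case (elim y)
    show ?case
    proof
      assume int: "integrable lborel (\<lambda>x. f x * frt_kernel \<sigma> a x y)"
      have "(\<lambda>n. LINT x|lborel. indicator {- real (Suc n)..real (Suc n)} x * (f x * frt_kernel \<sigma> a x y))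
          \<longlonglongrightarrow> (LINT x|lborel. f x * frt_kernel \<sigma> a x y)"
      proof (rule integral_dominated_convergence[where w = "\<lambda>x. cmod (f x * frt_kernel \<sigma> a x y)"])
        show "AE x in lborel. (\<lambda>n. indicator {- real (Suc n)..real (Suc n)} x * (f x * frt_kernel \<sigma> a x y))
            \<longlonglongrightarrow> f x * frt_kernel \<sigma> a x y"
        proof (intro AE_I2 tendsto_eventually)
          fix x
          have "\<forall>\<^sub>F n in sequentially. \<bar>x\<bar> \<le> real (Suc n)"
            using top by (simp add: filterlim_at_top)
          then show "\<forall>\<^sub>F n in sequentially. indicator {- real (Suc n)..real (Suc n)} x * (f x * frt_kernel \<sigma> a x y) =
              f x * frt_kernel \<sigma> a x y"
            by eventually_elim (auto simp: indicator_def)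
        qed
      qed (use int in \<open>auto simp: indicator_def frt_kernel_def intro!: integrable_norm\<close>)
      then have "(\<lambda>n. ?F n y) \<longlonglongrightarrow> frt UNIV \<sigma> a f y"
        unfolding frt_def by (intro tendsto_intros) (simp)
      then have "(\<lambda>n. ?F (r n) y) \<longlonglongrightarrow> frt UNIV \<sigma> a f y"
        using r LIMSEQ_subseq_LIMSEQ[of "\<lambda>n. ?F n y"] by (simp add: comp_def)
      with elim show "h y = frt UNIV \<sigma> a f y" by (rule LIMSEQ_unique)
    qed
  qed
qed

end

section \<open>The Segal--Bargmann transform of one component\<close>

text \<open>
  One component of the Segal--Bargmann transform; the constant \<open>c\<close> will be \<open>sqrt (\<nu> / (4 * \<sigma>))\<close>.
\<close>

definition bargmann :: "real \<Rightarrow> real \<Rightarrow> (real \<Rightarrow> complex) \<Rightarrow> complex \<Rightarrow> complex" where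
  "bargmann \<sigma> c f z = of_real (sqrt (\<sigma> / pi)) *
     (LINT x|lborel. exp (- (of_real \<sigma> * (of_real x - of_real c * z)\<^sup>2)) * f x)"

lemma norm_exp_square:
  "cmod (exp (- (of_real \<sigma> * (of_real x - w)\<^sup>2))) =
   exp (\<sigma> * ((Im w)\<^sup>2 - (Re w)\<^sup>2)) * exp (- \<sigma> * x\<^sup>2 + (2 * \<sigma> * Re w) * x)"
proof -
  have "Re (- (of_real \<sigma> * (of_real x - w)\<^sup>2)) = \<sigma> * ((Im w)\<^sup>2 - (Re w)\<^sup>2) + (- \<sigma> * x\<^sup>2 + (2 * \<sigma> * Re w) * x)"
    by (simp add: Re_power2 power2_eq_square algebra_simps)
  then show ?thesis by (simp only: norm_exp_eq_Re exp_add)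
qed

lemma bargmann_integrable:
  assumes f: "f \<in> L2G \<sigma>" and "\<sigma> > 0"
  shows "integrable lborel (\<lambda>x. exp (- (of_real \<sigma> * (of_real x - w)\<^sup>2)) * f x)"
proof (rule Bochner_Integration.integrable_bound)
  have [measurable]: "f \<in> borel_measurable borel" using f by (simp add: L2G_def)
  show "(\<lambda>x. exp (- (of_real \<sigma> * (of_real x - w)\<^sup>2)) * f x) \<in> borel_measurable lborel" by measurable
  show "integrable lborel (\<lambda>x. exp (\<sigma> * ((Im w)\<^sup>2 - (Re w)\<^sup>2)) * (exp (- \<sigma> * x\<^sup>2 + (2 * \<sigma> * Re w) * x) * cmod (f x)))"
    by (intro integrable_mult_right L2G_mult_gaussian_integrable assms)
qed (unfold norm_mult norm_exp_square, simp)

lemma bargmann_diff: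
  assumes "f \<in> L2G \<sigma>" "g \<in> L2G \<sigma>" "\<sigma> > 0"
  shows "bargmann \<sigma> c (\<lambda>x. f x - g x) z = bargmann \<sigma> c f z - bargmann \<sigma> c g z"
proof -
  have "(LINT x|lborel. exp (- (of_real \<sigma> * (of_real x - of_real c * z)\<^sup>2)) * (f x - g x)) =
      (LINT x|lborel. exp (- (of_real \<sigma> * (of_real x - of_real c * z)\<^sup>2)) * f x) -
      (LINT x|lborel. exp (- (of_real \<sigma> * (of_real x - of_real c * z)\<^sup>2)) * g x)"
    by (subst Bochner_Integration.integral_diff [symmetric])
       (auto intro!: bargmann_integrable assms simp: right_diff_distrib)
  then show ?thesis by (simp only: bargmann_def right_diff_distrib)
qed

text \<open>
  This is the Cauchy--Schwarz inequality, with the factor \<open>exp (\<sigma> * x\<^sup>2 / 2)\<close> given to the kernel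
  and its inverse to \<open>f\<close>. The kernel decays like \<open>exp (- \<sigma> * x\<^sup>2)\<close>, so it stays square integrable.
\<close>

lemma bargmann_bounded:
  assumes "\<sigma> > 0"
  shows "\<exists>D. \<forall>f\<in>L2G \<sigma>. ennreal ((cmod (bargmann \<sigma> c f z))\<^sup>2) \<le> ennreal D * sq_norm (gauss \<sigma>) f"
proof -
  define w where "w = of_real c * z"
  define k where "k x = exp (- (of_real \<sigma> * (of_real x - w)\<^sup>2))" for x :: real
  define E where "E = (exp (\<sigma> * ((Im w)\<^sup>2 - (Re w)\<^sup>2)))\<^sup>2 * (sqrt (pi / \<sigma>) * exp ((4 * \<sigma> * Re w)\<^sup>2 / (4 * \<sigma>)))"
  have [measurable]: "k \<in> borel_measurable borel" unfolding k_def by measurable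
  have sq: "(\<integral>\<^sup>+x. (ennreal (cmod (k x) * exp (\<sigma> * x\<^sup>2 / 2)))\<^sup>2 \<partial>lborel) = ennreal E"
  proof -
    have "(cmod (k x) * exp (\<sigma> * x\<^sup>2 / 2))\<^sup>2 = (exp (\<sigma> * ((Im w)\<^sup>2 - (Re w)\<^sup>2)))\<^sup>2 * exp (- \<sigma> * x\<^sup>2 + (4 * \<sigma> * Re w) * x)" for x
    proof -
      have "(exp (- \<sigma> * x\<^sup>2 + (2 * \<sigma> * Re w) * x) * exp (\<sigma> * x\<^sup>2 / 2))\<^sup>2 = exp (- \<sigma> * x\<^sup>2 + (4 * \<sigma> * Re w) * x)"
        by (simp add: power2_eq_square algebra_simps flip: exp_add)
      then show ?thesis unfolding k_def norm_exp_square by (simp only: power_mult_distrib mult.assoc)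
    qed
    then have "(\<integral>\<^sup>+x. (ennreal (cmod (k x) * exp (\<sigma> * x\<^sup>2 / 2)))\<^sup>2 \<partial>lborel) =
        (\<integral>\<^sup>+x. ennreal ((exp (\<sigma> * ((Im w)\<^sup>2 - (Re w)\<^sup>2)))\<^sup>2 * exp (- \<sigma> * x\<^sup>2 + (4 * \<sigma> * Re w) * x)) \<partial>lborel)"
      by (intro nn_integral_cong) (simp only: ennreal_power mult_nonneg_nonneg norm_ge_zero exp_ge_zero)
    also have "\<dots> = ennreal E"
      using has_bochner_integral_mult_right[OF has_bochner_integral_gaussian_real[OF assms, of "4 * \<sigma> * Re w"],
          of "(exp (\<sigma> * ((Im w)\<^sup>2 - (Re w)\<^sup>2)))\<^sup>2"]
      by (simp only: has_bochner_integral_iff E_def) (subst nn_integral_eq_integral; simp)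
    finally show ?thesis .
  qed
  have "ennreal ((cmod (bargmann \<sigma> c f z))\<^sup>2) \<le> ennreal ((\<sigma> / pi) * E) * sq_norm (gauss \<sigma>) f"
    if f: "f \<in> L2G \<sigma>" for f
  proof -
    have [measurable]: "f \<in> borel_measurable borel" using f by (simp add: L2G_def)
    have "ennreal (cmod (LINT x|lborel. k x * f x)) \<le> (\<integral>\<^sup>+x. ennreal (cmod (k x * f x)) \<partial>lborel)"
      by (rule ennreal_norm_integral_le)
    also have "\<dots> = (\<integral>\<^sup>+x. ennreal (cmod (k x) * exp (\<sigma> * x\<^sup>2 / 2)) * ennreal (cmod (f x) * exp (- \<sigma> * x\<^sup>2 / 2)) \<partial>lborel)"
      by (intro nn_integral_cong) (simp add: norm_mult mult_ac flip: ennreal_mult exp_add)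
    finally have "ennreal ((cmod (LINT x|lborel. k x * f x))\<^sup>2) \<le>
        (\<integral>\<^sup>+x. ennreal (cmod (k x) * exp (\<sigma> * x\<^sup>2 / 2)) * ennreal (cmod (f x) * exp (- \<sigma> * x\<^sup>2 / 2)) \<partial>lborel)\<^sup>2"
      unfolding ennreal_power[OF norm_ge_zero, symmetric] by (rule power_mono) simp
    also have "\<dots> \<le> (\<integral>\<^sup>+x. (ennreal (cmod (k x) * exp (\<sigma> * x\<^sup>2 / 2)))\<^sup>2 \<partial>lborel) *
        (\<integral>\<^sup>+x. (ennreal (cmod (f x) * exp (- \<sigma> * x\<^sup>2 / 2)))\<^sup>2 \<partial>lborel)"
      by (rule Cauchy_Schwarz_nn_integral) simp_all
    also have "(\<integral>\<^sup>+x. (ennreal (cmod (f x) * exp (- \<sigma> * x\<^sup>2 / 2)))\<^sup>2 \<partial>lborel) = sq_norm (gauss \<sigma>) f"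
      by (subst sq_norm_gauss) (auto intro!: nn_integral_cong simp: ennreal_power power_mult_distrib simp flip: exp_double)
    finally have "ennreal (\<sigma> / pi) * ennreal ((cmod (LINT x|lborel. k x * f x))\<^sup>2) \<le> ennreal (\<sigma> / pi) * (ennreal E * sq_norm (gauss \<sigma>) f)"
      unfolding sq by (rule mult_left_mono) simp
    moreover have "(cmod (bargmann \<sigma> c f z))\<^sup>2 = (\<sigma> / pi) * (cmod (LINT x|lborel. k x * f x))\<^sup>2"
      using assms by (simp add: bargmann_def k_def w_def norm_mult power_mult_distrib)
    then have "ennreal ((cmod (bargmann \<sigma> c f z))\<^sup>2) = ennreal (\<sigma> / pi) * ennreal ((cmod (LINT x|lborel. k x * f x))\<^sup>2)"
      using assms by (simp only: ennreal_mult zero_le_power2 divide_nonneg_pos pi_gt_zero less_imp_le)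
    moreover have "ennreal ((\<sigma> / pi) * E) = ennreal (\<sigma> / pi) * ennreal E"
      using assms by (intro ennreal_mult) (simp_all add: E_def)
    ultimately show ?thesis by (simp only: mult.assoc)
  qed
  then show ?thesis by blast
qed

lemma bargmann_tendsto:
  assumes "\<sigma> > 0" and F: "\<forall>\<^sub>F R in A. F R \<in> L2G \<sigma>" and h: "h \<in> L2G \<sigma>"
    and lim: "((\<lambda>R. sq_norm (gauss \<sigma>) (\<lambda>y. F R y - h y)) \<longlongrightarrow> 0) A"
  shows "((\<lambda>R. bargmann \<sigma> c (F R) z) \<longlongrightarrow> bargmann \<sigma> c h z) A"
proof -
  obtain D where D: "\<And>f. f \<in> L2G \<sigma> \<Longrightarrow> ennreal ((cmod (bargmann \<sigma> c f z))\<^sup>2) \<le> ennreal D * sq_norm (gauss \<sigma>) f"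
    using bargmann_bounded[OF assms(1)] by blast
  have "((\<lambda>R. ennreal ((cmod (bargmann \<sigma> c (F R) z - bargmann \<sigma> c h z))\<^sup>2)) \<longlongrightarrow> ennreal 0) A"
  proof (unfold ennreal_0, rule tendsto_sandwich[OF _ _ tendsto_const])
    show "((\<lambda>R. ennreal D * sq_norm (gauss \<sigma>) (\<lambda>y. F R y - h y)) \<longlongrightarrow> 0) A"
      using ennreal_tendsto_cmult[OF _ lim, of "ennreal D"] by simp
    show "\<forall>\<^sub>F R in A. ennreal ((cmod (bargmann \<sigma> c (F R) z - bargmann \<sigma> c h z))\<^sup>2) \<le>
        ennreal D * sq_norm (gauss \<sigma>) (\<lambda>y. F R y - h y)"
      using F
    proof eventually_elim
      case (elim R)
      then show ?case
        using D[OF L2G_diff[OF elim h]] by (simp add: bargmann_diff h assms)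
    qed
  qed simp
  then have "((\<lambda>R. (cmod (bargmann \<sigma> c (F R) z - bargmann \<sigma> c h z))\<^sup>2) \<longlongrightarrow> 0) A"
    by (rule tendsto_ennrealD) (intro always_eventually allI zero_le_power2, rule order_refl)
  from tendsto_real_sqrt[OF this] show ?thesis
    by (simp add: tendsto_norm_zero_iff LIM_zero_iff)
qed

text \<open>
  For \<open>z\<close> in the unit disc about \<open>z0\<close> the modulus of the kernel is at most a constant times the sum of the
  two Gaussians that belong to the extreme values of \<open>Re z\<close>.
\<close>

lemma bargmann_holomorphic:
  assumes f: "f \<in> L2G \<sigma>" and "\<sigma> > 0" and "c > 0"
  shows "bargmann \<sigma> c f holomorphic_on UNIV"
proof -
  have [measurable]: "f \<in> borel_measurable borel" using f by (simp add: L2G_def)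
  have "(\<lambda>z. LINT x|lborel. exp (- (of_real \<sigma> * (of_real x - of_real c * z)\<^sup>2)) * f x) holomorphic_on UNIV"
  proof (rule holomorphic_on_lebesgue_integral)
    fix z0 :: complex
    define Q where "Q = c * (\<bar>Im z0\<bar> + 1)"
    define b1 b2 where "b1 = 2 * \<sigma> * (c * (Re z0 + 1))" and "b2 = 2 * \<sigma> * (c * (Re z0 - 1))"
    define G where "G x = exp (\<sigma> * Q\<^sup>2) * (exp (- \<sigma> * x\<^sup>2 + b1 * x) * cmod (f x) + exp (- \<sigma> * x\<^sup>2 + b2 * x) * cmod (f x))" for x
    have "integrable lborel G"
      unfolding G_def
      by (intro integrable_mult_right Bochner_Integration.integrable_add L2G_mult_gaussian_integrable f assms)
    moreover have "cmod (exp (- (of_real \<sigma> * (of_real x - of_real c * z)\<^sup>2)) * f x) \<le> G x"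
      if z: "z \<in> cball z0 1" for z x
    proof -
      have re: "\<bar>Re z - Re z0\<bar> \<le> 1" and im: "\<bar>Im z - Im z0\<bar> \<le> 1"
        using z abs_Re_le_cmod[of "z - z0"] abs_Im_le_cmod[of "z - z0"]
        by (simp_all add: dist_norm norm_minus_commute)
      have "\<bar>c * Im z\<bar> \<le> Q"
        using im \<open>c > 0\<close> unfolding Q_def by (simp add: abs_mult) 
      then have "(c * Im z)\<^sup>2 \<le> Q\<^sup>2" by (metis abs_ge_zero power2_abs power_mono)
      then have "\<sigma> * ((c * Im z)\<^sup>2 - (c * Re z)\<^sup>2) \<le> \<sigma> * Q\<^sup>2"
        using \<open>\<sigma> > 0\<close> by (intro mult_left_mono) (auto intro: order_trans[of _ "(c * Im z)\<^sup>2"])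
      then have 1: "exp (\<sigma> * ((c * Im z)\<^sup>2 - (c * Re z)\<^sup>2)) \<le> exp (\<sigma> * Q\<^sup>2)" by simp
      have le: "2 * \<sigma> * (c * Re z) \<le> b1" "b2 \<le> 2 * \<sigma> * (c * Re z)"
        using re assms unfolding b1_def b2_def by (auto intro!: mult_left_mono)
      have "2 * \<sigma> * (c * Re z) * x \<le> b1 * x \<or> 2 * \<sigma> * (c * Re z) * x \<le> b2 * x"
        using mult_right_mono[OF le(1), of x] mult_right_mono_neg[OF le(2), of x] by linarith
      then have 2: "exp (- \<sigma> * x\<^sup>2 + 2 * \<sigma> * (c * Re z) * x) \<le> exp (- \<sigma> * x\<^sup>2 + b1 * x) + exp (- \<sigma> * x\<^sup>2 + b2 * x)"
        by (elim disjE) (simp_all add: add_increasing add_increasing2)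
      have "cmod (exp (- (of_real \<sigma> * (of_real x - of_real c * z)\<^sup>2)) * f x) =
          exp (\<sigma> * ((c * Im z)\<^sup>2 - (c * Re z)\<^sup>2)) * exp (- \<sigma> * x\<^sup>2 + 2 * \<sigma> * (c * Re z) * x) * cmod (f x)"
        unfolding norm_mult norm_exp_square by simp
      also have "\<dots> \<le> exp (\<sigma> * Q\<^sup>2) * (exp (- \<sigma> * x\<^sup>2 + b1 * x) + exp (- \<sigma> * x\<^sup>2 + b2 * x)) * cmod (f x)"
        by (intro mult_right_mono mult_mono 1 2) simp_all
      also have "\<dots> = G x" by (simp add: G_def algebra_simps)
      finally show ?thesis .
    qed
    ultimately show "\<exists>r>0. \<exists>G. cball z0 r \<subseteq> UNIV \<and> integrable lborel G \<and>
        (\<forall>z\<in>cball z0 r. \<forall>x\<in>space lborel. cmod (exp (- (of_real \<sigma> * (of_real x - of_real c * z)\<^sup>2)) * f x) \<le> G x)"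
      by (intro exI[of _ 1] conjI exI[of _ G]) auto
  qed (auto intro!: holomorphic_intros)
  then show ?thesis unfolding bargmann_def [abs_def] by (intro holomorphic_intros)
qed

text \<open>
  On a vertical line the transform is a Fourier transform. This gives both injectivity (from the
  line \<open>p = 0\<close>) and the norm estimate (from all lines).
\<close>

lemma bargmann_fourier:
  "bargmann \<sigma> c f (Complex p q) = of_real (sqrt (\<sigma> / pi) * exp (\<sigma> * c\<^sup>2 * q\<^sup>2)) * cis (- 2 * \<sigma> * c\<^sup>2 * p * q) *
     fourier (\<lambda>x. of_real (exp (- \<sigma> * (x - c * p)\<^sup>2)) * f x) (2 * \<sigma> * c * q)"
proof -
  have "exp (- (of_real \<sigma> * (of_real x - of_real c * Complex p q)\<^sup>2)) =
      of_real (exp (\<sigma> * c\<^sup>2 * q\<^sup>2)) * cis (- 2 * \<sigma> * c\<^sup>2 * p * q) *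
      (of_real (exp (- \<sigma> * (x - c * p)\<^sup>2)) * cis (2 * \<sigma> * c * q * x))" for x
  proof -
    have "- (of_real \<sigma> * (of_real x - of_real c * Complex p q)\<^sup>2) =
        of_real (\<sigma> * c\<^sup>2 * q\<^sup>2) + \<i> * of_real (- 2 * \<sigma> * c\<^sup>2 * p * q) +
        (of_real (- \<sigma> * (x - c * p)\<^sup>2) + \<i> * of_real (2 * \<sigma> * c * q * x))"
      by (simp add: complex_eq_iff Re_power2 Im_power2) (simp add: power2_eq_square algebra_simps)
    then show ?thesis by (simp only: exp_add cis_conv_exp exp_of_real)
  qed
  then show ?thesis
    unfolding bargmann_def fourier_def
    by (simp add: mult_ac flip: integral_mult_right_zero)
qed

lemma bargmann_inj:
  assumes f: "f \<in> L2G \<sigma>" and g: "g \<in> L2G \<sigma>" and "\<sigma> > 0" "c > 0"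
    and eq: "\<And>z. bargmann \<sigma> c f z = bargmann \<sigma> c g z"
  shows "AE x in lborel. f x = g x"
proof -
  define d where "d x = f x - g x" for x
  have d: "d \<in> L2G \<sigma>" unfolding d_def by (intro L2G_diff f g)
  have "fourier (\<lambda>x. of_real (exp (- \<sigma> * x\<^sup>2)) * d x) \<xi> = 0" for \<xi>
  proof -
    have "bargmann \<sigma> c d (Complex 0 (\<xi> / (2 * \<sigma> * c))) = 0"
      unfolding d_def using assms by (subst bargmann_diff) auto
    then show ?thesis unfolding bargmann_fourier using assms by simp
  qed
  moreover have "integrable lborel (\<lambda>x. of_real (exp (- \<sigma> * x\<^sup>2)) * d x)"
    using bargmann_integrable[OF d \<open>\<sigma> > 0\<close>, of 0] by (simp flip: exp_of_real)
  ultimately have "AE x in lborel. of_real (exp (- \<sigma> * x\<^sup>2)) * d x = 0"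
    by (intro fourier_eq_zero_imp_AE_zero)
  then show ?thesis by eventually_elim (simp add: d_def)
qed

context frt_parameter
begin

text \<open>
  The computation behind the intertwining relation. Because \<open>\<gamma> * (1 - a\<^sup>2) = \<sigma>\<close>, the coefficient of
  \<open>- y\<^sup>2\<close> in the exponent is again \<open>\<gamma>\<close>, and completing the square leaves \<open>- \<sigma> * (x - a * w)\<^sup>2\<close>.
\<close>

lemma gaussian_frt_kernel:
  "of_real (sqrt (\<sigma> / pi)) / csqrt (1 - a\<^sup>2) *
     (LINT y|lborel. exp (- (of_real \<sigma> * (of_real y - w)\<^sup>2)) * frt_kernel \<sigma> a x y) =
   exp (- (of_real \<sigma> * (of_real x - a * w)\<^sup>2))"
proof -
  define \<beta> where "\<beta> = 2 * (of_real \<sigma> * w + \<gamma> * a * of_real x)"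
  define \<delta> where "\<delta> = of_real \<sigma> * w\<^sup>2 + \<gamma> * (of_real x)\<^sup>2"
  have nz: "1 - a\<^sup>2 \<noteq> 0" using a by simp
  have \<gamma>1: "\<gamma> * (1 - a\<^sup>2) = of_real \<sigma>" using nz by (simp add: \<gamma>_def)
  have "exp (- (of_real \<sigma> * (of_real y - w)\<^sup>2)) * frt_kernel \<sigma> a x y =
      exp (- \<gamma> * (of_real y)\<^sup>2 + \<beta> * of_real y) * exp (- \<delta>)" for y
  proof -
    have "- (of_real \<sigma> * (of_real y - w)\<^sup>2) + - \<gamma> * (of_real x - of_real y * a)\<^sup>2 =
        - \<gamma> * (of_real y)\<^sup>2 + \<beta> * of_real y + - \<delta>"
      unfolding \<beta>_def \<delta>_def \<gamma>1 [symmetric] by (simp add: power2_eq_square algebra_simps)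
    then show ?thesis
      unfolding frt_kernel_def \<gamma>_def [symmetric] exp_add [symmetric] by simp
  qed
  then have "(LINT y|lborel. exp (- (of_real \<sigma> * (of_real y - w)\<^sup>2)) * frt_kernel \<sigma> a x y) =
      of_real (sqrt pi) / csqrt \<gamma> * (exp (\<beta>\<^sup>2 / (4 * \<gamma>)) * exp (- \<delta>))"
    using integral_gaussian[of \<gamma> \<beta>] \<sigma> \<gamma>_props(3) by simp
  also have "exp (\<beta>\<^sup>2 / (4 * \<gamma>)) * exp (- \<delta>) = exp (- (of_real \<sigma> * (of_real x - a * w)\<^sup>2))"
  proof -
    have "\<beta>\<^sup>2 / (4 * \<gamma>) = \<gamma> * ((1 - a\<^sup>2) * w + a * of_real x)\<^sup>2"
      unfolding \<beta>_def \<gamma>1 [symmetric] using \<gamma>_props(6)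
      by (simp add: power2_eq_square field_simps)
    then have "\<beta>\<^sup>2 / (4 * \<gamma>) + - \<delta> = - (of_real \<sigma> * (of_real x - a * w)\<^sup>2)"
      unfolding \<delta>_def \<gamma>1 [symmetric] by (simp add: power2_eq_square algebra_simps)
    then show ?thesis by (simp only: exp_add [symmetric])
  qed
  also have "of_real (sqrt (\<sigma> / pi)) / csqrt (1 - a\<^sup>2) * (of_real (sqrt pi) / csqrt \<gamma> * exp (- (of_real \<sigma> * (of_real x - a * w)\<^sup>2))) =
      exp (- (of_real \<sigma> * (of_real x - a * w)\<^sup>2))"
  proof -
    \<comment> \<open>The principal roots multiply because both factors lie in the right half-plane.\<close>
    have "csqrt (1 - a\<^sup>2) * csqrt \<gamma> = of_real (sqrt \<sigma>)"
    proof -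
      define v where "v = csqrt \<gamma>"
      have v2: "v\<^sup>2 = \<gamma>" by (simp add: v_def)
      then have "Re (v\<^sup>2) > 0" using \<gamma>_props(3) \<sigma> by simp
      then have "Re v \<noteq> 0" by (auto simp: Re_power2 not_less)
      then have v: "Re v > 0" using csqrt_principal[of \<gamma>] by (auto simp: v_def)
      have "csqrt (1 - a\<^sup>2) = of_real (sqrt \<sigma>) / v"
      proof (rule csqrt_unique)
        have "(of_real (sqrt \<sigma>) / v)\<^sup>2 = of_real \<sigma> / \<gamma>"
          using \<sigma> by (simp add: power_divide v2 flip: of_real_power)
        also have "\<dots> = 1 - a\<^sup>2"
          using nonzero_mult_div_cancel_left[OF \<gamma>_props(6), of "1 - a\<^sup>2"] by (simp only: \<gamma>1)
        finally show "(of_real (sqrt \<sigma>) / v)\<^sup>2 = 1 - a\<^sup>2" .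
        show "0 < Re (of_real (sqrt \<sigma>) / v) \<or> Re (of_real (sqrt \<sigma>) / v) = 0 \<and> 0 \<le> Im (of_real (sqrt \<sigma>) / v)"
          using v \<sigma> by (simp add: Re_divide sum_power2_gt_zero_iff)
      qed
      moreover have "v \<noteq> 0" using v by auto
      ultimately show ?thesis by (simp add: v_def [symmetric])
    qed
    then have "csqrt (1 - a\<^sup>2) * csqrt \<gamma> * of_real (sqrt pi) = of_real (sqrt \<sigma>) * of_real (sqrt pi)" by simp
    then show ?thesis using \<sigma> nz \<gamma>_props(6) by (simp add: real_sqrt_divide field_simps)
  qed
  finally show ?thesis by (simp only: mult.assoc)
qed

text \<open>
  On a set of finite measure the order of the two integrations may be exchanged; in chirped form this
  is again the multiplication formula.
\<close>

lemma bargmann_frt: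
  assumes f: "f \<in> L2G \<sigma>" and A[measurable]: "A \<in> sets borel" and fin: "emeasure lborel A < \<infinity>"
  shows "bargmann \<sigma> c (frt A \<sigma> a f) z = bargmann \<sigma> c (\<lambda>x. indicator A x * f x) (a * z)"
proof -
  have [measurable]: "f \<in> borel_measurable borel" using f by (simp add: L2G_def)
  define w where "w = of_real c * z"
  define K where "K = of_real (sqrt (\<sigma> / pi)) / csqrt (1 - a\<^sup>2)"
  define k where "k y = exp (- (of_real \<sigma> * (of_real y - w)\<^sup>2)) * exp (- (\<gamma> * a\<^sup>2) * (of_real y)\<^sup>2)" for y :: real
  have k: "integrable lborel k"
  proof -
    have eq: "k y = exp (- of_real \<sigma> * w\<^sup>2) * exp (- \<gamma> * (of_real y)\<^sup>2 + (2 * of_real \<sigma> * w) * of_real y)" for y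
    proof -
      have "- (of_real \<sigma> * (of_real y - w)\<^sup>2) + - (\<gamma> * a\<^sup>2) * (of_real y)\<^sup>2 =
          - of_real \<sigma> * w\<^sup>2 + (- \<gamma> * (of_real y)\<^sup>2 + (2 * of_real \<sigma> * w) * of_real y)"
        unfolding \<gamma>_props(1) by (simp add: power2_eq_square algebra_simps)
      then show ?thesis unfolding k_def by (simp only: exp_add [symmetric])
    qed
    then have "k = (\<lambda>y. exp (- of_real \<sigma> * w\<^sup>2) * exp (- \<gamma> * (of_real y)\<^sup>2 + (2 * of_real \<sigma> * w) * of_real y))"
      by (intro ext eq)
    moreover have "integrable lborel (\<lambda>y. exp (- of_real \<sigma> * w\<^sup>2) * exp (- \<gamma> * (of_real y)\<^sup>2 + (2 * of_real \<sigma> * w) * of_real y))"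
      using \<gamma>_props(3) \<sigma> by (intro integrable_mult_right integrable_gaussian) simp
    ultimately show ?thesis by (simp only:)
  qed
  have "(LINT y|lborel. exp (- (of_real \<sigma> * (of_real y - w)\<^sup>2)) * frt A \<sigma> a f y) =
      K * (LINT y|lborel. fourier (chirped A f) (s * y) * k y)"
    unfolding frt_eq_fourier k_def K_def by (subst integral_mult_right_zero [symmetric], intro Bochner_Integration.integral_cong refl, simp only: mult_ac)
  also have "(LINT y|lborel. fourier (chirped A f) (s * y) * k y) = (LINT x|lborel. chirped A f x * fourier k (s * x))"
    by (intro integral_fourier_mult integrable_chirped assms k)
  also have "K * \<dots> = (LINT x|lborel. K * (chirped A f x * fourier k (s * x)))"
    by simp
  also have "\<dots> = (LINT x|lborel. exp (- (of_real \<sigma> * (of_real x - a * w)\<^sup>2)) * (indicator A x * f x))"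
  proof (intro Bochner_Integration.integral_cong refl)
    fix x
    have "exp (- \<gamma> * (of_real x)\<^sup>2) * fourier k (s * x) =
        (LINT y|lborel. exp (- (of_real \<sigma> * (of_real y - w)\<^sup>2)) * frt_kernel \<sigma> a x y)"
      unfolding fourier_def k_def frt_kernel_factor
      by (subst integral_mult_right_zero [symmetric], intro Bochner_Integration.integral_cong refl, simp only: mult_ac)
    then have "K * (exp (- \<gamma> * (of_real x)\<^sup>2) * fourier k (s * x)) = exp (- (of_real \<sigma> * (of_real x - a * w)\<^sup>2))"
      unfolding K_def using gaussian_frt_kernel by simp
    moreover have "K * (chirped A f x * fourier k (s * x)) =
        K * (exp (- \<gamma> * (of_real x)\<^sup>2) * fourier k (s * x)) * (indicator A x * f x)"
      unfolding chirped_def by (simp only: mult_ac)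
    ultimately show "K * (chirped A f x * fourier k (s * x)) = exp (- (of_real \<sigma> * (of_real x - a * w)\<^sup>2)) * (indicator A x * f x)"
      by (simp only:)
  qed
  finally show ?thesis
    by (simp add: bargmann_def w_def mult_ac)
qed

text \<open>
  The relation for truncated transforms passes to the limit since evaluation of the
  Segal--Bargmann transform at a point is continuous on both sides.
\<close>

theorem bargmann_is_frt:
  assumes f: "f \<in> L2G \<sigma>" and h: "is_frt \<sigma> a f h"
  shows "bargmann \<sigma> c h z = bargmann \<sigma> c f (a * z)"
proof (rule tendsto_unique)
  have [measurable]: "f \<in> borel_measurable borel" using f by (simp add: L2G_def)
  have F: "(\<lambda>x. indicator A x * f x) \<in> L2G \<sigma>" if [measurable]: "A \<in> sets borel" for A
  proof -
    have "sq_norm (gauss \<sigma>) (\<lambda>x. indicator A x * f x) \<le> sq_norm (gauss \<sigma>) f"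
      by (rule sq_norm_mono) (simp add: indicator_def norm_mult)
    then show ?thesis using f by (auto simp: L2G_def intro: order.strict_trans1)
  qed
  show "((\<lambda>R. bargmann \<sigma> c (frt {-R..R} \<sigma> a f) z) \<longlongrightarrow> bargmann \<sigma> c h z) at_top"
  proof (rule bargmann_tendsto[OF \<sigma>])
    show "\<forall>\<^sub>F R in at_top. frt {-R..R} \<sigma> a f \<in> L2G \<sigma>"
      using eventually_gt_at_top[of 0] by eventually_elim (use h in \<open>auto simp: is_frt_def\<close>)
  qed (use h in \<open>auto simp: is_frt_def\<close>)
  have "((\<lambda>R. bargmann \<sigma> c (\<lambda>x. indicator {-R..R} x * f x) (a * z)) \<longlongrightarrow> bargmann \<sigma> c f (a * z)) at_top"
  proof (rule bargmann_tendsto[OF \<sigma> _ f])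
    have "cmod (indicator {-R..R} x * f x - f x) = cmod (indicator (- {-R..R}) x * f x)" for R x
      by (auto simp: indicator_def)
    then show "((\<lambda>R. sq_norm (gauss \<sigma>) (\<lambda>x. indicator {-R..R} x * f x - f x)) \<longlongrightarrow> 0) at_top"
      using L2G_tail[OF f] by (simp add: sq_norm_def)
  qed (simp add: F)
  then show "((\<lambda>R. bargmann \<sigma> c (frt {-R..R} \<sigma> a f) z) \<longlongrightarrow> bargmann \<sigma> c f (a * z)) at_top"
    using f by (simp add: bargmann_frt emeasure_lborel_Icc_eq)
qed simp

end

section \<open>Finiteness of the Fock norm\<close>

lemma lborel_complex_eq: "(lborel :: complex measure) = distr (lborel \<Otimes>\<^sub>M lborel) borel (\<lambda>(p, q). Complex p q)"
proof (rule lborel_eqI)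
  have meas: "(\<lambda>(p, q). Complex p q) \<in> borel_measurable (lborel \<Otimes>\<^sub>M lborel)"
  proof -
    have "(\<lambda>(p, q). Complex p q) = (\<lambda>x. of_real (fst x) + \<i> * of_real (snd x))"
      by (auto simp: complex_eq_iff)
    then show ?thesis by simp
  qed
  fix l u :: complex
  assume le: "\<And>b. b \<in> Basis \<Longrightarrow> l \<bullet> b \<le> u \<bullet> b"
  have "Re l \<le> Re u" "Im l \<le> Im u"
    using le[of 1] le[of \<i>] by (simp_all add: Basis_complex_def)
  moreover have "(\<lambda>(p, q). Complex p q) -` box l u \<inter> space (lborel \<Otimes>\<^sub>M lborel) = box (Re l) (Re u) \<times> box (Im l) (Im u)"
    by (auto simp: box_complex_eq space_pair_measure)
  ultimately show "emeasure (distr (lborel \<Otimes>\<^sub>M lborel) borel (\<lambda>(p, q). Complex p q)) (box l u) = ennreal (\<Prod>b\<in>Basis. (u - l) \<bullet> b)"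
    using meas by (simp add: emeasure_distr lborel.emeasure_pair_measure_Times Basis_complex_def ennreal_mult)
qed simp

lemma nn_integral_complex:
  fixes f :: "complex \<Rightarrow> ennreal"
  assumes [measurable]: "f \<in> borel_measurable borel"
  shows "(\<integral>\<^sup>+z. f z \<partial>lborel) = (\<integral>\<^sup>+p. \<integral>\<^sup>+q. f (Complex p q) \<partial>lborel \<partial>lborel)"
proof -
  have Complex_eq: "Complex p q = of_real p + \<i> * of_real q" for p q by (simp add: complex_eq_iff)
  have [measurable]: "(\<lambda>(p, q). Complex p q) \<in> borel_measurable (lborel \<Otimes>\<^sub>M lborel)"
    unfolding Complex_eq by measurable
  have "(\<integral>\<^sup>+z. f z \<partial>lborel) = (\<integral>\<^sup>+x. f (case x of (p, q) \<Rightarrow> Complex p q) \<partial>(lborel \<Otimes>\<^sub>M lborel))"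
    by (subst lborel_complex_eq, subst nn_integral_distr) simp_all
  also have "\<dots> = (\<integral>\<^sup>+p. \<integral>\<^sup>+q. f (case (p, q) of (p, q) \<Rightarrow> Complex p q) \<partial>lborel \<partial>lborel)"
    by (rule lborel.nn_integral_fst [symmetric]) simp
  finally show ?thesis by simp
qed

lemma nn_integral_complex_gaussian_finite:
  assumes "k > 0"
  shows "(\<integral>\<^sup>+z. ennreal (exp (- k * (cmod z)\<^sup>2)) \<partial>lborel) < \<infinity>"
proof -
  define E where "E = (\<integral>\<^sup>+p. ennreal (exp (- k * p\<^sup>2)) \<partial>lborel)"
  have E: "E < \<infinity>"
    using has_bochner_integral_gaussian_real[OF assms, of 0]
    by (simp add: E_def has_bochner_integral_iff nn_integral_eq_integral)
  have "ennreal (exp (- k * (cmod (Complex p q))\<^sup>2)) = ennreal (exp (- k * p\<^sup>2)) * ennreal (exp (- k * q\<^sup>2))" for p q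
    by (simp add: cmod_power2 distrib_left exp_diff exp_minus field_simps flip: ennreal_mult exp_add)
  then have "(\<integral>\<^sup>+z. ennreal (exp (- k * (cmod z)\<^sup>2)) \<partial>lborel) = E * E"
    by (subst nn_integral_complex) (simp_all add: E_def nn_integral_cmult nn_integral_multc)
  then show ?thesis using E by (simp add: ennreal_mult_less_top)
qed

lemma borel_measurable_bargmann [measurable]:
  assumes "f \<in> L2G \<sigma>" "\<sigma> > 0" "c > 0"
  shows "bargmann \<sigma> c f \<in> borel_measurable borel"
  using bargmann_holomorphic[OF assms] holomorphic_on_imp_continuous_on
  by (intro borel_measurable_continuous_onI) auto

text \<open>
  On the line \<open>Re z = p\<close>, the weight in \<open>q\<close> exactly cancels the growth of the transform, so
  Plancherel's inequality bounds the inner integral by that of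
  \<open>exp (- 2 * \<sigma> * c\<^sup>2 * p\<^sup>2 - 2 * \<sigma> * (x - c * p)\<^sup>2) * (cmod (f x))\<^sup>2\<close>. Integrating this over \<open>p\<close> first leaves a
  multiple of \<open>exp (- \<sigma> * x\<^sup>2) * (cmod (f x))\<^sup>2\<close>.
\<close>

lemma bargmann_fock_finite:
  assumes f: "f \<in> L2G \<sigma>" and "\<sigma> > 0" "c > 0"
  shows "(\<integral>\<^sup>+z. ennreal ((cmod (bargmann \<sigma> c f z))\<^sup>2 * exp (- (2 * \<sigma> * c\<^sup>2) * (cmod z)\<^sup>2)) \<partial>lborel) < \<infinity>"
proof -
  have [measurable]: "f \<in> borel_measurable borel" using f by (simp add: L2G_def)
  note [measurable] = borel_measurable_bargmann[OF assms]
  define k where "k = 2 * \<sigma> * c\<^sup>2"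
  define u where "u p x = of_real (exp (- \<sigma> * (x - c * p)\<^sup>2)) * f x" for p x
  have u_int: "integrable lborel (u p)" for p
    using bargmann_integrable[OF f \<open>\<sigma> > 0\<close>, of "of_real (c * p)"]
    unfolding u_def by (simp flip: exp_of_real)
  have [measurable]: "u p \<in> borel_measurable borel" for p unfolding u_def by measurable
  define C where "C = (\<sigma> / pi) * (1 / (2 * \<sigma> * c)) * (2 * pi)"
  have C: "C \<ge> 0" using assms by (simp add: C_def)
  have inner: "(\<integral>\<^sup>+q. ennreal ((cmod (bargmann \<sigma> c f (Complex p q)))\<^sup>2 * exp (- k * (cmod (Complex p q))\<^sup>2)) \<partial>lborel)
      \<le> ennreal C * (\<integral>\<^sup>+x. ennreal (exp (- k * p\<^sup>2) * (cmod (u p x))\<^sup>2) \<partial>lborel)" for p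
  proof -
    define L where "L = (\<sigma> / pi) * exp (- k * p\<^sup>2)"
    have "L \<ge> 0" using assms by (simp add: L_def)
    have pt: "(cmod (bargmann \<sigma> c f (Complex p q)))\<^sup>2 * exp (- k * (cmod (Complex p q))\<^sup>2) =
        L * (cmod (fourier (u p) (0 + (2 * \<sigma> * c) * q)))\<^sup>2" for q
    proof -
      let ?E = "exp (\<sigma> * c\<^sup>2 * q\<^sup>2)" and ?F = "cmod (fourier (u p) (0 + (2 * \<sigma> * c) * q))"
      have "?E\<^sup>2 * exp (- k * (p\<^sup>2 + q\<^sup>2)) = exp (- k * p\<^sup>2)"
        by (simp add: k_def algebra_simps flip: exp_double exp_add)
      moreover have "cmod (bargmann \<sigma> c f (Complex p q)) = sqrt (\<sigma> / pi) * ?E * ?F"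
        using assms unfolding bargmann_fourier u_def [symmetric] by (simp add: norm_mult)
      then have "(cmod (bargmann \<sigma> c f (Complex p q)))\<^sup>2 * exp (- k * (cmod (Complex p q))\<^sup>2) =
          (sqrt (\<sigma> / pi))\<^sup>2 * (?E\<^sup>2 * exp (- k * (p\<^sup>2 + q\<^sup>2))) * ?F\<^sup>2"
        by (simp add: cmod_power2 power_mult_distrib mult_ac)
      ultimately have "(cmod (bargmann \<sigma> c f (Complex p q)))\<^sup>2 * exp (- k * (cmod (Complex p q))\<^sup>2) =
          (sqrt (\<sigma> / pi))\<^sup>2 * exp (- k * p\<^sup>2) * ?F\<^sup>2"
        by metis
      then show ?thesis using assms by (simp add: L_def)
    qed
    have "(\<integral>\<^sup>+q. ennreal ((cmod (bargmann \<sigma> c f (Complex p q)))\<^sup>2 * exp (- k * (cmod (Complex p q))\<^sup>2)) \<partial>lborel) =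
        ennreal L * (\<integral>\<^sup>+q. ennreal ((cmod (fourier (u p) (0 + (2 * \<sigma> * c) * q)))\<^sup>2) \<partial>lborel)"
      unfolding pt using \<open>L \<ge> 0\<close> by (simp add: ennreal_mult nn_integral_cmult)
    also have "ennreal L = ennreal (L / (2 * \<sigma> * c)) * ennreal \<bar>2 * \<sigma> * c\<bar>"
      using assms \<open>L \<ge> 0\<close> by (simp flip: ennreal_mult)
    also have "\<dots> * (\<integral>\<^sup>+q. ennreal ((cmod (fourier (u p) (0 + (2 * \<sigma> * c) * q)))\<^sup>2) \<partial>lborel) =
        ennreal (L / (2 * \<sigma> * c)) * (\<integral>\<^sup>+\<xi>. ennreal ((cmod (fourier (u p) \<xi>))\<^sup>2) \<partial>lborel)"
      using assms nn_integral_real_affine[of "\<lambda>\<xi>. ennreal ((cmod (fourier (u p) \<xi>))\<^sup>2)" "2 * \<sigma> * c" 0]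
      by (simp only: mult.assoc) simp
    also have "\<dots> \<le> ennreal (L / (2 * \<sigma> * c)) * (ennreal (2 * pi) * (\<integral>\<^sup>+x. ennreal ((cmod (u p x))\<^sup>2) \<partial>lborel))"
      by (intro mult_left_mono Plancherel_inequality u_int) simp
    also have "\<dots> = ennreal C * (ennreal (exp (- k * p\<^sup>2)) * (\<integral>\<^sup>+x. ennreal ((cmod (u p x))\<^sup>2) \<partial>lborel))"
    proof -
      have "ennreal (L / (2 * \<sigma> * c)) * ennreal (2 * pi) = ennreal (L / (2 * \<sigma> * c) * (2 * pi))"
        using assms \<open>L \<ge> 0\<close> by (intro ennreal_mult [symmetric]) simp_all
      also have "L / (2 * \<sigma> * c) * (2 * pi) = C * exp (- k * p\<^sup>2)"
        by (simp add: L_def C_def)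
      also have "ennreal \<dots> = ennreal C * ennreal (exp (- k * p\<^sup>2))"
        by (intro ennreal_mult C) simp
      finally show ?thesis by (simp only: mult.assoc [symmetric])
    qed
    also have "\<dots> = ennreal C * (\<integral>\<^sup>+x. ennreal (exp (- k * p\<^sup>2) * (cmod (u p x))\<^sup>2) \<partial>lborel)"
      by (simp add: ennreal_mult nn_integral_cmult)
    finally show ?thesis .
  qed
  define D where "D = sqrt (pi / (2 * k))"
  have outer: "(\<integral>\<^sup>+p. ennreal (exp (- k * p\<^sup>2) * (cmod (u p x))\<^sup>2) \<partial>lborel) = ennreal D * ennreal ((cmod (f x))\<^sup>2 * exp (- \<sigma> * x\<^sup>2))" for x
  proof -
    have k: "k > 0" using assms by (simp add: k_def)
    have "exp (- k * p\<^sup>2) * (cmod (u p x))\<^sup>2 = ((cmod (f x))\<^sup>2 * exp (- 2 * \<sigma> * x\<^sup>2)) * exp (- (2 * k) * p\<^sup>2 + (4 * \<sigma> * c * x) * p)" for p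
    proof -
      have "exp (- k * p\<^sup>2) * (exp (- \<sigma> * (x - c * p)\<^sup>2))\<^sup>2 = exp (- 2 * \<sigma> * x\<^sup>2) * exp (- (2 * k) * p\<^sup>2 + (4 * \<sigma> * c * x) * p)"
        by (simp add: k_def power2_diff algebra_simps flip: exp_double exp_add)
      then show ?thesis by (simp add: u_def norm_mult power_mult_distrib mult_ac)
    qed
    then have "(\<integral>\<^sup>+p. ennreal (exp (- k * p\<^sup>2) * (cmod (u p x))\<^sup>2) \<partial>lborel) =
        ennreal ((cmod (f x))\<^sup>2 * exp (- 2 * \<sigma> * x\<^sup>2)) * (\<integral>\<^sup>+p. ennreal (exp (- (2 * k) * p\<^sup>2 + (4 * \<sigma> * c * x) * p)) \<partial>lborel)"
      by (simp add: ennreal_mult nn_integral_cmult)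
    also have "(\<integral>\<^sup>+p. ennreal (exp (- (2 * k) * p\<^sup>2 + (4 * \<sigma> * c * x) * p)) \<partial>lborel) =
        ennreal (sqrt (pi / (2 * k)) * exp ((4 * \<sigma> * c * x)\<^sup>2 / (4 * (2 * k))))"
      using has_bochner_integral_gaussian_real[of "2 * k" "4 * \<sigma> * c * x"] k
      by (simp add: has_bochner_integral_iff nn_integral_eq_integral)
    also have "(4 * \<sigma> * c * x)\<^sup>2 / (4 * (2 * k)) = \<sigma> * x\<^sup>2"
      using assms by (simp add: k_def power2_eq_square field_simps)
    also have "ennreal ((cmod (f x))\<^sup>2 * exp (- 2 * \<sigma> * x\<^sup>2)) * ennreal (sqrt (pi / (2 * k)) * exp (\<sigma> * x\<^sup>2)) =
        ennreal D * ennreal ((cmod (f x))\<^sup>2 * exp (- \<sigma> * x\<^sup>2))"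
    proof -
      have "exp (- 2 * \<sigma> * x\<^sup>2) * exp (\<sigma> * x\<^sup>2) = exp (- \<sigma> * x\<^sup>2)" by (simp flip: exp_add)
      then have "((cmod (f x))\<^sup>2 * exp (- 2 * \<sigma> * x\<^sup>2)) * (D * exp (\<sigma> * x\<^sup>2)) = D * ((cmod (f x))\<^sup>2 * exp (- \<sigma> * x\<^sup>2))"
        by (metis mult.assoc mult.commute)
      then show ?thesis using k unfolding D_def by (simp flip: ennreal_mult)
    qed
    finally show ?thesis .
  qed
  have "(\<integral>\<^sup>+z. ennreal ((cmod (bargmann \<sigma> c f z))\<^sup>2 * exp (- k * (cmod z)\<^sup>2)) \<partial>lborel) =
      (\<integral>\<^sup>+p. \<integral>\<^sup>+q. ennreal ((cmod (bargmann \<sigma> c f (Complex p q)))\<^sup>2 * exp (- k * (cmod (Complex p q))\<^sup>2)) \<partial>lborel \<partial>lborel)"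
    by (rule nn_integral_complex) simp
  also have "\<dots> \<le> (\<integral>\<^sup>+p. ennreal C * (\<integral>\<^sup>+x. ennreal (exp (- k * p\<^sup>2) * (cmod (u p x))\<^sup>2) \<partial>lborel) \<partial>lborel)"
    by (intro nn_integral_mono inner)
  also have "\<dots> = ennreal C * (\<integral>\<^sup>+p. \<integral>\<^sup>+x. ennreal (exp (- k * p\<^sup>2) * (cmod (u p x))\<^sup>2) \<partial>lborel \<partial>lborel)"
    unfolding u_def by (rule nn_integral_cmult) measurable
  also have "(\<integral>\<^sup>+p. \<integral>\<^sup>+x. ennreal (exp (- k * p\<^sup>2) * (cmod (u p x))\<^sup>2) \<partial>lborel \<partial>lborel) =
      (\<integral>\<^sup>+x. \<integral>\<^sup>+p. ennreal (exp (- k * p\<^sup>2) * (cmod (u p x))\<^sup>2) \<partial>lborel \<partial>lborel)"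
    unfolding u_def by (rule lborel_pair.Fubini') measurable
  also have "\<dots> = ennreal D * sq_norm (gauss \<sigma>) f"
    unfolding outer by (subst sq_norm_gauss) (simp_all add: nn_integral_cmult)
  also have "ennreal C * \<dots> < \<infinity>"
    using f by (simp add: L2G_def ennreal_mult_less_top)
  finally show ?thesis by (simp add: k_def)
qed

text \<open>
  For \<open>\<omega> = \<i>\<close> and \<open>\<omega> = - \<i>\<close> the arguments of \<open>H\<close> and \<open>K\<close> are the two idempotent coordinates of
  \<open>Z\<close>. One translation for each fixed second coordinate replaces the linear change of variables in
  four dimensions.
\<close>

lemma nn_integral_idempotent_coordinates:
  fixes H K :: "complex \<Rightarrow> ennreal" and \<omega> :: complex
  assumes [measurable]: "H \<in> borel_measurable borel" "K \<in> borel_measurable borel"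
  shows "(\<integral>\<^sup>+Z. H (fst Z - \<omega> * snd Z) * K (fst Z + \<omega> * snd Z) \<partial>lborel) =
         (\<integral>\<^sup>+z. \<integral>\<^sup>+w. H z * K (z + 2 * \<omega> * w) \<partial>lborel \<partial>lborel)"
proof -
  have "(\<integral>\<^sup>+Z. H (fst Z - \<omega> * snd Z) * K (fst Z + \<omega> * snd Z) \<partial>lborel) =
      (\<integral>\<^sup>+Z. H (fst Z - \<omega> * snd Z) * K (fst Z + \<omega> * snd Z) \<partial>(lborel \<Otimes>\<^sub>M lborel))"
    by (simp add: lborel_prod)
  also have "\<dots> = (\<integral>\<^sup>+w. \<integral>\<^sup>+z. H (z - \<omega> * w) * K (z + \<omega> * w) \<partial>lborel \<partial>lborel)"
    by (subst lborel_pair.nn_integral_snd [symmetric]) simp_all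
  also have "\<dots> = (\<integral>\<^sup>+w. \<integral>\<^sup>+z. H z * K (z + 2 * \<omega> * w) \<partial>lborel \<partial>lborel)"
  proof (rule nn_integral_cong)
    fix w :: complex
    have "(\<integral>\<^sup>+z. H (z - \<omega> * w) * K (z + \<omega> * w) \<partial>lborel) =
        (\<integral>\<^sup>+z. H (z - \<omega> * w) * K (z + \<omega> * w) \<partial>distr lborel borel ((+) (\<omega> * w)))"
      by (simp only: lborel_distr_plus)
    also have "\<dots> = (\<integral>\<^sup>+z. H z * K (z + 2 * \<omega> * w) \<partial>lborel)"
      by (subst nn_integral_distr) (simp_all add: algebra_simps)
    finally show "(\<integral>\<^sup>+z. H (z - \<omega> * w) * K (z + \<omega> * w) \<partial>lborel) = (\<integral>\<^sup>+z. H z * K (z + 2 * \<omega> * w) \<partial>lborel)" .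
  qed
  also have "\<dots> = (\<integral>\<^sup>+z. \<integral>\<^sup>+w. H z * K (z + 2 * \<omega> * w) \<partial>lborel \<partial>lborel)"
    by (rule lborel_pair.Fubini') simp
  finally show ?thesis .
qed

text \<open>
  One component of an element of the Fock space depends on one idempotent coordinate only; the other
  coordinate contributes a Gaussian integral that does not depend on the first.
\<close>

lemma nn_integral_idempotent_gaussian_finite:
  fixes H :: "complex \<Rightarrow> ennreal"
  assumes [measurable]: "H \<in> borel_measurable borel" and H: "(\<integral>\<^sup>+z. H z \<partial>lborel) < \<infinity>"
    and "k > 0" and \<omega>: "cmod \<omega> = 1"
  shows "(\<integral>\<^sup>+Z. H (fst Z - \<omega> * snd Z) * ennreal (exp (- k * (cmod (fst Z + \<omega> * snd Z))\<^sup>2)) \<partial>lborel) < \<infinity>"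
proof -
  define E where "E = (\<integral>\<^sup>+w. ennreal (exp (- (4 * k) * (cmod w)\<^sup>2)) \<partial>lborel)"
  have shift: "(\<integral>\<^sup>+w. ennreal (exp (- k * (cmod (z + 2 * \<omega> * w))\<^sup>2)) \<partial>lborel) = E" for z
  proof -
    \<comment> \<open>The modulus of \<open>z + 2 * \<omega> * w\<close> is twice that of \<open>t + w\<close>, so that a translation suffices.\<close>
    define t where "t = z / (2 * \<omega>)"
    have "\<omega> \<noteq> 0" using \<omega> by auto
    have "(cmod (z + 2 * \<omega> * w))\<^sup>2 = 4 * (cmod (t + w))\<^sup>2" for w
    proof -
      have "z + 2 * \<omega> * w = 2 * \<omega> * (t + w)" using \<open>\<omega> \<noteq> 0\<close> by (simp add: t_def field_simps)
      then have "cmod (z + 2 * \<omega> * w) = 2 * cmod (t + w)" using \<omega> by (simp add: norm_mult)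
      then show ?thesis by (simp add: power_mult_distrib)
    qed
    then have "(\<integral>\<^sup>+w. ennreal (exp (- k * (cmod (z + 2 * \<omega> * w))\<^sup>2)) \<partial>lborel) =
        (\<integral>\<^sup>+w. ennreal (exp (- (4 * k) * (cmod (t + w))\<^sup>2)) \<partial>lborel)"
      by (simp add: mult_ac)
    also have "\<dots> = (\<integral>\<^sup>+w. ennreal (exp (- (4 * k) * (cmod w)\<^sup>2)) \<partial>distr lborel borel ((+) t))"
      by (subst nn_integral_distr) simp_all
    finally show ?thesis by (simp only: lborel_distr_plus E_def)
  qed
  have "(\<integral>\<^sup>+Z. H (fst Z - \<omega> * snd Z) * ennreal (exp (- k * (cmod (fst Z + \<omega> * snd Z))\<^sup>2)) \<partial>lborel) =
      (\<integral>\<^sup>+z. \<integral>\<^sup>+w. H z * ennreal (exp (- k * (cmod (z + 2 * \<omega> * w))\<^sup>2)) \<partial>lborel \<partial>lborel)"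
    by (rule nn_integral_idempotent_coordinates) simp_all
  also have "\<dots> = (\<integral>\<^sup>+z. H z * E \<partial>lborel)"
    by (subst nn_integral_cmult) (simp_all only: shift, simp)
  also have "\<dots> = (\<integral>\<^sup>+z. H z \<partial>lborel) * E"
    by (rule nn_integral_multc) simp
  also have "\<dots> < \<infinity>"
    using H nn_integral_complex_gaussian_finite[of "4 * k"] \<open>k > 0\<close> by (simp add: E_def ennreal_mult_less_top)
  finally show ?thesis .
qed

section \<open>Transfer to bicomplex numbers\<close>

text \<open>
  The two projections are treated alike, so statements are made for an arbitrary one of them.
\<close>

definition bc_components :: "(bicomplex \<Rightarrow> complex) set" where
  "bc_components = {bc_plus, bc_minus}"

lemma bc_eq_iff_components: "Z = W \<longleftrightarrow> (\<forall>\<pi>\<in>bc_components. \<pi> Z = \<pi> W)"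
  unfolding bc_components_def by (metis bc_idem_plus_minus insertCI insertE singletonD)

lemma component_simps:
  assumes "\<pi> \<in> bc_components"
  shows "\<pi> (Z *\<^sub>T W) = \<pi> Z * \<pi> W" "\<pi> (Z /\<^sub>T W) = \<pi> Z / \<pi> W" "\<pi> (bc_exp Z) = exp (\<pi> Z)"
    "\<pi> (bc_sqrt Z) = csqrt (\<pi> Z)" "\<pi> (bc_conj Z) = cnj (\<pi> Z)" "\<pi> (bc_of_real r) = of_real r"
    "\<pi> bc_one = 1" "\<pi> (bc_sq Z) = (\<pi> Z)\<^sup>2" "\<pi> (bc_idem z z) = z"
  using assms by (auto simp: bc_components_def bc_div_def bc_exp_def bc_sqrt_def bc_conj_def
      bc_sq_def power2_eq_square) (simp_all add: bc_of_real_def bc_one_def bc_plus_def bc_minus_def)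

lemma bounded_linear_component: "\<pi> \<in> bc_components \<Longrightarrow> bounded_linear \<pi>"
  by (auto simp: bc_components_def bc_plus_def [abs_def] bc_minus_def [abs_def]
      intro!: bounded_linear_sub bounded_linear_add bounded_linear_const_mult bounded_linear_fst bounded_linear_snd)

lemma component_linear:
  assumes "\<pi> \<in> bc_components"
  shows "\<pi> (Z + W) = \<pi> Z + \<pi> W" "\<pi> (Z - W) = \<pi> Z - \<pi> W" "\<pi> (- Z) = - \<pi> Z" "\<pi> (r *\<^sub>R Z) = of_real r * \<pi> Z" "\<pi> 0 = 0"
proof -
  interpret bounded_linear \<pi> by (rule bounded_linear_component[OF assms])
  show "\<pi> (Z + W) = \<pi> Z + \<pi> W" "\<pi> (Z - W) = \<pi> Z - \<pi> W" "\<pi> (- Z) = - \<pi> Z" "\<pi> (r *\<^sub>R Z) = of_real r * \<pi> Z" "\<pi> 0 = 0"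
    using diff[of 0 Z] by (simp_all add: add diff scaleR zero scaleR_conv_of_real)
qed

lemma component_measurable [measurable]: "bc_plus \<in> borel_measurable borel" "bc_minus \<in> borel_measurable borel"
  by (auto intro!: borel_measurable_continuous_onI linear_continuous_on bounded_linear_component simp: bc_components_def)

lemma component_measurable' [measurable]: "\<pi> \<in> bc_components \<Longrightarrow> \<pi> \<in> borel_measurable borel"
  by (auto simp: bc_components_def)

lemma bounded_linear_bc_idem: "bounded_linear (\<lambda>\<alpha>. bc_idem \<alpha> 0)" "bounded_linear (\<lambda>\<beta>. bc_idem 0 \<beta>)"
  unfolding bc_idem_eq
  by (auto intro!: bounded_linear_Pair bounded_linear_divide bounded_linear_const_mult bounded_linear_ident
      bounded_linear_compose[OF bounded_linear_divide] bounded_linear_minus)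

lemma bc_idem_add: "bc_idem \<alpha> \<beta> = bc_idem \<alpha> 0 + bc_idem 0 \<beta>"
  by (simp add: bc_idem_eq add_divide_distrib diff_divide_distrib right_diff_distrib)

lemma borel_measurable_bc_iff:
  "f \<in> borel_measurable M \<longleftrightarrow> (\<forall>\<pi>\<in>bc_components. (\<lambda>x. \<pi> (f x)) \<in> borel_measurable M)"
proof
  assume "\<forall>\<pi>\<in>bc_components. (\<lambda>x. \<pi> (f x)) \<in> borel_measurable M"
  then have [measurable]: "(\<lambda>x. bc_plus (f x)) \<in> borel_measurable M" "(\<lambda>x. bc_minus (f x)) \<in> borel_measurable M"
    by (auto simp: bc_components_def)
  have "(\<lambda>x. bc_idem (bc_plus (f x)) (bc_minus (f x))) \<in> borel_measurable M"
    unfolding bc_idem_eq by (intro borel_measurable_Pair) measurable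
  then show "f \<in> borel_measurable M" by simp
next
  assume [measurable]: "f \<in> borel_measurable M"
  show "\<forall>\<pi>\<in>bc_components. (\<lambda>x. \<pi> (f x)) \<in> borel_measurable M"
    by (auto simp: bc_components_def)
qed

lemma integrable_bc_iff:
  "integrable M f \<longleftrightarrow> (\<forall>\<pi>\<in>bc_components. integrable M (\<lambda>x. \<pi> (f x)))"
proof
  assume "\<forall>\<pi>\<in>bc_components. integrable M (\<lambda>x. \<pi> (f x))"
  then have "integrable M (\<lambda>x. bc_idem (bc_plus (f x)) 0 + bc_idem 0 (bc_minus (f x)))"
    by (intro Bochner_Integration.integrable_add integrable_bounded_linear[OF bounded_linear_bc_idem(1)]
        integrable_bounded_linear[OF bounded_linear_bc_idem(2)]) (auto simp: bc_components_def)
  then show "integrable M f" by (simp flip: bc_idem_add)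
next
  assume "integrable M f"
  then show "\<forall>\<pi>\<in>bc_components. integrable M (\<lambda>x. \<pi> (f x))"
    by (auto intro: integrable_bounded_linear[OF bounded_linear_component])
qed

lemma component_integral:
  "\<pi> \<in> bc_components \<Longrightarrow> integrable M f \<Longrightarrow> \<pi> (integral\<^sup>L M f) = (LINT x|M. \<pi> (f x))"
  by (rule integral_bounded_linear [OF bounded_linear_component, symmetric])

lemma L2T_iff: "\<phi> \<in> L2T \<sigma> \<longleftrightarrow> (\<forall>\<pi>\<in>bc_components. (\<lambda>x. \<pi> (\<phi> x)) \<in> L2G \<sigma>)"
  by (auto simp: L2T_def L2G_iff borel_measurable_bc_iff[of \<phi>] bc_components_def)

lemma L2T_diff: "\<phi> \<in> L2T \<sigma> \<Longrightarrow> \<psi> \<in> L2T \<sigma> \<Longrightarrow> (\<lambda>x. \<phi> x - \<psi> x) \<in> L2T \<sigma>"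
  by (simp add: L2T_iff component_linear L2G_diff)

lemma L2T_norm_eq:
  assumes \<phi>: "\<phi> \<in> L2T \<sigma>"
  shows "L2T_norm \<sigma> \<phi> = sqrt (sqrt (\<sigma> / pi) / 2 *
    ((LINT x|lborel. (cmod (bc_plus (\<phi> x)))\<^sup>2 * exp (- \<sigma> * x\<^sup>2)) +
     (LINT x|lborel. (cmod (bc_minus (\<phi> x)))\<^sup>2 * exp (- \<sigma> * x\<^sup>2))))"
proof -
  have comp: "\<pi> (exp (- \<sigma> * x\<^sup>2) *\<^sub>R (\<phi> x *\<^sub>T bc_conj (\<phi> x))) = of_real ((cmod (\<pi> (\<phi> x)))\<^sup>2 * exp (- \<sigma> * x\<^sup>2))"
    if "\<pi> \<in> bc_components" for \<pi> x
    using that by (simp add: component_simps component_linear complex_norm_square[symmetric] mult.commute)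
  have int: "integrable lborel (\<lambda>x. (cmod (\<pi> (\<phi> x)))\<^sup>2 * exp (- \<sigma> * x\<^sup>2))" if "\<pi> \<in> bc_components" for \<pi>
    using \<phi> that by (simp add: L2T_iff L2G_iff)
  have "integrable lborel (\<lambda>x. exp (- \<sigma> * x\<^sup>2) *\<^sub>R (\<phi> x *\<^sub>T bc_conj (\<phi> x)))"
    unfolding integrable_bc_iff by (auto simp only: comp intro!: integrable_of_real int)
  then have "\<pi> (L2T_inner \<sigma> \<phi> \<phi>) = of_real (sqrt (\<sigma> / pi) * (LINT x|lborel. (cmod (\<pi> (\<phi> x)))\<^sup>2 * exp (- \<sigma> * x\<^sup>2)))"
    if "\<pi> \<in> bc_components" for \<pi>
    using that unfolding L2T_inner_def
    by (simp only: component_linear(4)[OF that, of "sqrt (\<sigma> / pi)"] component_integral comp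
        integral_complex_of_real) (simp only: of_real_mult)
  from this[of bc_plus] this[of bc_minus] show ?thesis
    by (simp add: L2T_norm_def bc_inner_norm_def bc_components_def distrib_left add_divide_distrib)
qed

text \<open>
  The squared norm is a positive multiple of the sum of those of the components.
\<close>

lemma L2T_norm_tendsto_iff:
  assumes "\<sigma> > 0" and F: "\<forall>\<^sub>F R in A. F R \<in> L2T \<sigma>"
  shows "((\<lambda>R. L2T_norm \<sigma> (F R)) \<longlongrightarrow> 0) A \<longleftrightarrow>
    (\<forall>\<pi>\<in>bc_components. ((\<lambda>R. sq_norm (gauss \<sigma>) (\<lambda>x. \<pi> (F R x))) \<longlongrightarrow> 0) A)"
proof -
  define N where "N \<pi> R = (LINT x|lborel. (cmod (\<pi> (F R x)))\<^sup>2 * exp (- \<sigma> * x\<^sup>2))" for \<pi> :: "bicomplex \<Rightarrow> complex" and R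
  define c where "c = sqrt (\<sigma> / pi) / 2"
  have "c > 0" using assms by (simp add: c_def)
  have N: "N \<pi> R \<ge> 0" for \<pi> R unfolding N_def by (intro integral_nonneg_AE) simp
  have norm: "\<forall>\<^sub>F R in A. L2T_norm \<sigma> (F R) = sqrt (c * (N bc_plus R + N bc_minus R))"
    using F by eventually_elim (simp only: L2T_norm_eq N_def c_def)
  have "((\<lambda>R. sq_norm (gauss \<sigma>) (\<lambda>x. \<pi> (F R x))) \<longlongrightarrow> 0) A \<longleftrightarrow> (N \<pi> \<longlongrightarrow> 0) A" if \<pi>: "\<pi> \<in> bc_components" for \<pi>
  proof -
    have "\<forall>\<^sub>F R in A. sq_norm (gauss \<sigma>) (\<lambda>x. \<pi> (F R x)) = ennreal (N \<pi> R)"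
      using F
    proof eventually_elim
      case (elim R)
      then have "(\<lambda>x. \<pi> (F R x)) \<in> L2G \<sigma>" using \<pi> by (simp add: L2T_iff)
      then show ?case unfolding N_def
        by (subst sq_norm_gauss) (auto simp: L2G_iff intro!: nn_integral_eq_integral)
    qed
    then have "((\<lambda>R. sq_norm (gauss \<sigma>) (\<lambda>x. \<pi> (F R x))) \<longlongrightarrow> 0) A \<longleftrightarrow> ((\<lambda>R. ennreal (N \<pi> R)) \<longlongrightarrow> ennreal 0) A"
      by (simp add: tendsto_cong)
    also have "\<dots> \<longleftrightarrow> (N \<pi> \<longlongrightarrow> 0) A"
      using tendsto_ennrealD[of "N \<pi>" 0 A] tendsto_ennrealI[of "N \<pi>" 0 A] N by auto
    finally show ?thesis .
  qed
  then have "(\<forall>\<pi>\<in>bc_components. ((\<lambda>R. sq_norm (gauss \<sigma>) (\<lambda>x. \<pi> (F R x))) \<longlongrightarrow> 0) A) \<longleftrightarrow>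
      (N bc_plus \<longlongrightarrow> 0) A \<and> (N bc_minus \<longlongrightarrow> 0) A"
    by (auto simp: bc_components_def)
  also have "\<dots> \<longleftrightarrow> ((\<lambda>R. sqrt (c * (N bc_plus R + N bc_minus R))) \<longlongrightarrow> 0) A"
  proof
    assume "(N bc_plus \<longlongrightarrow> 0) A \<and> (N bc_minus \<longlongrightarrow> 0) A"
    then have "((\<lambda>R. sqrt (c * (N bc_plus R + N bc_minus R))) \<longlongrightarrow> sqrt (c * (0 + 0))) A"
      by (intro tendsto_intros) auto
    then show "((\<lambda>R. sqrt (c * (N bc_plus R + N bc_minus R))) \<longlongrightarrow> 0) A" by simp
  next
    assume "((\<lambda>R. sqrt (c * (N bc_plus R + N bc_minus R))) \<longlongrightarrow> 0) A"
    then have "((\<lambda>R. (sqrt (c * (N bc_plus R + N bc_minus R)))\<^sup>2 / c) \<longlongrightarrow> 0\<^sup>2 / c) A"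
      using \<open>c > 0\<close> by (intro tendsto_intros) auto
    then have lim: "((\<lambda>R. N bc_plus R + N bc_minus R) \<longlongrightarrow> 0) A"
      using \<open>c > 0\<close> N by simp
    have "(N \<pi> \<longlongrightarrow> 0) A" if "\<And>R. N \<pi> R \<le> N bc_plus R + N bc_minus R" for \<pi>
      by (rule tendsto_sandwich[OF _ _ tendsto_const lim]) (use N that in auto)
    then show "(N bc_plus \<longlongrightarrow> 0) A \<and> (N bc_minus \<longlongrightarrow> 0) A" using N by simp
  qed
  also have "\<dots> \<longleftrightarrow> ((\<lambda>R. L2T_norm \<sigma> (F R)) \<longlongrightarrow> 0) A"
    by (rule tendsto_cong) (use norm in eventually_elim, simp)
  finally show ?thesis by simp
qed

lemma component_segal_bargmann:
  assumes \<pi>: "\<pi> \<in> bc_components" and \<phi>: "\<phi> \<in> L2T \<sigma>" and "\<sigma> > 0"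
  shows "\<pi> (segal_bargmann \<sigma> \<nu> \<phi> Z) = bargmann \<sigma> (sqrt (\<nu> / (4 * \<sigma>))) (\<lambda>x. \<pi> (\<phi> x)) (\<pi> Z)"
proof -
  have comp: "\<pi>' (bc_exp (- (\<sigma> *\<^sub>R bc_sq (bc_of_real x - sqrt (\<nu> / (4 * \<sigma>)) *\<^sub>R Z))) *\<^sub>T \<phi> x) =
      exp (- (of_real \<sigma> * (of_real x - of_real (sqrt (\<nu> / (4 * \<sigma>))) * \<pi>' Z)\<^sup>2)) * \<pi>' (\<phi> x)"
    if "\<pi>' \<in> bc_components" for \<pi>' x
    using that by (simp only: component_simps component_linear)
  have "integrable lborel (\<lambda>x. bc_exp (- (\<sigma> *\<^sub>R bc_sq (bc_of_real x - sqrt (\<nu> / (4 * \<sigma>)) *\<^sub>R Z))) *\<^sub>T \<phi> x)"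
    unfolding integrable_bc_iff using \<phi> \<open>\<sigma> > 0\<close>
    by (auto simp only: comp L2T_iff intro!: bargmann_integrable)
  then show ?thesis
    using \<pi> unfolding segal_bargmann_def bargmann_def
    by (simp only: component_linear component_integral comp)
qed

lemma component_frft_kernel:
  assumes "\<pi> \<in> bc_components"
  shows "\<pi> (frft_kernel \<sigma> \<theta> x y) = frt_kernel \<sigma> (\<pi> \<theta>) x y"
  using assms by (simp add: frft_kernel_def frt_kernel_def component_simps component_linear)

text \<open>
  Without integrability of the bicomplex integrand its integral has the default value \<open>0\<close>, even if one
  of the two components is integrable on its own.
\<close>

lemma component_frft_integral:
  assumes \<pi>: "\<pi> \<in> bc_components" and int: "integrable lborel (\<lambda>x. indicator A x *\<^sub>R (\<psi> x *\<^sub>T frft_kernel \<sigma> \<theta> x y))"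
  shows "\<pi> (frft_integral A \<sigma> \<theta> \<psi> y) = frt A \<sigma> (\<pi> \<theta>) (\<lambda>x. \<pi> (\<psi> x)) y"
  using \<pi> unfolding frft_integral_def frt_def set_lebesgue_integral_def
  by (simp add: component_simps component_linear component_integral[OF \<pi> int] component_frft_kernel of_real_indicator)

text \<open>
  Bicomplex division is componentwise, so the difference quotient has the complex difference quotients
  as its components; outside the null cone neither denominator vanishes.
\<close>

lemma bc_holomorphic_of_components:
  assumes F: "\<And>\<pi>. \<pi> \<in> bc_components \<Longrightarrow> F \<pi> holomorphic_on UNIV"
    and f: "\<And>\<pi> Z. \<pi> \<in> bc_components \<Longrightarrow> \<pi> (f Z) = F \<pi> (\<pi> Z)"
  shows "bc_holomorphic f"
  unfolding bc_holomorphic_def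
proof
  fix Z0
  define q where "q \<pi> H = (F \<pi> (\<pi> Z0 + \<pi> H) - F \<pi> (\<pi> Z0)) / \<pi> H" for \<pi> H
  have eq: "(f (Z0 + H) - f Z0) /\<^sub>T H = bc_idem (q bc_plus H) (q bc_minus H)" for H
    unfolding bc_div_def q_def using f component_linear by (simp add: bc_components_def)
  have lim: "(q \<pi> \<longlongrightarrow> deriv (F \<pi>) (\<pi> Z0)) (at 0 within - null_cone)" if \<pi>: "\<pi> \<in> bc_components" for \<pi>
  proof -
    have "(F \<pi> has_field_derivative deriv (F \<pi>) (\<pi> Z0)) (at (\<pi> Z0))"
      using F[OF \<pi>] by (auto intro: holomorphic_derivI)
    then have d: "((\<lambda>h. (F \<pi> (\<pi> Z0 + h) - F \<pi> (\<pi> Z0)) / h) \<longlongrightarrow> deriv (F \<pi>) (\<pi> Z0)) (at 0)"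
      by (simp add: DERIV_def)
    have "filterlim \<pi> (at 0) (at 0 within - null_cone)"
      unfolding filterlim_at
    proof
      show "\<forall>\<^sub>F H in at 0 within - null_cone. \<pi> H \<in> UNIV \<and> \<pi> H \<noteq> 0"
        using \<pi> by (auto simp: eventually_at_filter null_cone_def bc_components_def)
      have "(\<pi> \<longlongrightarrow> \<pi> 0) (at 0 within - null_cone)"
        by (rule bounded_linear.tendsto[OF bounded_linear_component[OF \<pi>]]) (rule tendsto_ident_at)
      then show "(\<pi> \<longlongrightarrow> 0) (at 0 within - null_cone)" by (simp add: component_linear \<pi>)
    qed
    from filterlim_compose[OF d this] show ?thesis by (simp add: q_def [abs_def])
  qed
  have "((\<lambda>H. bc_idem (q bc_plus H) (q bc_minus H)) \<longlongrightarrow>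
      bc_idem (deriv (F bc_plus) (bc_plus Z0)) (deriv (F bc_minus) (bc_minus Z0))) (at 0 within - null_cone)"
    unfolding bc_idem_eq using lim by (intro tendsto_intros) (auto simp: bc_components_def)
  then show "\<exists>L. ((\<lambda>H. (f (Z0 + H) - f Z0) /\<^sub>T H) \<longlongrightarrow> L) (at 0 within - null_cone)"
    unfolding eq by blast
qed

lemma norm_bc_components: "(norm Z)\<^sup>2 = ((cmod (bc_plus Z))\<^sup>2 + (cmod (bc_minus Z))\<^sup>2) / 2"
  by (cases Z, simp add: norm_Pair bc_plus_def bc_minus_def cmod_power2)
     (simp add: power2_eq_square algebra_simps)

lemma segal_bargmann_in_F2T:
  assumes \<phi>: "\<phi> \<in> L2T \<sigma>" and "\<sigma> > 0" "\<nu> > 0"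
  shows "segal_bargmann \<sigma> \<nu> \<phi> \<in> F2T \<nu>"
proof -
  define c where "c = sqrt (\<nu> / (4 * \<sigma>))"
  have "c > 0" using assms by (simp add: c_def)
  have c2: "2 * \<sigma> * c\<^sup>2 = \<nu> / 2" using assms by (simp add: c_def)
  define B where "B \<pi> = bargmann \<sigma> c (\<lambda>x. \<pi> (\<phi> x))" for \<pi> :: "bicomplex \<Rightarrow> complex"
  have comp: "\<pi> (segal_bargmann \<sigma> \<nu> \<phi> Z) = B \<pi> (\<pi> Z)" if "\<pi> \<in> bc_components" for \<pi> Z
    using that assms by (simp add: component_segal_bargmann B_def c_def)
  have L2: "(\<lambda>x. \<pi> (\<phi> x)) \<in> L2G \<sigma>" if "\<pi> \<in> bc_components" for \<pi>
    using that \<phi> by (simp add: L2T_iff)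
  have hol: "B \<pi> holomorphic_on UNIV" if "\<pi> \<in> bc_components" for \<pi>
    unfolding B_def using L2[OF that] \<open>\<sigma> > 0\<close> \<open>c > 0\<close> by (rule bargmann_holomorphic)
  have B_meas [measurable]: "B \<pi> \<in> borel_measurable borel" if "\<pi> \<in> bc_components" for \<pi>
    unfolding B_def using L2[OF that] \<open>\<sigma> > 0\<close> \<open>c > 0\<close> by (rule borel_measurable_bargmann)
  have meas: "segal_bargmann \<sigma> \<nu> \<phi> \<in> borel_measurable borel"
    unfolding borel_measurable_bc_iff by (auto simp: comp intro: measurable_compose[OF component_measurable' B_meas])
  have "integrable lborel (\<lambda>Z. exp (- \<nu> * (norm Z)\<^sup>2) *\<^sub>R (segal_bargmann \<sigma> \<nu> \<phi> Z *\<^sub>T bc_conj (segal_bargmann \<sigma> \<nu> \<phi> Z)))"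
    unfolding integrable_bc_iff
  proof
    fix \<pi> assume \<pi>: "\<pi> \<in> bc_components"
    note [measurable] = B_meas[OF \<pi>] component_measurable'[OF \<pi>]
    define H where "H z = ennreal ((cmod (B \<pi> z))\<^sup>2 * exp (- (2 * \<sigma> * c\<^sup>2) * (cmod z)\<^sup>2))" for z
    have [measurable]: "H \<in> borel_measurable borel" unfolding H_def by measurable
    have H: "(\<integral>\<^sup>+z. H z \<partial>lborel) < \<infinity>"
      unfolding H_def B_def by (rule bargmann_fock_finite[OF L2[OF \<pi>] \<open>\<sigma> > 0\<close> \<open>c > 0\<close>])
    \<comment> \<open>The projection \<open>\<pi>\<close> corresponds to \<open>\<omega> = \<i>\<close> or \<open>\<omega> = - \<i>\<close>, and \<open>fst Z + \<omega> * snd Z\<close> is the other coordinate.\<close>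
    obtain \<omega> where \<omega>: "cmod \<omega> = 1" and \<pi>_eq: "\<And>Z. \<pi> Z = fst Z - \<omega> * snd Z"
      and norm: "\<And>Z. (norm Z)\<^sup>2 = ((cmod (\<pi> Z))\<^sup>2 + (cmod (fst Z + \<omega> * snd Z))\<^sup>2) / 2"
    proof -
      consider "\<pi> = bc_plus" | "\<pi> = bc_minus" using \<pi> by (auto simp: bc_components_def)
      then show ?thesis
      proof cases
        case 1
        then show ?thesis
          by (intro that[of \<i>]) (simp_all add: norm_bc_components bc_plus_def bc_minus_def)
      next
        case 2
        then show ?thesis
          by (intro that[of "- \<i>"]) (simp_all add: norm_bc_components bc_plus_def bc_minus_def)
      qed
    qed
    let ?g = "\<lambda>Z. (cmod (B \<pi> (\<pi> Z)))\<^sup>2 * exp (- \<nu> * (norm Z)\<^sup>2)"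
    have "integrable lborel ?g"
    proof (rule integrableI_bounded)
      have "ennreal (norm (?g Z)) = H (fst Z - \<omega> * snd Z) * ennreal (exp (- (\<nu> / 2) * (cmod (fst Z + \<omega> * snd Z))\<^sup>2))" for Z
      proof -
        have "exp (- \<nu> * (norm Z)\<^sup>2) = exp (- (2 * \<sigma> * c\<^sup>2) * (cmod (\<pi> Z))\<^sup>2) * exp (- (\<nu> / 2) * (cmod (fst Z + \<omega> * snd Z))\<^sup>2)"
          unfolding norm c2 exp_add [symmetric] by (simp add: field_simps)
        then show ?thesis
          unfolding H_def by (simp add: \<pi>_eq mult.assoc flip: ennreal_mult)
      qed
      then show "(\<integral>\<^sup>+Z. ennreal (norm (?g Z)) \<partial>lborel) < \<infinity>"
        using nn_integral_idempotent_gaussian_finite[OF _ H _ \<omega>, of "\<nu> / 2"] \<open>\<nu> > 0\<close> by simp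
    qed simp
    then have "integrable lborel (\<lambda>Z. complex_of_real (?g Z))" by (rule integrable_of_real)
    moreover have "\<pi> (exp (- \<nu> * (norm Z)\<^sup>2) *\<^sub>R (segal_bargmann \<sigma> \<nu> \<phi> Z *\<^sub>T bc_conj (segal_bargmann \<sigma> \<nu> \<phi> Z))) = of_real (?g Z)" for Z
      using \<pi> by (simp add: component_simps component_linear comp complex_norm_square[symmetric] mult.commute)
    ultimately show "integrable lborel (\<lambda>Z. \<pi> (exp (- \<nu> * (norm Z)\<^sup>2) *\<^sub>R (segal_bargmann \<sigma> \<nu> \<phi> Z *\<^sub>T bc_conj (segal_bargmann \<sigma> \<nu> \<phi> Z))))"
      by simp
  qed
  moreover have "bc_holomorphic (segal_bargmann \<sigma> \<nu> \<phi>)"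
    by (rule bc_holomorphic_of_components[OF hol comp])
  ultimately show ?thesis using meas by (simp add: F2T_def H2T_def)
qed

text \<open>
  The points \<open>bc_idem z z\<close> already show all values of the transforms of both components.
\<close>

lemma segal_bargmann_inj:
  assumes "\<phi> \<in> L2T \<sigma>" "\<psi> \<in> L2T \<sigma>" and "\<sigma> > 0" "\<nu> > 0"
    and eq: "segal_bargmann \<sigma> \<nu> \<phi> = segal_bargmann \<sigma> \<nu> \<psi>"
  shows "AE x in lborel. \<phi> x = \<psi> x"
proof -
  have "AE x in lborel. \<pi> (\<phi> x) = \<pi> (\<psi> x)" if \<pi>: "\<pi> \<in> bc_components" for \<pi>
  proof -
    let ?c = "sqrt (\<nu> / (4 * \<sigma>))"
    show ?thesis
    proof (rule bargmann_inj[of _ \<sigma> _ ?c])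
    show "?c > 0" using assms by simp
    show "bargmann \<sigma> ?c (\<lambda>x. \<pi> (\<phi> x)) z = bargmann \<sigma> ?c (\<lambda>x. \<pi> (\<psi> x)) z" for z
      using component_segal_bargmann[OF \<pi> assms(1,3), of \<nu> "bc_idem z z"]
        component_segal_bargmann[OF \<pi> assms(2,3), of \<nu> "bc_idem z z"]
      by (simp add: eq component_simps[OF \<pi>])
    qed (use assms \<pi> in \<open>auto simp: L2T_iff\<close>)
  qed
  from this[of bc_plus] this[of bc_minus] show ?thesis
    by (simp add: bc_eq_iff_components bc_components_def AE_conj_iff)
qed

section \<open>The bicomplex fractional Fourier transform\<close>

lemma frt_parameter_component:
  assumes "\<sigma> > 0" "\<theta> \<in> bc_torus" "bc_one - bc_sq \<theta> \<notin> null_cone" and \<pi>: "\<pi> \<in> bc_components"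
  shows "frt_parameter \<sigma> (\<pi> \<theta>)"
proof
  show "cmod (\<pi> \<theta>) = 1" using assms by (auto simp: bc_torus_def bc_components_def)
  have "\<pi> (bc_one - bc_sq \<theta>) \<noteq> 0" using assms by (auto simp: null_cone_def bc_components_def)
  then show "(\<pi> \<theta>)\<^sup>2 \<noteq> 1" using \<pi> by (auto simp: component_linear component_simps)
qed fact

text \<open>
  Over a set of finite measure both components of the integrand are chirped functions times characters,
  which are integrable.
\<close>

lemma component_frft_integral_bounded:
  assumes \<psi>: "\<psi> \<in> L2T \<sigma>" and \<pi>: "\<pi> \<in> bc_components" and [measurable]: "A \<in> sets borel" and fin: "emeasure lborel A < \<infinity>"
    and par: "\<And>\<pi>. \<pi> \<in> bc_components \<Longrightarrow> frt_parameter \<sigma> (\<pi> \<theta>)"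
  shows "\<pi> (frft_integral A \<sigma> \<theta> \<psi> y) = frt A \<sigma> (\<pi> \<theta>) (\<lambda>x. \<pi> (\<psi> x)) y"
proof (rule component_frft_integral[OF \<pi>], unfold integrable_bc_iff, rule ballI)
  fix \<pi>' assume \<pi>': "\<pi>' \<in> bc_components"
  interpret frt_parameter \<sigma> "\<pi>' \<theta>" by (rule par[OF \<pi>'])
  let ?f = "\<lambda>x. \<pi>' (\<psi> x)"
  have "?f \<in> L2G \<sigma>" using \<psi> \<pi>' by (simp add: L2T_iff)
  then have "integrable lborel (\<lambda>x. exp (- (\<gamma> * (\<pi>' \<theta>)\<^sup>2) * (of_real y)\<^sup>2) * (chirped A ?f x * cis (s * y * x)))"
    using fin by (intro integrable_mult_right integrable_mult_cis integrable_chirped) simp_all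
  moreover have "\<pi>' (indicator A x *\<^sub>R (\<psi> x *\<^sub>T frft_kernel \<sigma> \<theta> x y)) =
      exp (- (\<gamma> * (\<pi>' \<theta>)\<^sup>2) * (of_real y)\<^sup>2) * (chirped A ?f x * cis (s * y * x))" for x
    using \<pi>' by (simp add: component_linear component_simps component_frft_kernel frt_kernel_factor
        chirped_def of_real_indicator mult_ac)
  ultimately show "integrable lborel (\<lambda>x. \<pi>' (indicator A x *\<^sub>R (\<psi> x *\<^sub>T frft_kernel \<sigma> \<theta> x y)))"
    by simp
qed

lemma is_frft_iff_components:
  assumes "\<sigma> > 0" and \<psi>: "\<psi> \<in> L2T \<sigma>"
    and par: "\<And>\<pi>. \<pi> \<in> bc_components \<Longrightarrow> frt_parameter \<sigma> (\<pi> \<theta>)"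
  shows "is_frft \<sigma> \<theta> \<psi> g \<longleftrightarrow> (\<forall>\<pi>\<in>bc_components. is_frt \<sigma> (\<pi> \<theta>) (\<lambda>x. \<pi> (\<psi> x)) (\<lambda>x. \<pi> (g x)))"
proof -
  let ?F = "\<lambda>R. frft_integral {-R..R} \<sigma> \<theta> \<psi>"
  have comp: "\<pi> (?F R y) = frt {-R..R} \<sigma> (\<pi> \<theta>) (\<lambda>x. \<pi> (\<psi> x)) y" if "\<pi> \<in> bc_components" for \<pi> R y
    by (rule component_frft_integral_bounded[OF \<psi> that _ _ par]) (simp_all add: emeasure_lborel_Icc_eq)
  have F: "?F R \<in> L2T \<sigma>" for R
  proof -
    have "frt {-R..R} \<sigma> (\<pi> \<theta>) (\<lambda>x. \<pi> (\<psi> x)) \<in> L2G \<sigma>" if \<pi>: "\<pi> \<in> bc_components" for \<pi>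
      using \<psi> \<pi> by (intro frt_parameter.frt_in_L2G[OF par[OF \<pi>]]) (auto simp: L2T_iff emeasure_lborel_Icc_eq)
    then show ?thesis by (simp add: L2T_iff comp)
  qed
  have "is_frft \<sigma> \<theta> \<psi> g \<longleftrightarrow> g \<in> L2T \<sigma> \<and> ((\<lambda>R. L2T_norm \<sigma> (\<lambda>y. ?F R y - g y)) \<longlongrightarrow> 0) at_top"
    by (simp add: is_frft_def F)
  also have "\<dots> \<longleftrightarrow> g \<in> L2T \<sigma> \<and> (\<forall>\<pi>\<in>bc_components. ((\<lambda>R. sq_norm (gauss \<sigma>) (\<lambda>y. \<pi> (?F R y - g y))) \<longlongrightarrow> 0) at_top)"
    by (intro conj_cong refl L2T_norm_tendsto_iff[OF \<open>\<sigma> > 0\<close>] always_eventually allI L2T_diff F)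
  also have "\<dots> \<longleftrightarrow> (\<forall>\<pi>\<in>bc_components. is_frt \<sigma> (\<pi> \<theta>) (\<lambda>x. \<pi> (\<psi> x)) (\<lambda>x. \<pi> (g x)))"
    using F unfolding is_frt_def by (auto simp: L2T_iff comp component_linear)
  finally show ?thesis .
qed

lemma frft_integral_cong_AE:
  assumes \<psi>: "\<psi> \<in> L2T \<sigma>" "\<psi>' \<in> L2T \<sigma>" and eq: "AE x in lborel. \<psi> x = \<psi>' x" and [measurable]: "A \<in> sets borel"
  shows "frft_integral A \<sigma> \<theta> \<psi> = frft_integral A \<sigma> \<theta> \<psi>'"
proof -
  have meas: "(\<lambda>x. indicator A x *\<^sub>R (\<phi> x *\<^sub>T frft_kernel \<sigma> \<theta> x y)) \<in> borel_measurable lborel"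
    if \<phi>: "\<phi> \<in> L2T \<sigma>" for \<phi> y
    unfolding borel_measurable_bc_iff
  proof
    fix \<pi> assume \<pi>: "\<pi> \<in> bc_components"
    then have [measurable]: "(\<lambda>x. \<pi> (\<phi> x)) \<in> borel_measurable borel"
      using \<phi> by (simp add: L2T_iff L2G_def)
    have [measurable]: "(\<lambda>x. frt_kernel \<sigma> (\<pi> \<theta>) x y) \<in> borel_measurable borel"
      unfolding frt_kernel_def by measurable
    show "(\<lambda>x. \<pi> (indicator A x *\<^sub>R (\<phi> x *\<^sub>T frft_kernel \<sigma> \<theta> x y))) \<in> borel_measurable lborel"
      by (simp add: component_linear component_simps component_frft_kernel \<pi>)
  qed
  have "(LINT x:A|lborel. \<psi> x *\<^sub>T frft_kernel \<sigma> \<theta> x y) = (LINT x:A|lborel. \<psi>' x *\<^sub>T frft_kernel \<sigma> \<theta> x y)" for y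
    unfolding set_lebesgue_integral_def
    by (intro integral_cong_AE meas \<psi>) (use eq in eventually_elim, simp)
  then show ?thesis by (simp add: frft_integral_def fun_eq_iff)
qed

text \<open>
  The properties of the transform itself are those of its two components. For the identity with the
  Segal--Bargmann transform it is shown that \<open>frft \<sigma> \<theta> \<psi>\<close> is a preimage of \<open>Gamma_op \<theta> (segal_bargmann \<sigma> \<nu> \<psi>)\<close>;
  by injectivity it then agrees almost everywhere with the preimage chosen by \<open>inv_into\<close>.
\<close>

theorem theorem6p1:
  fixes \<sigma> \<nu> :: real and \<theta> :: bicomplex
  assumes "\<sigma> > 0" and "\<nu> > 0"
    and "\<theta> \<in> bc_torus"
    and "\<theta> \<noteq> bc_one" and "\<theta> \<noteq> - bc_one" and "\<theta> \<noteq> bc_ij" and "\<theta> \<noteq> - bc_ij"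
    and "bc_one - bc_sq \<theta> \<notin> null_cone"
  shows
    "(\<forall>\<psi>\<in>L2T \<sigma>.
        is_frft \<sigma> \<theta> \<psi> (frft \<sigma> \<theta> \<psi>) \<and>
        (\<forall>g. is_frft \<sigma> \<theta> \<psi> g \<longrightarrow> (AE y in lborel. g y = frft \<sigma> \<theta> \<psi> y)) \<and>
        (\<forall>\<psi>'\<in>L2T \<sigma>. (AE x in lborel. \<psi> x = \<psi>' x) \<longrightarrow>
           (AE y in lborel. frft \<sigma> \<theta> \<psi> y = frft \<sigma> \<theta> \<psi>' y)) \<and>
        (AE y in lborel. integrable lborel (\<lambda>x. \<psi> x *\<^sub>T frft_kernel \<sigma> \<theta> x y) \<longrightarrow>
           frft \<sigma> \<theta> \<psi> y = frft_integral UNIV \<sigma> \<theta> \<psi> y)) \<and>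
     (\<forall>\<psi>\<in>L2T \<sigma>.
        Gamma_op \<theta> (segal_bargmann \<sigma> \<nu> \<psi>) \<in> F2T \<nu> \<inter> segal_bargmann \<sigma> \<nu> ` L2T \<sigma> \<and>
        (AE x in lborel.
           frft \<sigma> \<theta> \<psi> x = segal_bargmann_inv \<sigma> \<nu> (Gamma_op \<theta> (segal_bargmann \<sigma> \<nu> \<psi>)) x))"
proof -
  have par: "frt_parameter \<sigma> (\<pi> \<theta>)" if "\<pi> \<in> bc_components" for \<pi>
    using assms that by (intro frt_parameter_component)
  have L2: "(\<lambda>x. \<pi> (\<psi> x)) \<in> L2G \<sigma>" if "\<psi> \<in> L2T \<sigma>" "\<pi> \<in> bc_components" for \<psi> \<pi>
    using that by (simp add: L2T_iff)
  have iff: "is_frft \<sigma> \<theta> \<psi> g \<longleftrightarrow> (\<forall>\<pi>\<in>bc_components. is_frt \<sigma> (\<pi> \<theta>) (\<lambda>x. \<pi> (\<psi> x)) (\<lambda>x. \<pi> (g x)))"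
    if "\<psi> \<in> L2T \<sigma>" for \<psi> g
    using \<open>\<sigma> > 0\<close> that par by (rule is_frft_iff_components)
  have AE_eq: "AE y in lborel. g y = h y"
    if "\<And>\<pi>. \<pi> \<in> bc_components \<Longrightarrow> AE y in lborel. \<pi> (g y) = \<pi> (h y)" for g h :: "real \<Rightarrow> bicomplex"
    using that[of bc_plus] that[of bc_minus]
    by (simp add: bc_eq_iff_components bc_components_def AE_conj_iff)
  have frft: "is_frft \<sigma> \<theta> \<psi> (frft \<sigma> \<theta> \<psi>)" if \<psi>: "\<psi> \<in> L2T \<sigma>" for \<psi>
  proof -
    have "\<exists>h. is_frt \<sigma> (\<pi> \<theta>) (\<lambda>x. \<pi> (\<psi> x)) h" if "\<pi> \<in> bc_components" for \<pi>
      using frt_parameter.is_frt_exists[OF par[OF that] L2[OF \<psi> that]] .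
    then obtain h where h: "\<And>\<pi>. \<pi> \<in> bc_components \<Longrightarrow> is_frt \<sigma> (\<pi> \<theta>) (\<lambda>x. \<pi> (\<psi> x)) (h \<pi>)"
      by metis
    have "is_frft \<sigma> \<theta> \<psi> (\<lambda>y. bc_idem (h bc_plus y) (h bc_minus y))"
      unfolding iff[OF \<psi>] using h by (auto simp: bc_components_def)
    then show ?thesis unfolding frft_def by (rule someI[of "is_frft \<sigma> \<theta> \<psi>"])
  qed
  have frt: "is_frt \<sigma> (\<pi> \<theta>) (\<lambda>x. \<pi> (\<psi> x)) (\<lambda>x. \<pi> (frft \<sigma> \<theta> \<psi> x))" if "\<psi> \<in> L2T \<sigma>" "\<pi> \<in> bc_components" for \<psi> \<pi>
    using frft[OF that(1)] iff[OF that(1)] that(2) by blast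
  have unique: "AE y in lborel. g y = frft \<sigma> \<theta> \<psi> y" if \<psi>: "\<psi> \<in> L2T \<sigma>" and g: "is_frft \<sigma> \<theta> \<psi> g" for \<psi> g
  proof (rule AE_eq)
    fix \<pi> assume \<pi>: "\<pi> \<in> bc_components"
    show "AE y in lborel. \<pi> (g y) = \<pi> (frft \<sigma> \<theta> \<psi> y)"
      using g \<pi> unfolding iff[OF \<psi>]
      by (intro frt_parameter.is_frt_unique[OF par[OF \<pi>] L2[OF \<psi> \<pi>] _ frt[OF \<psi> \<pi>]]) blast
  qed
  have cong: "frft \<sigma> \<theta> \<psi> = frft \<sigma> \<theta> \<psi>'"
    if "\<psi> \<in> L2T \<sigma>" "\<psi>' \<in> L2T \<sigma>" "AE x in lborel. \<psi> x = \<psi>' x" for \<psi> \<psi>'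
  proof -
    have "frft_integral {-R..R} \<sigma> \<theta> \<psi> = frft_integral {-R..R} \<sigma> \<theta> \<psi>'" for R
      by (rule frft_integral_cong_AE[OF that]) simp
    then have "is_frft \<sigma> \<theta> \<psi> = is_frft \<sigma> \<theta> \<psi>'"
      by (intro ext) (simp only: is_frft_def)
    then show ?thesis by (simp add: frft_def)
  qed
  have integral: "AE y in lborel. integrable lborel (\<lambda>x. \<psi> x *\<^sub>T frft_kernel \<sigma> \<theta> x y) \<longrightarrow>
      frft \<sigma> \<theta> \<psi> y = frft_integral UNIV \<sigma> \<theta> \<psi> y" if \<psi>: "\<psi> \<in> L2T \<sigma>" for \<psi>
  proof -
    have "AE y in lborel. integrable lborel (\<lambda>x. \<psi> x *\<^sub>T frft_kernel \<sigma> \<theta> x y) \<longrightarrow>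
        \<pi> (frft \<sigma> \<theta> \<psi> y) = \<pi> (frft_integral UNIV \<sigma> \<theta> \<psi> y)" if \<pi>: "\<pi> \<in> bc_components" for \<pi>
      using frt_parameter.is_frt_AE_eq_integral[OF par[OF \<pi>] L2[OF \<psi> \<pi>] frt[OF \<psi> \<pi>]]
    proof eventually_elim
      case (elim y)
      show ?case
      proof
        assume int: "integrable lborel (\<lambda>x. \<psi> x *\<^sub>T frft_kernel \<sigma> \<theta> x y)"
        then have "integrable lborel (\<lambda>x. \<pi> (\<psi> x) * frt_kernel \<sigma> (\<pi> \<theta>) x y)"
          using \<pi> unfolding integrable_bc_iff by (auto simp: component_simps component_frft_kernel)
        with elim int show "\<pi> (frft \<sigma> \<theta> \<psi> y) = \<pi> (frft_integral UNIV \<sigma> \<theta> \<psi> y)"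
          by (simp add: component_frft_integral \<pi>)
      qed
    qed
    from this[of bc_plus] this[of bc_minus] show ?thesis
      unfolding bc_components_def
    proof (simp, elim AE_mp, intro AE_I2 impI)
      fix y
      assume "integrable lborel (\<lambda>x. \<psi> x *\<^sub>T frft_kernel \<sigma> \<theta> x y) \<longrightarrow> bc_plus (frft \<sigma> \<theta> \<psi> y) = bc_plus (frft_integral UNIV \<sigma> \<theta> \<psi> y)"
        "integrable lborel (\<lambda>x. \<psi> x *\<^sub>T frft_kernel \<sigma> \<theta> x y) \<longrightarrow> bc_minus (frft \<sigma> \<theta> \<psi> y) = bc_minus (frft_integral UNIV \<sigma> \<theta> \<psi> y)"
        "integrable lborel (\<lambda>x. \<psi> x *\<^sub>T frft_kernel \<sigma> \<theta> x y)"
      then show "frft \<sigma> \<theta> \<psi> y = frft_integral UNIV \<sigma> \<theta> \<psi> y"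
        by (simp add: bc_eq_iff_components bc_components_def)
    qed
  qed
  have frft_L2T: "frft \<sigma> \<theta> \<psi> \<in> L2T \<sigma>" if "\<psi> \<in> L2T \<sigma>" for \<psi>
    using frft[OF that] by (simp add: is_frft_def)
  have Gamma: "Gamma_op \<theta> (segal_bargmann \<sigma> \<nu> \<psi>) = segal_bargmann \<sigma> \<nu> (frft \<sigma> \<theta> \<psi>)" if \<psi>: "\<psi> \<in> L2T \<sigma>" for \<psi>
  proof
    fix Z
    have "\<pi> (segal_bargmann \<sigma> \<nu> \<psi> (\<theta> *\<^sub>T Z)) = \<pi> (segal_bargmann \<sigma> \<nu> (frft \<sigma> \<theta> \<psi>) Z)" if \<pi>: "\<pi> \<in> bc_components" for \<pi>
      using frt_parameter.bargmann_is_frt[OF par[OF \<pi>] L2[OF \<psi> \<pi>] frt[OF \<psi> \<pi>]]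
      by (simp add: component_segal_bargmann[OF \<pi> _ \<open>\<sigma> > 0\<close>] \<psi> frft_L2T component_simps[OF \<pi>])
    then show "Gamma_op \<theta> (segal_bargmann \<sigma> \<nu> \<psi>) Z = segal_bargmann \<sigma> \<nu> (frft \<sigma> \<theta> \<psi>) Z"
      by (simp add: Gamma_op_def bc_eq_iff_components)
  qed
  have inv: "AE x in lborel. frft \<sigma> \<theta> \<psi> x = segal_bargmann_inv \<sigma> \<nu> (Gamma_op \<theta> (segal_bargmann \<sigma> \<nu> \<psi>)) x"
    if \<psi>: "\<psi> \<in> L2T \<sigma>" for \<psi>
  proof -
    have mem: "segal_bargmann \<sigma> \<nu> (frft \<sigma> \<theta> \<psi>) \<in> segal_bargmann \<sigma> \<nu> ` L2T \<sigma>"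
      using frft_L2T[OF \<psi>] by blast
    show ?thesis
      unfolding Gamma[OF \<psi>] segal_bargmann_inv_def
      by (rule segal_bargmann_inj[OF frft_L2T[OF \<psi>] inv_into_into[OF mem] \<open>\<sigma> > 0\<close> \<open>\<nu> > 0\<close>])
         (simp only: f_inv_into_f[OF mem])
  qed
  show ?thesis
  proof (intro conjI ballI allI impI)
    fix \<psi> \<psi>' assume "\<psi> \<in> L2T \<sigma>" "\<psi>' \<in> L2T \<sigma>" "AE x in lborel. \<psi> x = \<psi>' x"
    from cong[OF this] show "AE y in lborel. frft \<sigma> \<theta> \<psi> y = frft \<sigma> \<theta> \<psi>' y" by simp
  next
    fix \<psi> assume \<psi>: "\<psi> \<in> L2T \<sigma>"
    show "Gamma_op \<theta> (segal_bargmann \<sigma> \<nu> \<psi>) \<in> F2T \<nu> \<inter> segal_bargmann \<sigma> \<nu> ` L2T \<sigma>"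
      unfolding Gamma[OF \<psi>] using segal_bargmann_in_F2T[OF frft_L2T[OF \<psi>] \<open>\<sigma> > 0\<close> \<open>\<nu> > 0\<close>] frft_L2T[OF \<psi>]
      by (intro IntI imageI)
  qed (fact frft unique integral inv)+
qed

end
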